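(* Let $\mathbf{X}=(X,\delta_\mathbf{X})$ be a represented space whose representation $\delta_\mathbf{X}$ is effectively traceable. Then $\operatorname{Lusin}_\mathbf{X}$ is well-defined (i.e. every pair in its domain has at least one value) and computable.
   Context: A represented space is a pair $(X,\delta_X)$ with $\delta_X:\subseteq\mathbb{N}^\mathbb{N}\to X$ a partial surjection; a (multivalued) map is computable if some computable $F:\subseteq\mathbb{N}^\mathbb{N}\to\mathbb{N}^\mathbb{N}$ maps every name of an input to a name of some admissible output. $\mathcal{C}(\mathbf{X},\mathbf{Y})$ is the represented space of continuous functions, where $0^n1p$ names $f$ iff the $n$-th oracle Turing machine with oracle $p$ computes a realizer of $f$ (a map $F$ with $\delta_\mathbf{Y}(F(p))=f(\delta_\mathbf{X}(p))$ for $p\in\mathrm{dom}(\delta_\mathbf{X})$). $\langle\cdot,\cdot\rangle$ and $\langle p_0,p_1,\ldots\rangle$ are standard computable tuplings on $\mathbb{N}^\mathbb{N}$. $\mathbb{S}_{\Sigma^1_1}$ is the represented space on $\{\top,\bot\}$ where $p$ names $\top$ iff $p$ codes an ill-founded tree (on $\mathbb{N}$, in a standard coding) and names $\bot$ iff $p$ codes a well-founded tree; sets $A\subseteq X$ are identified with their characteristic functions $\chi_A$. The set $\mathrm{BC}\subseteq\mathbb{N}^\mathbb{N}$ of Borel codes is defined by: $p\in\mathrm{BC}_0$ iff $p(0)=0$; $p\in\mathrm{BC}_\alpha$ iff $p=1\langle p_0,p_1,\ldots\rangle$ and for every $n$ there is $\beta<\alpha$ with $p_n\in\mathrm{BC}_\beta$;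 $\mathrm{BC}=\bigcup_{\alpha\text{ countable}}\mathrm{BC}_\alpha$. $\mathbb{S}_\mathcal{B}=(\{\bot,\top\},\delta_\mathcal{B})$ where $\mathrm{dom}(\delta_\mathcal{B})=\mathrm{BC}$, $\delta_\mathcal{B}(0p)=\top$ and $\delta_\mathcal{B}(1\langle p_0,p_1,\ldots\rangle)=\bigvee_{i}\neg\delta_\mathcal{B}(p_i)$. A representation $\delta_\mathbf{X}$ is effectively traceable if there is a computable $T:\subseteq\mathbb{N}^\mathbb{N}\times\mathbb{N}^\mathbb{N}\to\mathbb{N}^\mathbb{N}$ with $\mathrm{dom}(T)=\mathrm{dom}(\delta_\mathbf{X})\times\mathbb{N}^\mathbb{N}$ and $\{T(p,q)\mid q\in\mathbb{N}^\mathbb{N}\}=\delta_\mathbf{X}^{-1}(\delta_\mathbf{X}(p))$ for all $p\in\mathrm{dom}(\delta_\mathbf{X})$. $\operatorname{Lusin}_\mathbf{X}:\subseteq\mathcal{C}(\mathbf{X},\mathbb{S}_{\Sigma^1_1})\times\mathcal{C}(\mathbf{X},\mathbb{S}_{\Sigma^1_1})\rightrightarrows\mathcal{C}(\mathbf{X},\mathbb{S}_\mathcal{B})$ has domain the pairs $(\chi_A,\chi_B)$ with $A\cap B=\emptyset$, and $\chi_C\in\operatorname{Lusin}_\mathbf{X}(\chi_A,\chi_B)$ iff $A\subseteq C$ and $C\cap B=\emptyset$. *)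

theory Defs
  imports Main "HOL-Library.Nat_Bijection" "HOL-Library.FuncSet" "HOL-Library.Sublist"
begin

type_synonym baire = "nat \<Rightarrow> nat"

definition cons_seq :: "nat \<Rightarrow> baire \<Rightarrow> baire" where
  "cons_seq a p = (\<lambda>n. case n of 0 \<Rightarrow> a | Suc m \<Rightarrow> p m)"

lemma cons_seq_0 [simp]: "cons_seq a p 0 = a"
  by (simp add: cons_seq_def)

definition pair_seq :: "baire \<Rightarrow> baire \<Rightarrow> baire" where
  "pair_seq p q = (\<lambda>n. if even n then p (n div 2) else q (n div 2))"

lemma pair_seq_inject [simp]: "pair_seq p q = pair_seq p' q' \<longleftrightarrow> p = p' \<and> q = q'"
proof
  assume eq: "pair_seq p q = pair_seq p' q'"
  have "p n = p' n \<and> q n = q' n" for n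
    using fun_cong[OF eq, of "2 * n"] fun_cong[OF eq, of "2 * n + 1"]
    by (simp add: pair_seq_def)
  then show "p = p' \<and> q = q'" by blast
qed simp

definition tuple_seq :: "(nat \<Rightarrow> baire) \<Rightarrow> baire" where
  "tuple_seq ps = (\<lambda>n. case prod_decode n of (i, j) \<Rightarrow> ps i j)"

lemma tuple_seq_inject [simp]: "tuple_seq ps = tuple_seq qs \<longleftrightarrow> ps = qs"
proof
  assume eq: "tuple_seq ps = tuple_seq qs"
  have "ps i j = qs i j" for i j
    using fun_cong[OF eq, of "prod_encode (i, j)"] by (simp add: tuple_seq_def)
  then show "ps = qs" by blast
qed simp

lemma cons_seq_inject [simp]:
  "cons_seq a p = cons_seq b q \<longleftrightarrow> a = b \<and> p = q"
proof
  assume eq: "cons_seq a p = cons_seq b q"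
  have "a = b \<and> p n = q n" for n
    using fun_cong[OF eq, of 0] fun_cong[OF eq, of "Suc n"] by (simp add: cons_seq_def)
  then show "a = b \<and> p = q" by blast
qed simp

text \<open>The partial function whose graph is \<open>R\<close>, for single-valued \<open>R\<close>.\<close>

definition pfun_of :: "('a \<Rightarrow> 'b \<Rightarrow> bool) \<Rightarrow> 'a \<rightharpoonup> 'b" where
  "pfun_of R a = (if \<exists>!b. R a b then Some (THE b. R a b) else None)"

lemma pfun_of_eq_Some:
  assumes "\<And>b b'. R a b \<Longrightarrow> R a b' \<Longrightarrow> b = b'"
  shows "pfun_of R a = Some b \<longleftrightarrow> R a b"
proof -
  have "(THE b. R a b) = b" if "R a b" for b
    using that assms by blast
  then show ?thesis
    using assms by (auto simp: pfun_of_def)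
qed


section \<open>Oracle Turing machines\<close>

text \<open>
  Deterministic multitape machines. A machine is a finite list of instructions, hence has finitely
  many states, symbols and tapes; these are named by natural numbers. Symbol \<open>0\<close> is the blank and
  natural numbers are written in unary with symbol \<open>1\<close>. Tapes are infinite in both directions:
  \<open>(l, r)\<close> is the tape with the contents \<open>rev l @ r\<close>, padded by blanks, and the head on the first
  cell of \<open>r\<close>. Tape \<open>0\<close> holds input and output, tape \<open>1\<close> is the oracle tape, all others are
  work tapes.
\<close>

type_synonym tape = "nat list \<times> nat list"

datatype dir = Left | Right

fun first_cell :: "nat list \<Rightarrow> nat" where
  "first_cell [] = 0"
| "first_cell (a # _) = a"

fun read_tape :: "tape \<Rightarrow> nat" where
  "read_tape (l, r) = first_cell r"

fun write_tape :: "nat \<Rightarrow> tape \<Rightarrow> tape" where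
  "write_tape b (l, r) = (l, b # tl r)"

fun move_tape :: "dir \<Rightarrow> tape \<Rightarrow> tape" where
  "move_tape Left (l, r) = (tl l, first_cell l # r)"
| "move_tape Right (l, r) = (first_cell r # l, tl r)"

definition unary :: "nat \<Rightarrow> tape" where
  "unary n = ([], replicate n 1)"

fun ones :: "tape \<Rightarrow> nat" where
  "ones (l, r) = count_list l 1 + count_list r 1"

text \<open>
  \<open>Act s i a b d s'\<close>: in state \<open>s\<close>, if the head of tape \<open>i\<close> reads \<open>a\<close>, write \<open>b\<close>, move that head in
  direction \<open>d\<close> and enter state \<open>s'\<close>.
  \<open>Query s s'\<close>: in state \<open>s\<close>, replace the number on the oracle tape by the oracle's value at that
  number and enter state \<open>s'\<close>.
\<close>

datatype instr = Act nat nat nat nat dir nat | Query nat nat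

type_synonym config = "nat \<times> (nat \<Rightarrow> tape)"

fun applicable :: "config \<Rightarrow> instr \<Rightarrow> bool" where
  "applicable (s, t) (Act s0 i a b d s') \<longleftrightarrow> s = s0 \<and> read_tape (t i) = a"
| "applicable (s, t) (Query s0 s') \<longleftrightarrow> s = s0"

fun exec :: "baire \<Rightarrow> config \<Rightarrow> instr \<Rightarrow> config" where
  "exec p (s, t) (Act s0 i a b d s') = (s', t(i := move_tape d (write_tape b (t i))))"
| "exec p (s, t) (Query s0 s') = (s', t(1 := unary (p (ones (t 1)))))"

text \<open>The first applicable instruction is executed; if there is none, the machine halts.\<close>

definition step :: "instr list \<Rightarrow> baire \<Rightarrow> config \<Rightarrow> config option" where
  "step M p c = map_option (exec p c) (find (applicable c) M)"

definition init_config :: "nat \<Rightarrow> config" where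
  "init_config k = (0, (\<lambda>_. ([], []))(0 := unary k))"

definition halts_with :: "instr list \<Rightarrow> baire \<Rightarrow> nat \<Rightarrow> nat \<Rightarrow> bool" where
  "halts_with M p k v \<longleftrightarrow>
     (\<exists>c. (\<lambda>c c'. step M p c = Some c')\<^sup>*\<^sup>* (init_config k) c \<and> step M p c = None \<and>
          ones (snd c 0) = v)"

text \<open>The partial map \<open>p \<mapsto> r\<close> on Baire space where the machine with oracle \<open>p\<close>
  computes \<open>k \<mapsto> r k\<close>.\<close>

definition machine_map :: "instr list \<Rightarrow> baire \<rightharpoonup> baire" where
  "machine_map M = pfun_of (\<lambda>p r. \<forall>k. halts_with M p k (r k))"

lemma halts_with_unique:
  assumes "halts_with M p k v" "halts_with M p k w"
  shows "v = w"
proof -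
  let ?R = "\<lambda>c c'. step M p c = Some c'"
  have *: "?R\<^sup>*\<^sup>* c d \<Longrightarrow> step M p d = None \<Longrightarrow> ?R\<^sup>*\<^sup>* c e \<Longrightarrow> step M p e = None \<Longrightarrow> d = e" for c d e
  proof (induction rule: converse_rtranclp_induct)
    case base
    then show ?case by (auto elim: converse_rtranclpE)
  next
    case (step c c')
    from step.prems(2,3) step.hyps(1) have "?R\<^sup>*\<^sup>* c' e"
      by (auto elim: converse_rtranclpE)
    with step show ?case by blast
  qed
  from assms obtain d e where
    "?R\<^sup>*\<^sup>* (init_config k) d" "step M p d = None" "ones (snd d 0) = v"
    "?R\<^sup>*\<^sup>* (init_config k) e" "step M p e = None" "ones (snd e 0) = w"
    unfolding halts_with_def by auto
  then show ?thesis using * by blast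
qed

lemma machine_map_eq_Some: "machine_map M p = Some r \<longleftrightarrow> (\<forall>k. halts_with M p k (r k))"
  unfolding machine_map_def
proof (rule pfun_of_eq_Some)
  fix r r' assume "\<forall>k. halts_with M p k (r k)" "\<forall>k. halts_with M p k (r' k)"
  then show "r = r'" by (intro ext halts_with_unique) auto
qed

definition instr_decode :: "nat \<Rightarrow> instr" where
  "instr_decode n =
     (case sum_decode n of
        Inl m \<Rightarrow>
          (let (s, m1) = prod_decode m; (i, m2) = prod_decode m1; (a, m3) = prod_decode m2;
               (b, m4) = prod_decode m3; (d, s') = prod_decode m4
           in Act s i a b (if d = 0 then Left else Right) s')
      | Inr m \<Rightarrow> (let (s, s') = prod_decode m in Query s s'))"

definition machine :: "nat \<Rightarrow> instr list" where
  "machine n = map instr_decode (list_decode n)"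

lemma machine_surj: "\<exists>n. machine n = M"
proof -
  have "\<exists>n. instr_decode n = I" for I
  proof (cases I)
    case (Act s i a b d s')
    define e where "e = (case d of Left \<Rightarrow> 0 | Right \<Rightarrow> (1 :: nat))"
    have "instr_decode (sum_encode (Inl (prod_encode (s, prod_encode (i, prod_encode (a,
            prod_encode (b, prod_encode (e, s')))))))) = I"
      by (cases d) (simp_all add: instr_decode_def e_def Act)
    then show ?thesis ..
  next
    case (Query s s')
    have "instr_decode (sum_encode (Inr (prod_encode (s, s')))) = I"
      by (simp add: instr_decode_def Query)
    then show ?thesis ..
  qed
  then obtain g where "instr_decode (g I) = I" for I
    by metis
  then have "machine (list_encode (map g M)) = M"
    by (simp add: machine_def comp_def)
  then show ?thesis ..
qed

text \<open>
  As usual for partial maps on Baire space, a machine computing \<open>F\<close> has to be correct on the domain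
  of \<open>F\<close>, and may behave arbitrarily elsewhere.
\<close>

definition computable :: "(baire \<rightharpoonup> baire) \<Rightarrow> bool" where
  "computable F \<longleftrightarrow> (\<exists>n. F \<subseteq>\<^sub>m machine_map (machine n))"

definition computable2 :: "(baire \<times> baire \<rightharpoonup> baire) \<Rightarrow> bool" where
  "computable2 F \<longleftrightarrow> (\<exists>G. computable G \<and> (\<forall>p q. (p, q) \<in> dom F \<longrightarrow> G (pair_seq p q) = F (p, q)))"


section \<open>Represented spaces\<close>

record 'a repspace =
  points :: "'a set"
  rep :: "baire \<rightharpoonup> 'a"

definition represented_space :: "'a repspace \<Rightarrow> bool" where
  "represented_space X \<longleftrightarrow> ran (rep X) = points X"

definition prod_space :: "'a repspace \<Rightarrow> 'b repspace \<Rightarrow> ('a \<times> 'b) repspace" where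
  "prod_space X Y =
     \<lparr>points = points X \<times> points Y,
      rep = pfun_of (\<lambda>r (x, y). \<exists>p q. r = pair_seq p q \<and> rep X p = Some x \<and> rep Y q = Some y)\<rparr>"

lemma rep_prod_space_eq_Some:
  "rep (prod_space X Y) r = Some (x, y) \<longleftrightarrow>
     (\<exists>p q. r = pair_seq p q \<and> rep X p = Some x \<and> rep Y q = Some y)"
  unfolding prod_space_def by (simp, subst pfun_of_eq_Some) auto

definition realizes :: "(baire \<rightharpoonup> baire) \<Rightarrow> 'a repspace \<Rightarrow> 'b repspace \<Rightarrow> ('a \<Rightarrow> 'b) \<Rightarrow> bool" where
  "realizes F X Y f \<longleftrightarrow>
     (\<forall>p x. rep X p = Some x \<longrightarrow> (\<exists>q. F p = Some q \<and> rep Y q = Some (f x)))"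

text \<open>
  \<open>fun_name X Y r f\<close>: \<open>r = 0\<^sup>n1p\<close> and the \<open>n\<close>-th machine with oracle \<open>p\<close> computes a
  realizer of \<open>f\<close>. A machine with oracle \<open>p\<close> working on \<open>q\<close> is a machine with oracle
  \<open>\<langle>p, q\<rangle>\<close>. Functions on \<open>X\<close> are extensional.
\<close>

definition fun_name :: "'a repspace \<Rightarrow> 'b repspace \<Rightarrow> baire \<Rightarrow> ('a \<Rightarrow> 'b) \<Rightarrow> bool" where
  "fun_name X Y r f \<longleftrightarrow> f \<in> points X \<rightarrow>\<^sub>E points Y \<and>
     (\<exists>n p. r = (cons_seq 0 ^^ n) (cons_seq 1 p) \<and>
            realizes (\<lambda>q. machine_map (machine n) (pair_seq p q)) X Y f)"

text \<open>
  The continuous functions between represented spaces are those having a name: these are exactly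
  the functions with a continuous realizer.
\<close>

definition cont_space :: "'a repspace \<Rightarrow> 'b repspace \<Rightarrow> ('a \<Rightarrow> 'b) repspace" where
  "cont_space X Y = \<lparr>points = {f. \<exists>r. fun_name X Y r f}, rep = pfun_of (fun_name X Y)\<rparr>"

lemma zeros_one_inject:
  "(cons_seq 0 ^^ n) (cons_seq 1 p) = (cons_seq 0 ^^ m) (cons_seq 1 q) \<longleftrightarrow> n = m \<and> p = q"
proof (induction n m rule: diff_induct)
  case (1 n)
  then show ?case by (cases n) auto
qed auto

lemma rep_cont_space_eq_Some:
  assumes "represented_space X"
  shows "rep (cont_space X Y) r = Some f \<longleftrightarrow> fun_name X Y r f"
proof -
  have "f = g" if f: "fun_name X Y r f" and g: "fun_name X Y r g" for f g
  proof -
    have E: "f \<in> points X \<rightarrow>\<^sub>E points Y" "g \<in> points X \<rightarrow>\<^sub>E points Y"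
      using f g by (auto simp: fun_name_def)
    from f obtain n p where r: "r = (cons_seq 0 ^^ n) (cons_seq 1 p)"
      and "realizes (\<lambda>q. machine_map (machine n) (pair_seq p q)) X Y f" (is "realizes ?F _ _ _")
      by (auto simp: fun_name_def)
    moreover have "realizes ?F X Y g"
      using g unfolding fun_name_def r zeros_one_inject by auto
    ultimately have "f x = g x" if "rep X p = Some x" for p x
      using that by (fastforce simp: realizes_def)
    then have "f x = g x" if "x \<in> points X" for x
      using that assms by (force simp: represented_space_def ran_def)
    then show ?thesis using E by (rule PiE_ext[rotated 2])
  qed
  then show ?thesis
    unfolding cont_space_def by (simp add: pfun_of_eq_Some)
qed

text \<open>
  A partial multivalued map is given by its domain \<open>D\<close> and its sets of values \<open>F x\<close> for \<open>x \<in> D\<close>.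
\<close>

definition mv_computable ::
    "'a repspace \<Rightarrow> 'b repspace \<Rightarrow> 'a set \<Rightarrow> ('a \<Rightarrow> 'b set) \<Rightarrow> bool" where
  "mv_computable X Y D F \<longleftrightarrow>
     (\<exists>G. computable G \<and>
        (\<forall>x\<in>D. \<forall>p. rep X p = Some x \<longrightarrow>
           (\<exists>q y. G p = Some q \<and> rep Y q = Some y \<and> y \<in> F x)))"

definition effectively_traceable :: "(baire \<rightharpoonup> 'a) \<Rightarrow> bool" where
  "effectively_traceable \<delta> \<longleftrightarrow>
     (\<exists>T. computable2 T \<and> dom T = dom \<delta> \<times> UNIV \<and>
        (\<forall>p\<in>dom \<delta>. {r. \<exists>q. T (p, q) = Some r} = {r. \<delta> r = \<delta> p}))"


section \<open>The truth-value spaces\<close>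

text \<open>In both spaces \<open>True\<close> is \<open>\<top>\<close> and \<open>False\<close> is \<open>\<bottom>\<close>.\<close>

definition is_tree :: "nat list set \<Rightarrow> bool" where
  "is_tree T \<longleftrightarrow> (\<forall>s\<in>T. \<forall>u. prefix u s \<longrightarrow> u \<in> T)"

definition ill_founded :: "nat list set \<Rightarrow> bool" where
  "ill_founded T \<longleftrightarrow> (\<exists>f. \<forall>n. map f [0..<n] \<in> T)"

definition codes_tree :: "baire \<Rightarrow> nat list set \<Rightarrow> bool" where
  "codes_tree p T \<longleftrightarrow> is_tree T \<and> p = (\<lambda>n. if list_decode n \<in> T then 1 else 0)"

definition sigma11_space :: "bool repspace" where
  "sigma11_space =
     \<lparr>points = UNIV,
      rep = pfun_of (\<lambda>p b. \<exists>T. codes_tree p T \<and> b = ill_founded T)\<rparr>"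

lemma codes_tree_unique: "codes_tree p T \<Longrightarrow> codes_tree p U \<Longrightarrow> T = U"
  unfolding codes_tree_def
  by (metis (no_types, lifting) list_encode_inverse subsetI subset_antisym zero_neq_one)

lemma rep_sigma11_space_eq_Some:
  "rep sigma11_space p = Some b \<longleftrightarrow> (\<exists>T. codes_tree p T \<and> b = ill_founded T)"
  unfolding sigma11_space_def by (simp, subst pfun_of_eq_Some) (auto dest: codes_tree_unique)

inductive_set BC :: "baire set" where
  zero: "p 0 = 0 \<Longrightarrow> p \<in> BC"
| one: "(\<And>n. ps n \<in> BC) \<Longrightarrow> cons_seq 1 (tuple_seq ps) \<in> BC"

text \<open>\<open>borel_value p b\<close>: the value \<open>\<delta>(p)\<close> is \<open>b\<close>; the graph of \<open>\<delta>\<close>, by recursion on Borel codes.\<close>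

inductive borel_value :: "baire \<Rightarrow> bool \<Rightarrow> bool" where
  zero: "p 0 = 0 \<Longrightarrow> borel_value p True"
| one: "(\<And>n. borel_value (ps n) (bs n)) \<Longrightarrow>
          borel_value (cons_seq 1 (tuple_seq ps)) (\<exists>i. \<not> bs i)"

definition borel_space :: "bool repspace" where
  "borel_space = \<lparr>points = UNIV, rep = pfun_of borel_value |` BC\<rparr>"

lemma borel_value_unique: "borel_value p b \<Longrightarrow> borel_value p c \<Longrightarrow> b = c"
proof (induction arbitrary: c rule: borel_value.induct)
  case (zero p)
  then show ?case by (auto elim: borel_value.cases)
next
  case IH: (one ps bs)
  from IH.prems show ?case
  proof (cases rule: borel_value.cases)
    case (one qs cs)
    then have "borel_value (ps n) (cs n)" for n by simp
    then have "bs = cs" using IH.IH by blast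
    then show ?thesis using one by simp
  qed simp
qed

lemma BC_iff_borel_value: "p \<in> BC \<longleftrightarrow> (\<exists>b. borel_value p b)"
proof
  show "p \<in> BC \<Longrightarrow> \<exists>b. borel_value p b"
  proof (induction rule: BC.induct)
    case (one ps)
    then obtain bs where "borel_value (ps n) (bs n)" for n by metis
    then show ?case by (blast intro: borel_value.one)
  qed (blast intro: borel_value.zero)
  show "\<exists>b. borel_value p b \<Longrightarrow> p \<in> BC"
    by (erule exE, erule borel_value.induct) (erule BC.zero, rule BC.one)
qed

lemma rep_borel_space_eq_Some: "rep borel_space p = Some b \<longleftrightarrow> borel_value p b"
  using pfun_of_eq_Some[of borel_value p b] borel_value_unique
  by (auto simp: borel_space_def restrict_map_def BC_iff_borel_value)

lemma dom_rep_borel_space: "dom (rep borel_space) = BC"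
  by (auto simp: BC_iff_borel_value dom_def rep_borel_space_eq_Some)

section \<open>The Lusin separation map\<close>

definition chi :: "'a repspace \<Rightarrow> 'a set \<Rightarrow> 'a \<Rightarrow> bool" where
  "chi X A = restrict (\<lambda>x. x \<in> A) (points X)"

definition Lusin_dom :: "'a repspace \<Rightarrow> (('a \<Rightarrow> bool) \<times> ('a \<Rightarrow> bool)) set" where
  "Lusin_dom X =
     {(chi X A, chi X B) | A B. A \<subseteq> points X \<and> B \<subseteq> points X \<and>
        chi X A \<in> points (cont_space X sigma11_space) \<and>
        chi X B \<in> points (cont_space X sigma11_space) \<and> A \<inter> B = {}}"

definition Lusin :: "'a repspace \<Rightarrow> ('a \<Rightarrow> bool) \<times> ('a \<Rightarrow> bool) \<Rightarrow> ('a \<Rightarrow> bool) set" where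
  "Lusin X z =
     {chi X C | C. C \<subseteq> points X \<and> chi X C \<in> points (cont_space X borel_space) \<and>
        (\<exists>A B. A \<subseteq> points X \<and> B \<subseteq> points X \<and> z = (chi X A, chi X B) \<and>
               A \<subseteq> C \<and> C \<inter> B = {})}"

end

theory Submission imports Defs begin

text \<open>
  For disjoint \<open>A\<close> and \<open>B\<close> and a name \<open>r\<close>, the product of the trees \<open>A(r)\<close> and \<open>B(r)\<close> is well-founded,
  and bar recursion along it turns the pair into a Borel code with value true if \<open>A(r)\<close> is
  ill-founded and false if \<open>B(r)\<close> is. This value depends on the name \<open>r\<close>, not only on the point. To
  repair this, put \<open>A\<^sub>0 = A\<close>, let \<open>C\<^sub>k\<close> be the set of names separating \<open>A\<^sub>k\<close> from \<open>B\<close> in this way, and let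
  \<open>A\<^sub>k\<^sub>+\<^sub>1\<close> be the set of all \<open>r\<close> such that \<open>C\<^sub>k\<close> contains some \<open>T(r, q)\<close>; this is again given by
  a tree, whose branches consist of \<open>q\<close> and a certificate that the Borel code at \<open>T(r, q)\<close> is true.
  Since the \<open>T(r, q)\<close> are exactly the names of the same point, \<open>A\<^sub>k\<^sub>+\<^sub>1\<close> is disjoint from \<open>B\<close> and the union
  of all \<open>C\<^sub>k\<close> is invariant.

  Whether a node belongs to the tree of \<open>A\<^sub>k\<^sub>+\<^sub>1\<close> is decided on finite parts of the oracles by a
  primitive recursive function that simulates the given machines for finitely many steps. A single
  machine searching for a long enough part of its oracle then computes the code of the union,
  uniformly in the names of \<open>A\<close> and \<open>B\<close>.
\<close>


section \<open>Register programs on oracle Turing machines\<close>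

text \<open>The dependence on names only concerns points outside both sets: the trees of two names
  of such a point are unrelated, and bar recursion reads off whatever their shapes happen to give.
  Enlarging \<open>A\<close> once is no cure, because a code separating the larger set from
  \<open>B\<close> has the same defect. The inclusions close up only in the limit:
  \<open>T(r, q)\<close> in \<open>C_k\<close> puts \<open>r\<close> into \<open>A_{k+1}\<close>,
  hence into \<open>C_{k+1}\<close>. Only the side of \<open>A\<close> grows, so all
  \<open>C_k\<close> avoid the same \<open>B\<close>, and so does their union. Certificates enter
  because \<open>A_{k+1}\<close> must again be given by a tree, whereas truth of a Borel code is
  defined by transfinite recursion. On a well-founded code local conditions force the value of every
  node, so truth becomes the existence of one function satisfying a closed condition. The labels in
  this condition are themselves known only through finite oracles; a node is therefore removed only
  on a visible violation. The resulting sets are not shown to be closed under prefixes, which is why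
  \<open>branch\<close> asks a path to stay inside only eventually.\<close>

datatype prog = Skip | Inc nat | Ask | Seq prog prog | Loop nat prog

text \<open>Registers will be tapes, so the oracle acts on register 1, and input and output share
  register 0. \<open>Loop\<close> is a while loop that takes one unit off its counter before each
  pass; the body may refill the counter, which is what unbounded search uses.\<close>

inductive big :: "baire \<Rightarrow> prog \<Rightarrow> (nat \<Rightarrow> nat) \<Rightarrow> (nat \<Rightarrow> nat) \<Rightarrow> bool" for p where
  Skip: "big p Skip s s"
| Inc: "big p (Inc i) s (s(i := Suc (s i)))"
| Ask: "big p Ask s (s(1 := p (s 1)))"
| Seq: "big p c s s' \<Longrightarrow> big p d s' s'' \<Longrightarrow> big p (Seq c d) s s''"
| Loop_0: "s i = 0 \<Longrightarrow> big p (Loop i c) s s"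
| Loop_Suc: "s i = Suc n \<Longrightarrow> big p c (s(i := n)) s' \<Longrightarrow> big p (Loop i c) s' s'' \<Longrightarrow>
    big p (Loop i c) s s''"

fun len :: "prog \<Rightarrow> nat" where
  "len Skip = 0"
| "len (Inc i) = 3"
| "len Ask = 1"
| "len (Seq c d) = len c + len d"
| "len (Loop i c) = len c + 2"

text \<open>Both the first and the last state of the code of a loop perform the test, so that no
  unconditional jump is needed.\<close>

fun code :: "prog \<Rightarrow> nat \<Rightarrow> instr list" where
  "code Skip k = []"
| "code (Inc i) k =
     [Act k i 0 0 Left (k + 1), Act k i 1 1 Left (k + 1),
      Act (k + 1) i 0 1 Left (k + 2), Act (k + 2) i 0 0 Right (k + 3)]"
| "code Ask k = [Query k (k + 1)]"
| "code (Seq c d) k = code c k @ code d (k + len c)"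
| "code (Loop i c) k =
     [Act k i 0 0 Left (k + len c + 2), Act k i 1 0 Right (k + 1)] @ code c (k + 1) @
     [Act (k + len c + 1) i 0 0 Left (k + len c + 2), Act (k + len c + 1) i 1 0 Right (k + 1)]"

section \<open>Locating the code of a program inside a larger machine\<close>

fun source :: "instr \<Rightarrow> nat" where
  "source (Act s i a b d s') = s"
| "source (Query s s') = s"

lemma source_code: "I \<in> set (code c k) \<Longrightarrow> k \<le> source I \<and> source I < k + len c"
  by (induction c k rule: code.induct) fastforce+

text \<open>While the machine is in a state of the interval of \<open>c\<close>, only instructions
  with a source in that interval can apply. Their position in the list is irrelevant apart from
  their order, so a block of code is located by filtering.\<close>

definition contains_code :: "instr list \<Rightarrow> prog \<Rightarrow> nat \<Rightarrow> bool" where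
  "contains_code M c k \<longleftrightarrow> filter (\<lambda>I. k \<le> source I \<and> source I < k + len c) M = code c k"

lemma contains_code_self: "contains_code (code c k) c k"
  unfolding contains_code_def using source_code by (intro filter_True) blast

lemma filter_code_disjoint:
  assumes "j + n \<le> k \<or> k + len c \<le> j"
  shows "filter (\<lambda>I. j \<le> source I \<and> source I < j + n) (code c k) = []"
  using assms source_code by (intro filter_False) fastforce

lemma contains_code_sub:
  assumes "contains_code M c k" "k \<le> k'" "k' + len c' \<le> k + len c"
    "filter (\<lambda>I. k' \<le> source I \<and> source I < k' + len c') (code c k) = code c' k'"
  shows "contains_code M c' k'"
proof -
  have "filter (\<lambda>I. k' \<le> source I \<and> source I < k' + len c') M =
    filter (\<lambda>I. k' \<le> source I \<and> source I < k' + len c')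
      (filter (\<lambda>I. k \<le> source I \<and> source I < k + len c) M)"
    unfolding filter_filter using assms(2,3) by (intro filter_cong) auto
  with assms(1,4) show ?thesis by (simp add: contains_code_def)
qed

lemma contains_code_Seq:
  assumes "contains_code M (Seq c d) k"
  shows "contains_code M c k" "contains_code M d (k + len c)"
proof -
  show "contains_code M c k"
    by (rule contains_code_sub[OF assms])
      (simp_all add: filter_code_disjoint contains_code_self[unfolded contains_code_def])
  show "contains_code M d (k + len c)"
    by (rule contains_code_sub[OF assms])
      (simp_all add: filter_code_disjoint contains_code_self[unfolded contains_code_def])
qed

lemma contains_code_Loop:
  assumes "contains_code M (Loop i c) k"
  shows "contains_code M c (k + 1)"
  by (rule contains_code_sub[OF assms])
    (use contains_code_self[of c "k + 1"] in \<open>simp_all add: contains_code_def\<close>)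

lemma find_filter: "(\<And>x. P x \<Longrightarrow> Q x) \<Longrightarrow> find P (filter Q xs) = find P xs"
  by (induction xs) auto

lemma applicable_source: "applicable (s, t) I \<Longrightarrow> source I = s"
  by (cases I) auto

lemma step_contains_code:
  assumes "contains_code M c k" "k \<le> s" "s < k + len c"
  shows "step M p (s, t) = step (code c k) p (s, t)"
proof -
  have "find (applicable (s, t)) (filter (\<lambda>I. k \<le> source I \<and> source I < k + len c) M) =
    find (applicable (s, t)) M"
    using assms(2,3) applicable_source by (intro find_filter) blast
  with assms(1) show ?thesis
    by (simp add: step_def contains_code_def)
qed

lemma step_code_None: "s \<ge> k + len c \<Longrightarrow> step (code c k) p (s, t) = None"
  unfolding step_def using source_code applicable_source
  by (fastforce simp: find_None_iff)

section \<open>Numbers on tapes and the correctness of compiled programs\<close>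

text \<open>Every move of the head may leave explicit blanks behind, so the tape of a number is
  determined only up to blanks at both ends. The head rests on the first 1, if there is one.\<close>

fun holds :: "nat \<Rightarrow> tape \<Rightarrow> bool" where
  "holds n (l, r) \<longleftrightarrow> set l \<subseteq> {0} \<and> (\<exists>m. r = replicate n 1 @ replicate m 0)"

lemma holds_unary: "holds n (unary n)"
  by (auto simp: unary_def intro: exI[of _ 0])

lemma count_list_zeros: "set l \<subseteq> {0} \<Longrightarrow> count_list l (Suc 0) = 0"
  by (induction l) auto

lemma count_list_replicate: "count_list (replicate n a) b = (if a = b then n else 0)"
  by (induction n) auto

lemma ones_holds: "holds n \<tau> \<Longrightarrow> ones \<tau> = n"
  by (cases \<tau>) (auto simp: count_list_zeros count_list_append count_list_replicate)

lemma read_holds_0: "holds 0 \<tau> \<Longrightarrow> read_tape \<tau> = 0"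
  by (cases \<tau>) (auto, metis first_cell.simps replicate_0 replicate_Suc not0_implies_Suc)

lemma read_holds_Suc: "holds (Suc n) \<tau> \<Longrightarrow> read_tape \<tau> = Suc 0"
  by (cases \<tau>) auto

lemma first_cell_zeros: "set l \<subseteq> {0} \<Longrightarrow> first_cell l = 0"
  by (cases l) auto

lemma set_tl_zeros: "set l \<subseteq> {0} \<Longrightarrow> set (tl l) \<subseteq> {0}"
  by (cases l) auto

lemma holds_dec: "holds (Suc n) \<tau> \<Longrightarrow> holds n (move_tape Right (write_tape 0 \<tau>))"
  by (cases \<tau>) auto

lemma holds_0_left: "holds 0 \<tau> \<Longrightarrow> holds 0 (move_tape Left (write_tape 0 \<tau>))"
proof (cases \<tau>)
  case (Pair l r)
  assume "holds 0 \<tau>"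
  then obtain m where "set l \<subseteq> {0}" "r = replicate m 0" by (auto simp: Pair)
  then show ?thesis
    by (auto simp: Pair first_cell_zeros dest: set_tl_zeros intro!: exI[of _ "Suc (Suc (m - 1))"])
qed

text \<open>Each instruction writes under the head and then moves. To put a 1 in front of the block
  the head steps left, writes while moving left once more, and returns by one step to the
  right.\<close>

lemma holds_inc:
  assumes "holds n \<tau>"
  defines "\<tau>1 \<equiv> move_tape Left (write_tape (read_tape \<tau>) \<tau>)"
  defines "\<tau>2 \<equiv> move_tape Left (write_tape 1 \<tau>1)"
  shows "read_tape \<tau> \<in> {0, 1}" "read_tape \<tau>1 = 0" "read_tape \<tau>2 = 0"
    "holds (Suc n) (move_tape Right (write_tape 0 \<tau>2))"
proof -
  obtain l r where \<tau>: "\<tau> = (l, r)" by (cases \<tau>)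
  with assms obtain m where l: "set l \<subseteq> {0}" and r: "r = replicate n 1 @ replicate m 0" by auto
  show "read_tape \<tau> \<in> {0, 1}"
    using assms(1) by (cases n) (auto simp: read_holds_0 read_holds_Suc)
  show 1: "read_tape \<tau>1 = 0" and 2: "read_tape \<tau>2 = 0"
    using l set_tl_zeros[OF l] by (simp_all add: \<tau>1_def \<tau>2_def \<tau> first_cell_zeros)
  have "\<exists>m'. first_cell r # tl r = replicate n 1 @ replicate m' 0"
  proof (cases r)
    case Nil
    then show ?thesis using r by (auto intro: exI[of _ 1])
  next
    case (Cons a list)
    then show ?thesis using r by (intro exI[of _ m]) simp
  qed
  then show "holds (Suc n) (move_tape Right (write_tape 0 \<tau>2))"
    using l set_tl_zeros[OF l] set_tl_zeros[OF set_tl_zeros[OF l]]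
    by (auto simp: \<tau>1_def \<tau>2_def \<tau> first_cell_zeros)
qed

abbreviation steps :: "instr list \<Rightarrow> baire \<Rightarrow> config \<Rightarrow> config \<Rightarrow> bool" where
  "steps M p \<equiv> (\<lambda>c c'. step M p c = Some c')\<^sup>*\<^sup>*"

text \<open>The body of a loop ends in the last state of the loop, so the induction on runs reenters
  a loop there and not at \<open>k\<close>; the simulation has to be stated for both states.\<close>

fun entries :: "prog \<Rightarrow> nat \<Rightarrow> nat set" where
  "entries (Loop i c) k = {k, k + len c + 1}"
| "entries c k = {k}"

lemma entries_start: "k \<in> entries c k"
  by (cases c) auto

lemma find_append: "find P (xs @ ys) = (case find P xs of None \<Rightarrow> find P ys | Some x \<Rightarrow> Some x)"
  by (induction xs) auto

lemma find_code_eq_None: "s < k \<or> s \<ge> k + len c \<Longrightarrow> find (applicable (s, t)) (code c k) = None"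
  using source_code applicable_source by (fastforce simp: find_None_iff)

lemma Loop_step:
  assumes "contains_code M (Loop i c) k" "e \<in> entries (Loop i c) k"
  shows "read_tape (t i) = 0 \<Longrightarrow> step M p (e, t) =
      Some (k + len (Loop i c), t(i := move_tape Left (write_tape 0 (t i))))"
    and "read_tape (t i) = 1 \<Longrightarrow> step M p (e, t) =
      Some (k + 1, t(i := move_tape Right (write_tape 0 (t i))))"
proof -
  have "step M p (e, t) = step (code (Loop i c) k) p (e, t)"
    using assms by (intro step_contains_code) auto
  then show "read_tape (t i) = 0 \<Longrightarrow> step M p (e, t) =
      Some (k + len (Loop i c), t(i := move_tape Left (write_tape 0 (t i))))"
    and "read_tape (t i) = 1 \<Longrightarrow> step M p (e, t) =
      Some (k + 1, t(i := move_tape Right (write_tape 0 (t i))))"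
    using assms(2) by (auto simp: step_def find_append find_code_eq_None)
qed

lemma big_steps:
  assumes "big p c s s'" "contains_code M c k" "e \<in> entries c k" "\<And>i. holds (s i) (t i)"
  shows "\<exists>t'. steps M p (e, t) (k + len c, t') \<and> (\<forall>i. holds (s' i) (t' i))"
  using assms
proof (induction arbitrary: k e t rule: big.induct)
  case (Skip s)
  then show ?case by auto
next
  case (Inc i s)
  define t1 where "t1 = t(i := move_tape Left (write_tape (read_tape (t i)) (t i)))"
  define t2 where "t2 = t1(i := move_tape Left (write_tape 1 (t1 i)))"
  define t3 where "t3 = t2(i := move_tape Right (write_tape 0 (t2 i)))"
  note h = holds_inc[OF Inc.prems(3)[of i]]
  note st = step_contains_code[OF Inc.prems(1)]
  have "step M p (k, t) = Some (k + 1, t1)"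
    using h(1) by (subst st) (auto simp: step_def t1_def)
  moreover have "step M p (k + 1, t1) = Some (k + 2, t2)"
    using h(2) by (subst st) (auto simp: step_def t1_def t2_def)
  moreover have "step M p (k + 2, t2) = Some (k + 3, t3)"
    using h(3) by (subst st) (auto simp: step_def t1_def t2_def t3_def)
  ultimately have "steps M p (k, t) (k + 3, t3)"
    by (meson converse_rtranclp_into_rtranclp rtranclp.rtrancl_refl)
  moreover have "\<forall>j. holds ((s(i := Suc (s i))) j) (t3 j)"
    using h(4) Inc.prems(3) by (auto simp: t3_def t2_def t1_def)
  ultimately show ?case using Inc.prems(2) by (metis entries.simps(3) len.simps(2) singletonD)
next
  case (Ask s)
  have "step M p (k, t) = Some (k + 1, t(1 := unary (p (s 1))))"
    by (subst step_contains_code[OF Ask.prems(1)])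
      (auto simp: step_def ones_holds[OF Ask.prems(3)])
  then have "steps M p (k, t) (k + 1, t(1 := unary (p (s 1))))"
    by (rule r_into_rtranclp)
  moreover have "\<forall>j. holds ((s(1 := p (s 1))) j) ((t(1 := unary (p (s 1)))) j)"
    using Ask.prems(3) holds_unary by auto
  ultimately show ?case using Ask.prems(2) by (metis entries.simps(4) len.simps(3) singletonD)
next
  case (Seq c s s' d s'')
  note sub = contains_code_Seq[OF Seq.prems(1)]
  from Seq.prems(2) have e: "e = k" by simp
  from Seq.IH(1)[OF sub(1) entries_start Seq.prems(3)] obtain t'
    where t': "steps M p (k, t) (k + len c, t')" "\<And>i. holds (s' i) (t' i)" by blast
  from Seq.IH(2)[OF sub(2) entries_start t'(2)] obtain t''
    where t'': "steps M p (k + len c, t') (k + len c + len d, t'')" "\<And>i. holds (s'' i) (t'' i)"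
    by blast
  from rtranclp_trans[OF t'(1) t''(1)] t''(2) e show ?case by (auto simp: add.assoc)
next
  case (Loop_0 s i c)
  have h: "holds 0 (t i)" using Loop_0.prems(3)[of i] Loop_0.hyps by simp
  have "step M p (e, t) = Some (k + len (Loop i c), t(i := move_tape Left (write_tape 0 (t i))))"
    by (rule Loop_step[OF Loop_0.prems(1,2)]) (rule read_holds_0[OF h])
  moreover have "holds (s j) ((t(i := move_tape Left (write_tape 0 (t i)))) j)" for j
    using Loop_0.prems(3) holds_0_left[OF h] Loop_0.hyps by simp
  ultimately show ?case by blast
next
  case (Loop_Suc s i n c s' s'')
  let ?t = "t(i := move_tape Right (write_tape 0 (t i)))"
  have h: "holds (Suc n) (t i)" using Loop_Suc.prems(3)[of i] Loop_Suc.hyps by simp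
  have 1: "step M p (e, t) = Some (k + 1, ?t)"
    by (rule Loop_step[OF Loop_Suc.prems(1,2)]) (simp add: read_holds_Suc[OF h])
  have "holds ((s(i := n)) j) (?t j)" for j
    using Loop_Suc.prems(3) holds_dec[OF h] by simp
  from Loop_Suc.IH(1)[OF contains_code_Loop[OF Loop_Suc.prems(1)] entries_start this] obtain t'
    where t': "steps M p (k + 1, ?t) (k + 1 + len c, t')" "\<And>i. holds (s' i) (t' i)" by blast
  from Loop_Suc.IH(2)[OF Loop_Suc.prems(1) _ t'(2), of "k + 1 + len c"] obtain t''
    where t'': "steps M p (k + 1 + len c, t') (k + len (Loop i c), t'')"
      "\<And>i. holds (s'' i) (t'' i)"
    by auto
  from 1 t'(1) t''(1) have "steps M p (e, t) (k + len (Loop i c), t'')"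
    by (meson converse_rtranclp_into_rtranclp rtranclp_trans)
  with t''(2) show ?case by blast
qed

lemma big_halts_with:
  assumes "big p c ((\<lambda>_. 0)(0 := k)) s"
  shows "halts_with (code c 0) p k (s 0)"
proof -
  have "holds (((\<lambda>_. 0)(0 := k)) i) (snd (init_config k) i)" for i
    using holds_unary by (simp add: init_config_def)
  from big_steps[OF assms contains_code_self entries_start this] obtain t'
    where "steps (code c 0) p (0, snd (init_config k)) (len c, t')" "holds (s 0) (t' 0)"
    by (metis add_0)
  then show ?thesis unfolding halts_with_def
    by (intro exI[of _ "(len c, t')"]) (auto simp: ones_holds step_code_None init_config_def)
qed


section \<open>Primitive recursive functions\<close>

text \<open>Only unary functions with pairing: the compiler then deals with one value register and
  needs no bookkeeping of arities.\<close>

inductive pr :: "(nat \<Rightarrow> nat) \<Rightarrow> bool" where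
  zero: "pr (\<lambda>_. 0)"
| Suc: "pr Suc"
| fst: "pr (\<lambda>x. fst (prod_decode x))"
| snd: "pr (\<lambda>x. snd (prod_decode x))"
| pair: "pr f \<Longrightarrow> pr g \<Longrightarrow> pr (\<lambda>x. prod_encode (f x, g x))"
| comp: "pr f \<Longrightarrow> pr g \<Longrightarrow> pr (\<lambda>x. f (g x))"
| iter: "pr f \<Longrightarrow> pr (\<lambda>x. (f ^^ snd (prod_decode x)) (fst (prod_decode x)))"

definition erase :: "nat \<Rightarrow> prog" where
  "erase i = Loop i Skip"

definition transfer :: "nat \<Rightarrow> nat \<Rightarrow> prog" where
  "transfer i j = Loop i (Inc j)"

text \<open>A loop destroys its counter, so a second register \<open>h\<close> receives the same
  amount and restores \<open>i\<close> afterwards.\<close>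

definition copy :: "nat \<Rightarrow> nat \<Rightarrow> nat \<Rightarrow> prog" where
  "copy i j h = Seq (Loop i (Seq (Inc j) (Inc h))) (transfer h i)"

lemma big_eq: "big p c s s' \<Longrightarrow> s' = s'' \<Longrightarrow> big p c s s''"
  by simp

lemma big_erase: "big p (erase i) s (s(i := 0))"
  unfolding erase_def
proof (induction "s i" arbitrary: s)
  case 0
  then show ?case by (auto intro!: big_eq[OF big.Loop_0])
next
  case (Suc n)
  from Suc(1)[of "s(i := n)"] have "big p (Loop i Skip) (s(i := n)) (s(i := 0))" by simp
  with Suc(2)[symmetric] show ?case by (rule big.Loop_Suc[OF _ big.Skip])
qed

lemma big_transfer:
  assumes "i \<noteq> j"
  shows "big p (transfer i j) s (s(i := 0, j := s j + s i))"
  unfolding transfer_def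
proof (induction "s i" arbitrary: s)
  case 0
  then show ?case by (auto intro!: big_eq[OF big.Loop_0])
next
  case (Suc n)
  let ?s = "s(i := n, j := Suc (s j))"
  have "big p (Inc j) (s(i := n)) ?s"
    using assms by (auto intro: big_eq[OF big.Inc])
  moreover have "big p (Loop i (Inc j)) ?s (s(i := 0, j := s j + s i))"
    using Suc(1)[of ?s] assms Suc(2)[symmetric] by (auto intro: big_eq simp: fun_upd_twist)
  ultimately show ?case by (rule big.Loop_Suc[where s = s and i = i, OF Suc(2)[symmetric]])
qed

lemma big_copy:
  assumes "distinct [i, j, h]" "s h = 0"
  shows "big p (copy i j h) s (s(j := s j + s i))"
proof -
  have "big p (Loop i (Seq (Inc j) (Inc h))) s (s(i := 0, j := s j + s i, h := s h + s i))" for s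
  proof (induction "s i" arbitrary: s)
    case 0
    then show ?case by (auto intro!: big_eq[OF big.Loop_0])
  next
    case (Suc n)
    let ?s = "s(i := n, j := Suc (s j), h := Suc (s h))"
    have "big p (Seq (Inc j) (Inc h)) (s(i := n)) ?s"
      using assms(1) by (intro big.Seq[OF big.Inc] big_eq[OF big.Inc]) auto
    moreover have "big p (Loop i (Seq (Inc j) (Inc h))) ?s
        (s(i := 0, j := s j + s i, h := s h + s i))"
      using Suc(1)[of ?s] assms(1) Suc(2)[symmetric] by (auto elim!: big_eq)
    ultimately show ?case by (rule big.Loop_Suc[where s = s and i = i, OF Suc(2)[symmetric]])
  qed
  from this[of s] show ?thesis
    unfolding copy_def using assms by (auto elim!: big.Seq intro!: big_eq[OF big_transfer])
qed

lemma prod_decode_0: "prod_decode 0 = (0, 0)"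
  using prod_encode_inverse[of "(0, 0)"] by (simp add: prod_encode_def)

lemma prod_decode_Suc:
  "prod_decode (Suc n) =
     (case prod_decode n of (a, 0) \<Rightarrow> (0, Suc a) | (a, Suc b) \<Rightarrow> (Suc a, b))"
proof -
  obtain a b where ab: "prod_decode n = (a, b)" by fastforce
  then have n: "n = prod_encode (a, b)" by (metis prod_decode_inverse)
  have "Suc n = prod_encode (case b of 0 \<Rightarrow> (0, Suc a) | Suc b \<Rightarrow> (Suc a, b))"
    by (cases b) (simp_all add: n prod_encode_def)
  then show ?thesis using ab by (cases b) simp_all
qed

text \<open>One step \<open>(a, 0) \<mapsto> (0, a + 1)\<close>, \<open>(a, b + 1) \<mapsto> (a + 1, b)\<close> of the enumeration of pairs; register
  \<open>h\<close> remembers whether \<open>b\<close> was \<open>0\<close>.\<close>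

definition next_pair :: "nat \<Rightarrow> nat \<Rightarrow> nat \<Rightarrow> nat \<Rightarrow> prog" where
  "next_pair a b e h =
     Seq (Inc h) (Seq (Loop b (Seq (transfer b e) (Seq (erase h) (Inc a))))
       (Seq (Loop h (Seq (transfer a b) (Inc b))) (transfer e b)))"

lemma big_next_pair:
  assumes d: "distinct [a, b, e, h]" and s: "s e = 0" "s h = 0" "s a = m" "s b = n"
  shows "big p (next_pair a b e h) s
    (case n of 0 \<Rightarrow> s(a := 0, b := Suc m) | Suc n' \<Rightarrow> s(a := Suc m, b := n'))"
proof (cases n)
  case 0
  have "big p (Loop b (Seq (transfer b e) (Seq (erase h) (Inc a)))) (s(h := 1)) (s(h := 1))"
    using d s 0 by (intro big.Loop_0) auto
  moreover have "big p (Seq (transfer a b) (Inc b)) (s(h := 0)) (s(a := 0, b := Suc m))"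
    using d s 0 by (intro big.Seq[OF big_transfer] big_eq[OF big.Inc]) (auto simp: fun_eq_iff)
  then have "big p (Loop h (Seq (transfer a b) (Inc b))) (s(h := 1)) (s(a := 0, b := Suc m))"
    using d s by (intro big.Loop_Suc[OF _ _ big.Loop_0]) auto
  moreover have "big p (transfer e b) (s(a := 0, b := Suc m)) (s(a := 0, b := Suc m))"
    using d s by (auto intro!: big_eq[OF big_transfer] simp: fun_eq_iff)
  moreover have "big p (Inc h) s (s(h := 1))"
    using s by (auto intro: big_eq[OF big.Inc])
  ultimately show ?thesis
    unfolding next_pair_def 0 by (auto intro: big.Seq)
next
  case (Suc n')
  have "big p (Seq (transfer b e) (Seq (erase h) (Inc a))) (s(h := 1, b := n'))
      (s(b := 0, e := n', a := Suc m))"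
    using d s Suc
    by (intro big.Seq[OF big_transfer] big.Seq[OF big_erase] big_eq[OF big.Inc])
      (auto simp: fun_eq_iff)
  then have "big p (Loop b (Seq (transfer b e) (Seq (erase h) (Inc a)))) (s(h := 1))
      (s(b := 0, e := n', a := Suc m))"
    using d s Suc by (intro big.Loop_Suc[OF _ _ big.Loop_0]) auto
  moreover have "big p (Loop h (Seq (transfer a b) (Inc b))) (s(b := 0, e := n', a := Suc m))
      (s(b := 0, e := n', a := Suc m))"
    using d s by (intro big.Loop_0) auto
  moreover have "big p (transfer e b) (s(b := 0, e := n', a := Suc m)) (s(a := Suc m, b := n'))"
    using d s by (auto intro!: big_eq[OF big_transfer] simp: fun_eq_iff)
  moreover have "big p (Inc h) s (s(h := 1))"
    using s by (auto intro: big_eq[OF big.Inc])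
  ultimately show ?thesis
    unfolding next_pair_def Suc by (auto intro: big.Seq)
qed

text \<open>Instead of inverting a quadratic function, the program walks \<open>x\<close> steps
  along the enumeration of pairs, starting from \<open>(0, 0)\<close>.\<close>

definition decode_pair :: "nat \<Rightarrow> nat \<Rightarrow> nat \<Rightarrow> nat \<Rightarrow> nat \<Rightarrow> prog" where
  "decode_pair x a b e h = Loop x (next_pair a b e h)"

lemma big_decode_pair:
  assumes d: "distinct [x, a, b, e, h]" and s: "s e = 0" "s h = 0" "s a = 0" "s b = 0"
  shows "big p (decode_pair x a b e h) s
    (s(x := 0, a := fst (prod_decode (s x)), b := snd (prod_decode (s x))))"
proof -
  have "big p (Loop x (next_pair a b e h)) s
      (s(x := 0, a := fst (prod_decode (n + s x)), b := snd (prod_decode (n + s x))))"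
    if "s e = 0" "s h = 0" "prod_decode n = (s a, s b)" for n s
    using that
  proof (induction "s x" arbitrary: s n)
    case 0
    then show ?case by (auto intro!: big_eq[OF big.Loop_0] simp: fun_eq_iff)
  next
    case (Suc k)
    let ?s = "case s b of 0 \<Rightarrow> s(x := k, a := 0, b := Suc (s a))
      | Suc n' \<Rightarrow> s(x := k, a := Suc (s a), b := n')"
    have 1: "big p (next_pair a b e h) (s(x := k)) ?s"
      using d Suc.prems by (intro big_eq[OF big_next_pair]) (auto split: nat.splits)
    have 2: "?s x = k" "?s e = 0" "?s h = 0"
      using d Suc.prems by (auto split: nat.splits)
    have 3: "prod_decode (Suc n) = (?s a, ?s b)"
      using d Suc.prems by (auto split: nat.splits simp: prod_decode_Suc)
    have "big p (Loop x (next_pair a b e h)) ?s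
        (?s(x := 0, a := fst (prod_decode (Suc n + ?s x)), b := snd (prod_decode (Suc n + ?s x))))"
      using 2 3 by (intro Suc.hyps) auto
    then have "big p (Loop x (next_pair a b e h)) ?s
        (s(x := 0, a := fst (prod_decode (n + s x)), b := snd (prod_decode (n + s x))))"
      by (rule big_eq) (use 2(1) d Suc.hyps(2)[symmetric] in \<open>auto simp: fun_eq_iff split: nat.splits\<close>)
    then show ?case by (rule big.Loop_Suc[where s = s and i = x, OF Suc.hyps(2)[symmetric] 1])
  qed
  from this[of s 0] show ?thesis
    using s unfolding decode_pair_def by (simp add: prod_decode_0)
qed

text \<open>Uses \<open>prod_encode (a, b) = triangle (a + b) + a\<close>. The counter
  \<open>t\<close> is already lowered when it is added to \<open>r\<close>, hence the extra
  \<open>Inc\<close> in each pass of the triangular sum.\<close>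

definition encode_pair :: "nat \<Rightarrow> nat \<Rightarrow> nat \<Rightarrow> nat \<Rightarrow> nat \<Rightarrow> prog" where
  "encode_pair a b t h r =
     Seq (copy a r h) (Seq (transfer a t) (Seq (transfer b t)
       (Loop t (Seq (copy t r h) (Inc r)))))"

lemma big_encode_pair:
  assumes d: "distinct [a, b, t, h, r]" and s: "s t = 0" "s h = 0" "s r = 0"
  shows "big p (encode_pair a b t h r) s (s(a := 0, b := 0, r := prod_encode (s a, s b)))"
proof -
  have *: "big p (Loop t (Seq (copy t r h) (Inc r))) s (s(t := 0, r := s r + triangle (s t)))"
    if "s h = 0" for s
    using that
  proof (induction "s t" arbitrary: s)
    case 0
    then show ?case by (auto intro!: big_eq[OF big.Loop_0] simp: fun_eq_iff)
  next
    case (Suc n)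
    let ?s = "s(t := n, r := s r + n + 1)"
    have "big p (Seq (copy t r h) (Inc r)) (s(t := n)) ?s"
      using d Suc.prems by (intro big.Seq[OF big_copy] big_eq[OF big.Inc]) (auto simp: fun_eq_iff)
    moreover have "big p (Loop t (Seq (copy t r h) (Inc r))) ?s (s(t := 0, r := s r + triangle (s t)))"
      using Suc.hyps(1)[of ?s] Suc.prems Suc.hyps(2)[symmetric] d
      by (auto elim!: big_eq simp: fun_eq_iff)
    ultimately show ?case by (rule big.Loop_Suc[where s = s and i = t, OF Suc.hyps(2)[symmetric]])
  qed
  have "big p (copy a r h) s (s(r := s a))"
    using d s by (auto intro!: big_eq[OF big_copy] simp: fun_eq_iff)
  moreover have "big p (transfer a t) (s(r := s a)) (s(r := s a, a := 0, t := s a))"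
    using d s by (auto intro!: big_eq[OF big_transfer] simp: fun_eq_iff)
  moreover have "big p (transfer b t) (s(r := s a, a := 0, t := s a))
      (s(r := s a, a := 0, b := 0, t := s a + s b))"
    using d s by (auto intro!: big_eq[OF big_transfer] simp: fun_eq_iff)
  moreover have "big p (Loop t (Seq (copy t r h) (Inc r))) (s(r := s a, a := 0, b := 0, t := s a + s b))
      (s(a := 0, b := 0, r := prod_encode (s a, s b)))"
    using d s by (intro big_eq[OF *]) (auto simp: fun_eq_iff prod_encode_def)
  ultimately show ?thesis unfolding encode_pair_def by (blast intro: big.Seq)
qed

text \<open>Everything above \<open>b\<close> is clean scratch space and is left clean, so
  subprograms are nested by raising \<open>b\<close>.\<close>

definition computes :: "prog \<Rightarrow> nat \<Rightarrow> (nat \<Rightarrow> nat) \<Rightarrow> bool" where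
  "computes c b f \<longleftrightarrow> (\<forall>p s. (\<forall>j>b. s j = 0) \<longrightarrow> big p c s (s(b := f (s b))))"

lemma computesD: "computes c b f \<Longrightarrow> (\<And>j. j > b \<Longrightarrow> s j = 0) \<Longrightarrow> big p c s (s(b := f (s b)))"
  by (simp add: computes_def)

lemma pr_computes: "pr f \<Longrightarrow> \<exists>c. computes c b f"
proof (induction arbitrary: b rule: pr.induct)
  case zero
  have "computes (erase b) b (\<lambda>_. 0)"
    unfolding computes_def using big_erase by blast
  then show ?case ..
next
  case Suc
  have "computes (Inc b) b Suc"
    unfolding computes_def using big.Inc by blast
  then show ?case ..
next
  case fst
  have "computes (Seq (decode_pair b (b + 1) (b + 2) (b + 3) (b + 4))
      (Seq (erase (b + 2)) (transfer (b + 1) b))) b (\<lambda>x. fst (prod_decode x))"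
    unfolding computes_def
    by (intro allI impI big.Seq[OF big_decode_pair] big.Seq[OF big_erase] big_eq[OF big_transfer])
      (auto simp: fun_eq_iff)
  then show ?case ..
next
  case snd
  have "computes (Seq (decode_pair b (b + 1) (b + 2) (b + 3) (b + 4))
      (Seq (erase (b + 1)) (transfer (b + 2) b))) b (\<lambda>x. snd (prod_decode x))"
    unfolding computes_def
    by (intro allI impI big.Seq[OF big_decode_pair] big.Seq[OF big_erase] big_eq[OF big_transfer])
      (auto simp: fun_eq_iff)
  then show ?case ..
next
  case (pair f g)
  from pair.IH obtain c d where cd: "computes c (b + 1) f" "computes d (b + 2) g" by blast
  have "computes (Seq (copy b (b + 1) (b + 2)) (Seq c (Seq (transfer b (b + 2)) (Seq d
      (encode_pair (b + 1) (b + 2) (b + 3) (b + 4) b))))) b (\<lambda>x. prod_encode (f x, g x))"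
    unfolding computes_def
    by (intro allI impI big.Seq[OF big_copy] big.Seq[OF computesD[OF cd(1)]]
        big.Seq[OF big_transfer] big.Seq[OF computesD[OF cd(2)]] big_eq[OF big_encode_pair])
      (auto simp: fun_eq_iff)
  then show ?case ..
next
  case (comp f g)
  from comp.IH obtain c d where cd: "computes c b f" "computes d b g" by blast
  have "computes (Seq d c) b (\<lambda>x. f (g x))"
    unfolding computes_def
    by (intro allI impI big.Seq[OF computesD[OF cd(2)]] big_eq[OF computesD[OF cd(1)]]) auto
  then show ?case ..
next
  case (iter f)
  from iter.IH obtain c where c: "computes c (b + 2) f" by blast
  have loop: "big p (Loop (b + 1) c) s (s(b + 1 := 0, b + 2 := (f ^^ s (b + 1)) (s (b + 2))))"
    if "\<forall>j>b+2. s j = 0" for p s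
    using that
  proof (induction "s (b + 1)" arbitrary: s)
    case 0
    then show ?case by (auto intro!: big_eq[OF big.Loop_0] simp: fun_eq_iff)
  next
    case (Suc n)
    let ?s = "s(b + 1 := n, b + 2 := f (s (b + 2)))"
    have "big p c (s(b + 1 := n)) ?s"
      by (rule big_eq[OF computesD[OF c]]) (use Suc.prems in \<open>auto simp: fun_eq_iff\<close>)
    moreover have "big p (Loop (b + 1) c) ?s
        (s(b + 1 := 0, b + 2 := (f ^^ s (b + 1)) (s (b + 2))))"
      using Suc.hyps(1)[of ?s] Suc.prems Suc.hyps(2)[symmetric]
      by (auto elim!: big_eq simp: fun_eq_iff funpow_swap1)
    ultimately show ?case by (rule big.Loop_Suc[where s = s and i = "b + 1", OF Suc.hyps(2)[symmetric]])
  qed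
  have "computes (Seq (decode_pair b (b + 2) (b + 1) (b + 3) (b + 4))
      (Seq (Loop (b + 1) c) (transfer (b + 2) b))) b
      (\<lambda>x. (f ^^ snd (prod_decode x)) (fst (prod_decode x)))"
    unfolding computes_def
    by (intro allI impI big.Seq[OF big_decode_pair] big.Seq[OF loop] big_eq[OF big_transfer])
      (auto simp: fun_eq_iff)
  then show ?case ..
qed

subsection \<open>Unbounded search with an oracle\<close>

text \<open>Register 3 holds the state of the search, register 2 the flag for another round,
  register 0 the result; 1 is for the query and 4 to 7 are scratch. \<open>Loop 4\<close> runs at
  most once: it takes one unit from \<open>Suc v\<close>, moves the remaining \<open>v\<close> to
  the output and clears the flag.\<close>

definition search_body :: "prog \<Rightarrow> prog \<Rightarrow> prog \<Rightarrow> prog" where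
  "search_body c d e =
     Seq (copy 3 4 5) (Seq c (Seq (Inc 2) (Seq (Loop 4 (Seq (transfer 4 0) (erase 2)))
       (Seq (copy 3 4 5) (Seq d (Seq (transfer 4 1) (Seq Ask (Seq (transfer 1 4)
         (Seq (encode_pair 3 4 5 6 7) (Seq (transfer 7 3) e))))))))))"

text \<open>The only place with an oracle query and with unbounded iteration. \<open>out\<close> is
  0 for "continue" and \<open>Suc v\<close> for "stop with \<open>v\<close>"; every round asks one
  question.\<close>

lemma search_computable:
  assumes pr: "pr init" "pr out" "pr query" "pr upd"
  defines "nxt \<equiv> \<lambda>p x. upd (prod_encode (x, p (query x)))"
  shows "\<exists>n. \<forall>p k v t. out ((nxt p ^^ t) (init k)) = Suc v \<longrightarrow>
    (\<forall>j<t. out ((nxt p ^^ j) (init k)) = 0) \<longrightarrow> halts_with (machine n) p k v"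
proof -
  define S where "S = (\<lambda>r f x. (\<lambda>_ :: nat. 0 :: nat)(0 := r, 2 := f, 3 := x))"
  from pr obtain a c d e where
    comp: "computes a 3 init" "computes c 4 out" "computes d 4 query" "computes e 3 upd"
    using pr_computes by meson
  define B where "B = search_body c d e"
  have body: "big p B (S 0 0 x)
      (case out x of 0 \<Rightarrow> S 0 1 (nxt p x)
       | Suc v \<Rightarrow> S v 0 (nxt p x))" for p x
  proof -
    define o1 where "o1 = (case out x of 0 \<Rightarrow> 0 | Suc v \<Rightarrow> v)"
    define f1 where "f1 = (case out x of 0 \<Rightarrow> 1 :: nat | Suc v \<Rightarrow> 0)"
    have "big p (Loop 4 (Seq (transfer 4 0) (erase 2))) ((S 0 1 x)(4 := out x)) (S o1 f1 x)"
    proof (cases "out x")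
      case 0
      then show ?thesis
        by (intro big_eq[OF big.Loop_0]) (auto simp: S_def o1_def f1_def fun_eq_iff)
    next
      case (Suc v)
      have "big p (Seq (transfer 4 0) (erase 2)) ((S 0 1 x)(4 := v)) (S v 0 x)"
        by (intro big.Seq[OF big_transfer] big_eq[OF big_erase]) (auto simp: S_def fun_eq_iff)
      then have "big p (Loop 4 (Seq (transfer 4 0) (erase 2))) ((S 0 1 x)(4 := out x)) (S v 0 x)"
        by (intro big.Loop_Suc[where n = v, OF _ _ big.Loop_0]) (auto simp: S_def Suc)
      then show ?thesis by (simp add: o1_def f1_def Suc)
    qed
    note loop = this
    have 1: "big p (copy 3 4 5) (S 0 0 x) ((S 0 0 x)(4 := x))"
      by (intro big_eq[OF big_copy]) (auto simp: S_def)
    have 2: "big p c ((S 0 0 x)(4 := x)) ((S 0 0 x)(4 := out x))"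
      by (intro big_eq[OF computesD[OF comp(2)]]) (auto simp: S_def)
    have 3: "big p (Inc 2) ((S 0 0 x)(4 := out x)) ((S 0 1 x)(4 := out x))"
      by (intro big_eq[OF big.Inc]) (auto simp: S_def fun_eq_iff)
    have 4: "big p (copy 3 4 5) (S o1 f1 x) ((S o1 f1 x)(4 := x))"
      by (intro big_eq[OF big_copy]) (auto simp: S_def)
    have 5: "big p d ((S o1 f1 x)(4 := x)) ((S o1 f1 x)(4 := query x))"
      by (intro big_eq[OF computesD[OF comp(3)]]) (auto simp: S_def)
    have 6: "big p (transfer 4 1) ((S o1 f1 x)(4 := query x)) ((S o1 f1 x)(1 := query x))"
      by (intro big_eq[OF big_transfer]) (auto simp: S_def fun_eq_iff)
    have 7: "big p Ask ((S o1 f1 x)(1 := query x)) ((S o1 f1 x)(1 := p (query x)))"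
      by (intro big_eq[OF big.Ask]) (auto simp: S_def fun_eq_iff)
    have 8: "big p (transfer 1 4) ((S o1 f1 x)(1 := p (query x))) ((S o1 f1 x)(4 := p (query x)))"
      by (intro big_eq[OF big_transfer]) (auto simp: S_def fun_eq_iff)
    have 9: "big p (encode_pair 3 4 5 6 7) ((S o1 f1 x)(4 := p (query x)))
        ((S o1 f1 0)(7 := prod_encode (x, p (query x))))"
      by (intro big_eq[OF big_encode_pair]) (auto simp: S_def fun_eq_iff)
    have 10: "big p (transfer 7 3) ((S o1 f1 0)(7 := prod_encode (x, p (query x))))
        (S o1 f1 (prod_encode (x, p (query x))))"
      by (intro big_eq[OF big_transfer]) (auto simp: S_def fun_eq_iff)
    have 11: "big p e (S o1 f1 (prod_encode (x, p (query x))))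
        (S o1 f1 (nxt p x))"
      by (intro big_eq[OF computesD[OF comp(4)]]) (auto simp: S_def fun_eq_iff nxt_def)
    have "big p B (S 0 0 x) (S o1 f1 (nxt p x))"
      unfolding B_def search_body_def
      by (intro big.Seq[OF 1] big.Seq[OF 2] big.Seq[OF 3] big.Seq[OF loop] big.Seq[OF 4]
          big.Seq[OF 5] big.Seq[OF 6] big.Seq[OF 7] big.Seq[OF 8] big.Seq[OF 9] big.Seq[OF 10] 11)
    then show ?thesis by (auto simp: o1_def f1_def split: nat.splits)
  qed
  have S_upd: "(S 0 1 x)(2 := 0) = S 0 0 x" for x
    by (auto simp: S_def)
  have loop: "\<exists>x'. big p (Loop 2 B) (S 0 1 x) (S v 0 x')"
    if "out ((nxt p ^^ t) x) = Suc v"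
      "\<forall>j<t. out ((nxt p ^^ j) x) = 0" for p x v t
    using that
  proof (induction t arbitrary: x)
    case 0
    then have "big p B ((S 0 1 x)(2 := 0)) (S v 0 (nxt p x))"
      using body[of p x] by (simp only: S_upd nat.case funpow_0)
    then have "big p (Loop 2 B) (S 0 1 x) (S v 0 (nxt p x))"
      by (intro big.Loop_Suc[OF _ _ big.Loop_0]) (auto simp: S_def)
    then show ?case ..
  next
    case (Suc t)
    let ?x = "nxt p x"
    have "out x = 0" using Suc.prems(2)[rule_format, of 0] by simp
    then have 1: "big p B ((S 0 1 x)(2 := 0)) (S 0 1 ?x)"
      using body[of p x] by (simp only: S_upd nat.case)
    have "\<forall>j<t. out ((nxt p ^^ j) ?x) = 0"
    proof (intro allI impI)
      fix j assume "j < t"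
      then show "out ((nxt p ^^ j) ?x) = 0"
        using Suc.prems(2)[rule_format, of "Suc j"] by (simp add: funpow_swap1)
    qed
    moreover have "out ((nxt p ^^ t) ?x) = Suc v"
      using Suc.prems(1) by (simp add: funpow_swap1)
    ultimately obtain x' where 2: "big p (Loop 2 B) (S 0 1 ?x) (S v 0 x')"
      using Suc.IH by blast
    have "big p (Loop 2 B) (S 0 1 x) (S v 0 x')"
      by (rule big.Loop_Suc[OF _ 1 2]) (simp add: S_def)
    then show ?case ..
  qed
  obtain n where n: "machine n = code (Seq (transfer 0 3) (Seq a (Seq (Inc 2) (Loop 2 B)))) 0"
    using machine_surj by blast
  have "halts_with (machine n) p k v"
    if prem: "out ((nxt p ^^ t) (init k)) = Suc v"
      "\<forall>j<t. out ((nxt p ^^ j) (init k)) = 0" for p k v t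
  proof -
    from loop[OF prem] obtain x' where *: "big p (Loop 2 B) (S 0 1 (init k)) (S v 0 x')" by blast
    have 1: "big p (transfer 0 3) ((\<lambda>_. 0)(0 := k)) (S 0 0 k)"
      by (intro big_eq[OF big_transfer]) (auto simp: S_def fun_eq_iff)
    have 2: "big p a (S 0 0 k) (S 0 0 (init k))"
      by (intro big_eq[OF computesD[OF comp(1)]]) (auto simp: S_def fun_eq_iff)
    have 3: "big p (Inc 2) (S 0 0 (init k)) (S 0 1 (init k))"
      by (intro big_eq[OF big.Inc]) (auto simp: S_def fun_eq_iff)
    from big_halts_with[OF big.Seq[OF 1 big.Seq[OF 2 big.Seq[OF 3 *]]]]
    show ?thesis by (simp add: n S_def)
  qed
  then show ?thesis by blast
qed


section \<open>Primitive recursion on coded data\<close>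

text \<open>Codes need only be injective: a function on numbers that represents a map in
  \<open>prec\<close> may behave arbitrarily on numbers that are not codes.\<close>

class enc =
  fixes enc :: "'a \<Rightarrow> nat"
  assumes enc_inject [simp]: "enc x = enc y \<longleftrightarrow> x = y"

instantiation nat :: enc
begin
definition enc_nat :: "nat \<Rightarrow> nat" where [simp]: "enc_nat n = n"
instance by standard simp
end

instantiation bool :: enc
begin
definition enc_bool :: "bool \<Rightarrow> nat" where "enc_bool b = of_bool b"
instance by standard (simp add: enc_bool_def)
end

instantiation prod :: (enc, enc) enc
begin
definition enc_prod :: "'a \<times> 'b \<Rightarrow> nat" where
  "enc_prod x = prod_encode (enc (fst x), enc (snd x))"
instance by standard (simp add: enc_prod_def prod_eq_iff)
end

instantiation option :: (enc) enc
begin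
definition enc_option :: "'a option \<Rightarrow> nat" where
  "enc_option x = (case x of None \<Rightarrow> 0 | Some y \<Rightarrow> Suc (enc y))"
instance by standard (simp add: enc_option_def split: option.split)
end

instantiation list :: (enc) enc
begin
definition enc_list :: "'a list \<Rightarrow> nat" where
  "enc_list xs = list_encode (map enc xs)"
instance
proof
  show "enc xs = enc ys \<longleftrightarrow> xs = ys" for xs ys :: "'a list"
    using inj_map_eq_map[of "enc :: 'a \<Rightarrow> nat"] by (simp add: enc_list_def list_encode_eq inj_def)
qed
end

lemma enc_Nil: "enc [] = 0"
  by (simp add: enc_list_def)

lemma enc_Cons: "enc (x # xs) = Suc (prod_encode (enc x, enc xs))"
  by (simp add: enc_list_def)

lemma enc_nat_list: "enc xs = list_encode (xs :: nat list)"
  by (simp add: enc_list_def enc_nat_def[abs_def])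

section \<open>Closure properties of primitive recursive maps between coded types\<close>

definition prec :: "('a :: enc \<Rightarrow> 'b :: enc) \<Rightarrow> bool" where
  "prec f \<longleftrightarrow> (\<exists>g. pr g \<and> (\<forall>x. g (enc x) = enc (f x)))"

named_theorems prec_intros

lemma precI: "pr g \<Longrightarrow> (\<And>x. g (enc x) = enc (f x)) \<Longrightarrow> prec f"
  unfolding prec_def by blast

lemma precE:
  assumes "prec f"
  obtains g where "pr g" "\<And>x. g (enc x) = enc (f x)"
  using assms unfolding prec_def by blast

lemma pr_prec: "pr f \<Longrightarrow> prec f"
  by (rule precI) simp_all

lemma prec_enc_iff: "prec (\<lambda>x. enc (f x)) \<longleftrightarrow> prec f"
  by (simp add: prec_def)

lemma prec_encI: "prec (\<lambda>x. enc (f x)) \<Longrightarrow> prec f"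
  by (simp add: prec_enc_iff)

lemma prec_comp:
  assumes "prec f" "prec g"
  shows "prec (\<lambda>x. f (g x))"
proof -
  from assms obtain f' g' where "pr f'" "\<And>x. f' (enc x) = enc (f x)"
    "pr g'" "\<And>x. g' (enc x) = enc (g x)" unfolding prec_def by metis
  then show ?thesis by (intro precI[OF pr.comp[of f' g']]) auto
qed

lemma prec_const [prec_intros]: "prec (\<lambda>_. c)"
proof -
  have "pr (\<lambda>_. n)" for n
    by (induction n) (auto intro: pr.zero pr.comp[OF pr.Suc])
  then show ?thesis by (rule precI) simp
qed

lemma prec_id [prec_intros]: "prec (\<lambda>x. x)"
proof (rule precI)
  show "pr (\<lambda>x. x)"
    using pr.pair[OF pr.fst pr.snd] by simp
qed simp

lemma prec_enc: "prec f \<Longrightarrow> prec (\<lambda>x. enc (f x))"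
  by (simp add: prec_enc_iff)

lemma prec_fst [prec_intros]: "prec f \<Longrightarrow> prec (\<lambda>x. fst (f x))"
  by (rule prec_comp[of fst]) (rule precI[OF pr.fst], simp_all add: enc_prod_def)

lemma prec_snd [prec_intros]: "prec f \<Longrightarrow> prec (\<lambda>x. snd (f x))"
  by (rule prec_comp[of snd]) (rule precI[OF pr.snd], simp_all add: enc_prod_def)

lemma prec_prod_encode [prec_intros]:
  assumes "prec f" "prec g"
  shows "prec (\<lambda>x. prod_encode (f x, g x))"
proof -
  from assms obtain f' g' where "pr f'" "\<And>x. f' (enc x) = enc (f x)"
    "pr g'" "\<And>x. g' (enc x) = enc (g x)" unfolding prec_def by metis
  then show ?thesis by (intro precI[OF pr.pair[of f' g']]) auto
qed

lemma prec_Pair [prec_intros]: "prec f \<Longrightarrow> prec g \<Longrightarrow> prec (\<lambda>x. (f x, g x))"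
  by (rule prec_encI) (auto simp: enc_prod_def intro: prec_prod_encode prec_enc)

lemma prec_Suc [prec_intros]: "prec f \<Longrightarrow> prec (\<lambda>x. Suc (f x))"
  by (rule prec_comp[OF pr_prec[OF pr.Suc]])

lemma prec_prod_decode [prec_intros]: "prec f \<Longrightarrow> prec (\<lambda>x. prod_decode (f x))"
  by (rule prec_encI) (auto simp: enc_prod_def prec_enc_iff)

lemma prec_list_decode [prec_intros]: "prec f \<Longrightarrow> prec (\<lambda>x. list_decode (f x))"
  by (rule prec_encI) (simp add: enc_nat_list)

lemma prec_list_encode [prec_intros]: "prec f \<Longrightarrow> prec (\<lambda>x. list_encode (f x))"
  by (simp add: prec_enc_iff flip: enc_nat_list)

text \<open>\<open>pr.iter\<close> iterates a function without parameters, so the argument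
  \<open>x\<close> is carried along unchanged as the first component of the iterated value.\<close>

lemma prec_funpow [prec_intros]:
  fixes f :: "'a :: enc \<Rightarrow> 'b :: enc \<Rightarrow> 'b"
  assumes "prec (\<lambda>z. f (fst z) (snd z))" "prec n" "prec a"
  shows "prec (\<lambda>x. (f x ^^ n x) (a x))"
proof -
  from prec_Pair[OF prec_fst[OF prec_id] assms(1)] obtain h where
    h: "pr h" "h (enc z) = enc (fst z, f (fst z) (snd z))" for z
    by (auto elim: precE)
  have "(h ^^ k) (enc (x, y)) = enc (x, (f x ^^ k) y)" for k x y
    by (induction k) (simp_all add: h(2))
  moreover from assms obtain n' a' where
    n': "pr n'" "\<And>x. n' (enc x) = enc (n x)" and a': "pr a'" "\<And>x. a' (enc x) = enc (a x)"
    unfolding prec_def by metis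
  moreover have "pr (\<lambda>x. x)"
    using pr.pair[OF pr.fst pr.snd] by simp
  from pr.comp[OF pr.snd pr.comp[OF pr.iter[OF h(1)] pr.pair[OF pr.pair[OF this a'(1)] n'(1)]]]
  have "pr (\<lambda>e. snd (prod_decode ((h ^^ n' e) (prod_encode (e, a' e)))))" by simp
  ultimately show ?thesis
    by (elim precI) (simp add: enc_prod_def)
qed

lemma prec_of_bool [prec_intros]: "prec b \<Longrightarrow> prec (\<lambda>x. of_bool (b x) :: nat)"
  using prec_enc[of b] by (simp add: enc_bool_def)

lemma prec_if [prec_intros]:
  assumes "prec b" "prec f" "prec g"
  shows "prec (\<lambda>x. if b x then f x else g x)"
proof -
  \<comment> \<open>A case distinction is the iteration of a constant function, zero times or
    once.\<close>
  have "prec (\<lambda>x. ((\<lambda>_. f x) ^^ of_bool (b x)) (g x))"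
    by (intro prec_funpow prec_of_bool prec_comp[OF assms(2)] prec_fst prec_id assms)
  moreover have "((\<lambda>_. f x) ^^ of_bool (b x)) (g x) = (if b x then f x else g x)" for x
    by simp
  ultimately show ?thesis by simp
qed

lemma prec_conj [prec_intros]: "prec b \<Longrightarrow> prec c \<Longrightarrow> prec (\<lambda>x. b x \<and> c x)"
proof -
  assume "prec b" "prec c"
  then have "prec (\<lambda>x. if b x then c x else False)"
    by (intro prec_intros)
  moreover have "(\<lambda>x. if b x then c x else False) = (\<lambda>x. b x \<and> c x)" by auto
  ultimately show ?thesis by metis
qed

lemma prec_not [prec_intros]: "prec b \<Longrightarrow> prec (\<lambda>x. \<not> b x)"
proof -
  assume "prec b"
  then have "prec (\<lambda>x. if b x then False else True)"
    by (intro prec_intros)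
  moreover have "(\<lambda>x. if b x then False else True) = (\<lambda>x. \<not> b x)" by auto
  ultimately show ?thesis by metis
qed

lemma prec_disj [prec_intros]: "prec b \<Longrightarrow> prec c \<Longrightarrow> prec (\<lambda>x. b x \<or> c x)"
proof -
  assume "prec b" "prec c"
  then have "prec (\<lambda>x. \<not> (\<not> b x \<and> \<not> c x))"
    by (intro prec_intros)
  then show ?thesis unfolding de_Morgan_conj not_not .
qed

lemma prec_rec_nat [prec_intros]:
  assumes "prec (\<lambda>z. f (fst z) (fst (snd z)) (snd (snd z)))" "prec a" "prec n"
  shows "prec (\<lambda>x. rec_nat (a x) (f x) (n x))"
proof -
  have "prec (\<lambda>x. snd (((\<lambda>z. (Suc (fst z), f x (fst z) (snd z))) ^^ n x) (0, a x)))"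
    by (intro prec_intros assms)
  moreover have "((\<lambda>z. (Suc (fst z), f x (fst z) (snd z))) ^^ k) (0, a x) =
      (k, rec_nat (a x) (f x) k)" for x k
    by (induction k) simp_all
  ultimately show ?thesis by simp
qed

lemma prec_pred: "prec f \<Longrightarrow> prec (\<lambda>x. f x - Suc 0)"
proof -
  assume f: "prec f"
  have "prec (\<lambda>x. rec_nat 0 (\<lambda>m _. m) (f x))"
    by (intro prec_intros f)
  moreover have "rec_nat 0 (\<lambda>m _. m) n = n - Suc 0" for n
    by (cases n) simp_all
  ultimately show ?thesis by simp
qed

lemma prec_case_nat [prec_intros]:
  assumes "prec n" "prec a" "prec (\<lambda>z. h (fst z) (snd z))"
  shows "prec (\<lambda>x. case n x of 0 \<Rightarrow> a x | Suc m \<Rightarrow> h x m)"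
proof -
  have "prec (\<lambda>x. rec_nat (a x) (\<lambda>m _. h x m) (n x))"
    by (intro prec_rec_nat prec_comp[OF assms(3), of "\<lambda>z. (fst z, fst (snd z))", simplified]
        prec_intros assms)
  moreover have "rec_nat (a x) (\<lambda>m _. h x m) (n x) = (case n x of 0 \<Rightarrow> a x | Suc m \<Rightarrow> h x m)" for x
    by (cases "n x") simp_all
  ultimately show ?thesis by simp
qed

lemma prec_plus [prec_intros]: "prec f \<Longrightarrow> prec g \<Longrightarrow> prec (\<lambda>x. f x + g x :: nat)"
proof -
  assume fg: "prec f" "prec g"
  have "prec (\<lambda>x. (Suc ^^ f x) (g x))"
    by (intro prec_intros fg)
  moreover have "(Suc ^^ m) n = m + n" for m n
    by (induction m) simp_all
  ultimately show ?thesis by simp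
qed

lemma prec_minus [prec_intros]: "prec f \<Longrightarrow> prec g \<Longrightarrow> prec (\<lambda>x. f x - g x :: nat)"
proof -
  assume fg: "prec f" "prec g"
  have "prec (\<lambda>x. ((\<lambda>n. n - Suc 0) ^^ g x) (f x))"
    by (intro prec_intros prec_pred fg)
  moreover have "((\<lambda>n. n - Suc 0) ^^ m) n = n - m" for m n
    by (induction m) simp_all
  ultimately show ?thesis by simp
qed

lemma prec_times [prec_intros]: "prec f \<Longrightarrow> prec g \<Longrightarrow> prec (\<lambda>x. f x * g x :: nat)"
proof -
  assume fg: "prec f" "prec g"
  have "prec (\<lambda>x. ((\<lambda>n. g x + n) ^^ f x) 0)"
    by (intro prec_intros prec_comp[OF fg(2)] fg)
  moreover have "((\<lambda>n. k + n) ^^ m) 0 = m * k" for m k :: nat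
    by (induction m) simp_all
  ultimately show ?thesis by simp
qed

lemma prec_le [prec_intros]: "prec f \<Longrightarrow> prec g \<Longrightarrow> prec (\<lambda>x. f x \<le> (g x :: nat))"
proof -
  assume fg: "prec f" "prec g"
  have "prec (\<lambda>x. case f x - g x of 0 \<Rightarrow> True | Suc _ \<Rightarrow> False)"
    by (intro prec_intros fg)
  moreover have "(case f x - g x of 0 \<Rightarrow> True | Suc _ \<Rightarrow> False) \<longleftrightarrow> f x \<le> g x" for x
    by (simp split: nat.split) arith
  ultimately show ?thesis by simp
qed

lemma prec_less [prec_intros]: "prec f \<Longrightarrow> prec g \<Longrightarrow> prec (\<lambda>x. f x < (g x :: nat))"
  unfolding less_eq_Suc_le by (intro prec_intros)

lemma prec_eq [prec_intros]: "prec f \<Longrightarrow> prec g \<Longrightarrow> prec (\<lambda>x. f x = g x)"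
proof -
  assume fg: "prec f" "prec g"
  have "prec (\<lambda>x. enc (f x) \<le> enc (g x) \<and> enc (g x) \<le> enc (f x))"
    by (intro prec_intros prec_enc fg)
  moreover have "enc (f x) \<le> enc (g x) \<and> enc (g x) \<le> enc (f x) \<longleftrightarrow> f x = g x" for x
    by (metis enc_inject order_antisym order_refl)
  ultimately show ?thesis by simp
qed

lemma prec_all_less [prec_intros]:
  fixes P :: "'a :: enc \<Rightarrow> nat \<Rightarrow> bool"
  assumes "prec n" "prec (\<lambda>z. P (fst z) (snd z))"
  shows "prec (\<lambda>x. \<forall>i<n x. P x i)"
proof -
  have "prec (\<lambda>x. rec_nat True (\<lambda>i b. b \<and> P x i) (n x))"
    by (intro prec_intros prec_comp[OF assms(2), of "\<lambda>z. (fst z, fst (snd z))", simplified] assms)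
  moreover have "rec_nat True (\<lambda>i b. b \<and> P x i) k \<longleftrightarrow> (\<forall>i<k. P x i)" for x k
    by (induction k) (auto simp: less_Suc_eq)
  ultimately show ?thesis by simp
qed

lemma prec_even [prec_intros]: "prec f \<Longrightarrow> prec (\<lambda>x. even (f x :: nat))"
proof -
  assume f: "prec f"
  have "prec (\<lambda>x. (Not ^^ f x) True)"
    by (intro prec_intros f)
  moreover have "(Not ^^ n) True \<longleftrightarrow> even n" for n
    by (induction n) simp_all
  ultimately show ?thesis by simp
qed

lemma prec_div2 [prec_intros]: "prec f \<Longrightarrow> prec (\<lambda>x. f x div 2 :: nat)"
proof -
  assume f: "prec f"
  have "prec (\<lambda>x. fst (((\<lambda>z :: nat \<times> nat. (snd z, Suc (fst z))) ^^ f x) (0, 0)))"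
    by (intro prec_intros f)
  moreover have "((\<lambda>z :: nat \<times> nat. (snd z, Suc (fst z))) ^^ n) (0, 0) = (n div 2, Suc n div 2)" for n
    by (induction n) simp_all
  ultimately show ?thesis by simp
qed

lemma prec_Some [prec_intros]: "prec f \<Longrightarrow> prec (\<lambda>x. Some (f x))"
  by (rule prec_encI) (auto simp: enc_option_def intro: prec_Suc prec_enc)

text \<open>The class provides no inverse of \<open>enc\<close>. The components of an option or a
  list are at hand only as numbers, and \<open>h'\<close> accepts them in that form.\<close>

lemma prec_via_enc:
  assumes "prec h"
  obtains h' where "prec h'" "\<And>x. h' (enc x) = enc (h x)"
  using assms pr_prec by (auto elim!: precE)

lemma prec_case_option [prec_intros]:
  assumes "prec f" "prec a" "prec (\<lambda>z. h (fst z) (snd z))"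
  shows "prec (\<lambda>x. case f x of None \<Rightarrow> a x | Some y \<Rightarrow> h x y)"
proof -
  from prec_via_enc[OF assms(3)] obtain h' where
    h': "prec h'" "\<And>z. h' (enc z) = enc (h (fst z) (snd z))" by blast
  have "prec (\<lambda>x. case enc (f x) of 0 \<Rightarrow> enc (a x) | Suc n \<Rightarrow> h' (prod_encode (enc x, n)))"
    by (intro prec_intros prec_enc prec_comp[OF h'(1)] assms)
  moreover have "(case enc (f x) of 0 \<Rightarrow> enc (a x) | Suc n \<Rightarrow> h' (prod_encode (enc x, n))) =
      enc (case f x of None \<Rightarrow> a x | Some y \<Rightarrow> h x y)" for x
    using h'(2)[of "(x, _)"] by (simp add: enc_option_def enc_prod_def split: option.split)
  ultimately have "prec (\<lambda>x. enc (case f x of None \<Rightarrow> a x | Some y \<Rightarrow> h x y))" by simp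
  then show ?thesis by (rule prec_encI)
qed

lemma prec_Cons [prec_intros]: "prec f \<Longrightarrow> prec g \<Longrightarrow> prec (\<lambda>x. f x # g x)"
  by (rule prec_encI) (unfold enc_Cons, intro prec_Suc prec_prod_encode prec_enc)

lemma prec_case_list [prec_intros]:
  assumes "prec f" "prec a" "prec (\<lambda>z. h (fst z) (fst (snd z)) (snd (snd z)))"
  shows "prec (\<lambda>x. case f x of [] \<Rightarrow> a x | y # ys \<Rightarrow> h x y ys)"
proof -
  from prec_via_enc[OF assms(3)] obtain h' where
    h': "prec h'" "\<And>z. h' (enc z) = enc (h (fst z) (fst (snd z)) (snd (snd z)))" by blast
  have "prec (\<lambda>x. case enc (f x) of 0 \<Rightarrow> enc (a x) | Suc n \<Rightarrow> h' (prod_encode (enc x, n)))"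
    by (intro prec_intros prec_enc prec_comp[OF h'(1)] assms)
  moreover have "(case enc (f x) of 0 \<Rightarrow> enc (a x) | Suc n \<Rightarrow> h' (prod_encode (enc x, n))) =
      enc (case f x of [] \<Rightarrow> a x | y # ys \<Rightarrow> h x y ys)" for x
    using h'(2)[of "(x, _, _)"] by (simp add: enc_Nil enc_Cons enc_prod_def split: list.split)
  ultimately have "prec (\<lambda>x. enc (case f x of [] \<Rightarrow> a x | y # ys \<Rightarrow> h x y ys))" by simp
  then show ?thesis by (rule prec_encI)
qed

text \<open>Bounds the number of rounds of a fold by the code of the list, since
  \<open>length\<close> is itself obtained from a fold. Surplus rounds do not change anything once
  the list is empty.\<close>

lemma length_le_enc: "length xs \<le> enc xs"
proof (induction xs)
  case (Cons x xs)
  then show ?case using le_prod_encode_2[of "enc xs" "enc x"] by (simp add: enc_Cons)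
qed simp

lemma prec_fold [prec_intros]:
  fixes f :: "'a :: enc \<Rightarrow> 'b :: enc \<Rightarrow> 'c :: enc \<Rightarrow> 'c"
  assumes "prec (\<lambda>z. f (fst z) (fst (snd z)) (snd (snd z)))" "prec l" "prec a"
  shows "prec (\<lambda>x. fold (f x) (l x) (a x))"
proof -
  let ?step = "\<lambda>x z. case fst z of [] \<Rightarrow> z | y # ys \<Rightarrow> (ys, f x y (snd z))"
  have 1: "prec (\<lambda>x. snd ((?step x ^^ enc (l x)) (l x, a x)))"
    by (intro prec_intros prec_enc assms
        prec_comp[OF assms(1), of "\<lambda>z. (fst (fst z), fst (snd z), snd (snd (fst z)))", simplified])
  have "length ys \<le> n \<Longrightarrow> (?step x ^^ n) (ys, acc) = ([], fold (f x) ys acc)" for x n ys acc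
  proof (induction n arbitrary: ys acc)
    case (Suc n)
    then show ?case by (cases ys) (simp_all add: funpow_Suc_right del: funpow.simps)
  qed simp
  note * = this
  have 2: "(?step x ^^ enc (l x)) (l x, a x) = ([], fold (f x) (l x) (a x))" for x
    by (rule *[OF length_le_enc])
  show ?thesis using 1 unfolding 2 by simp
qed

lemma prec_rev [prec_intros]: "prec l \<Longrightarrow> prec (\<lambda>x. rev (l x))"
proof -
  assume l: "prec l"
  have "prec (\<lambda>x. fold (\<lambda>y ys. y # ys) (l x) [])"
    by (intro prec_intros l)
  then show ?thesis by (simp add: fold_Cons_rev)
qed

lemma prec_append [prec_intros]: "prec l \<Longrightarrow> prec m \<Longrightarrow> prec (\<lambda>x. l x @ m x)"
proof -
  assume lm: "prec l" "prec m"
  have "prec (\<lambda>x. fold (\<lambda>y ys. y # ys) (rev (l x)) (m x))"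
    by (intro prec_intros lm)
  then show ?thesis by (simp add: fold_Cons_rev)
qed

lemma prec_foldr [prec_intros]:
  assumes "prec (\<lambda>z. f (fst z) (fst (snd z)) (snd (snd z)))" "prec l" "prec a"
  shows "prec (\<lambda>x. foldr (f x) (l x) (a x))"
  unfolding foldr_conv_fold by (intro prec_intros assms)

lemma prec_map [prec_intros]:
  assumes "prec (\<lambda>z. f (fst z) (snd z))" "prec l"
  shows "prec (\<lambda>x. map (f x) (l x))"
proof -
  have "prec (\<lambda>x. foldr (\<lambda>y ys. f x y # ys) (l x) [])"
    by (intro prec_intros assms prec_comp[OF assms(1), of "\<lambda>z. (fst z, fst (snd z))", simplified])
  moreover have "foldr (\<lambda>y ys. f x y # ys) ys [] = map (f x) ys" for x ys
    by (induction ys) simp_all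
  ultimately show ?thesis by simp
qed

lemma prec_concat [prec_intros]: "prec l \<Longrightarrow> prec (\<lambda>x. concat (l x))"
  unfolding concat_conv_foldr by (intro prec_intros)

lemma prec_length [prec_intros]: "prec l \<Longrightarrow> prec (\<lambda>x. length (l x))"
proof -
  assume l: "prec l"
  have "prec (\<lambda>x. fold (\<lambda>_ n. Suc n) (l x) 0)"
    by (intro prec_intros l)
  moreover have "fold (\<lambda>_ n. Suc n) ys k = k + length ys" for ys :: "'b list" and k
    by (induction ys arbitrary: k) simp_all
  ultimately show ?thesis by simp
qed

lemma prec_upt [prec_intros]: "prec m \<Longrightarrow> prec n \<Longrightarrow> prec (\<lambda>x. [m x..<n x])"
proof -
  assume mn: "prec m" "prec n"
  have "prec (\<lambda>x. rec_nat [] (\<lambda>k l. l @ [m x + k]) (n x - m x))"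
    by (intro prec_intros mn prec_comp[OF mn(1)])
  moreover have "rec_nat [] (\<lambda>k l. l @ [i + k]) n = [i..<i + n]" for i n :: nat
    by (induction n) simp_all
  moreover have "[i..<i + (j - i)] = [i..<j]" for i j :: nat
    by (cases "i \<le> j") simp_all
  ultimately show ?thesis by simp
qed

lemma prec_drop [prec_intros]: "prec n \<Longrightarrow> prec l \<Longrightarrow> prec (\<lambda>x. drop (n x) (l x))"
proof -
  assume nl: "prec n" "prec l"
  have "prec (\<lambda>x. ((\<lambda>l. case l of [] \<Rightarrow> [] | y # ys \<Rightarrow> ys) ^^ n x) (l x))"
    by (intro prec_intros nl)
  moreover have "((\<lambda>l. case l of [] \<Rightarrow> [] | y # ys \<Rightarrow> ys) ^^ k) ys = drop k ys" for k and ys :: "'b list"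
    by (induction k arbitrary: ys)
      (simp_all add: funpow_Suc_right drop_Suc del: funpow.simps split: list.split)
  ultimately show ?thesis by simp
qed

lemma prec_take [prec_intros]: "prec n \<Longrightarrow> prec l \<Longrightarrow> prec (\<lambda>x. take (n x) (l x))"
proof -
  assume nl: "prec n" "prec l"
  have "prec (\<lambda>x. rev (drop (length (l x) - n x) (rev (l x))))"
    by (intro prec_intros nl)
  then show ?thesis by (simp add: take_rev flip: rev_take)
qed

definition lookup :: "'a list \<Rightarrow> nat \<Rightarrow> 'a option" where
  "lookup xs i = (if i < length xs then Some (xs ! i) else None)"

lemma prec_lookup [prec_intros]: "prec l \<Longrightarrow> prec n \<Longrightarrow> prec (\<lambda>x. lookup (l x) (n x))"
proof -
  assume ln: "prec l" "prec n"
  have "prec (\<lambda>x. case drop (n x) (l x) of [] \<Rightarrow> None | y # _ \<Rightarrow> Some y)"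
    by (intro prec_intros ln)
  moreover have "(case drop i ys of [] \<Rightarrow> None | y # _ \<Rightarrow> Some y) = lookup ys i" for i and ys :: "'b list"
    by (cases "i < length ys") (simp_all add: lookup_def Cons_nth_drop_Suc[symmetric])
  ultimately show ?thesis by simp
qed

lemma prec_find [prec_intros]:
  assumes "prec (\<lambda>z. P (fst z) (snd z))" "prec l"
  shows "prec (\<lambda>x. find (P x) (l x))"
proof -
  have "prec (\<lambda>x. foldr (\<lambda>y r. if P x y then Some y else r) (l x) None)"
    by (intro prec_intros assms prec_comp[OF assms(1), of "\<lambda>z. (fst z, fst (snd z))", simplified])
  moreover have "foldr (\<lambda>y r. if P x y then Some y else r) ys None = find (P x) ys" for x ys
    by (induction ys) simp_all
  ultimately show ?thesis by simp
qed

text \<open>Recursion with changing parameters: the calls for \<open>k\<close> are made at the new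
  arguments \<open>args x\<close>, whereas \<open>prec_rec_nat\<close> keeps its parameter fixed. It
  serves for \<open>level\<close>, where one level consults the previous one at another
  name.\<close>

fun tree_rec :: "('a \<Rightarrow> 'b) \<Rightarrow> ('a \<Rightarrow> 'a list) \<Rightarrow> ('a \<Rightarrow> 'b list \<Rightarrow> 'b) \<Rightarrow> nat \<Rightarrow> 'a \<Rightarrow> 'b" where
  "tree_rec g args h 0 x = g x"
| "tree_rec g args h (Suc k) x = h x (map (tree_rec g args h k) (args x))"

text \<open>The recursion is unfolded into the list of all arguments of each level; the values are then
  collected bottom-up in association lists.\<close>

lemma prec_tree_rec:
  fixes g :: "'a :: enc \<Rightarrow> 'b :: enc" and f :: "'c :: enc \<Rightarrow> 'a"
  assumes "prec g" "prec args" "prec (\<lambda>z. h (fst z) (snd z))" "prec n" "prec f"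
  shows "prec (\<lambda>x. tree_rec g args h (n x) (f x))"
proof -
  define level where "level = (\<lambda>x k. ((\<lambda>l. concat (map args l)) ^^ k) [x])"
  define val where "val = (\<lambda>m y. case find (\<lambda>z. fst z = y) m of None \<Rightarrow> g y | Some z \<Rightarrow> snd z)"
  define memo where "memo = (\<lambda>x k i. rec_nat (map (\<lambda>y. (y, g y)) (level x k))
    (\<lambda>i m. map (\<lambda>y. (y, h y (map (val m) (args y)))) (level x (k - Suc i))) i)"
  have level: "prec (\<lambda>z. level (a z) (b z))" if "prec a" "prec b" for a :: "'z :: enc \<Rightarrow> _" and b
    unfolding level_def by (intro prec_intros that prec_comp[OF assms(2)])
  have val: "prec (\<lambda>z. val (a z) (b z))" if "prec a" "prec b" for a :: "'z :: enc \<Rightarrow> _" and b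
    unfolding val_def
    by (intro prec_intros that prec_comp[OF assms(1)] prec_comp[OF that(2)])
  have h: "prec (\<lambda>z. h (a z) (b z))" if "prec a" "prec b" for a :: "'z :: enc \<Rightarrow> _" and b
    using prec_comp[OF assms(3) prec_Pair[OF that]] by simp
  have memo: "prec (\<lambda>x. memo (f x) (n x) (n x))"
    unfolding memo_def
    by (intro prec_intros level val h prec_comp[OF assms(1)] prec_comp[OF assms(2)] prec_comp[OF assms(4)]
        prec_comp[OF assms(5)])
  have val_map: "val (map (\<lambda>y. (y, F y)) l) y = F y" if "y \<in> set l" for F l y
  proof -
    have "find (\<lambda>z. fst z = y) (map (\<lambda>y. (y, F y)) l) = Some (y, F y)"
      using that by (induction l) auto
    then show ?thesis by (simp add: val_def)
  qed
  have *: "i \<le> k \<Longrightarrow> memo x k i = map (\<lambda>y. (y, tree_rec g args h i y)) (level x (k - i))" for x k i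
  proof (induction i)
    case 0
    then show ?case by (simp add: memo_def)
  next
    case (Suc i)
    then have IH: "memo x k i = map (\<lambda>y. (y, tree_rec g args h i y)) (level x (k - i))" by simp
    have lev: "level x (k - i) = concat (map args (level x (k - Suc i)))"
    proof -
      from Suc.prems have "k - i = Suc (k - Suc i)" by simp
      then show ?thesis by (simp only: level_def funpow.simps comp_apply)
    qed
    have "memo x k (Suc i) = map (\<lambda>y. (y, h y (map (val (memo x k i)) (args y)))) (level x (k - Suc i))"
      by (simp add: memo_def)
    also have "\<dots> = map (\<lambda>y. (y, tree_rec g args h (Suc i) y)) (level x (k - Suc i))"
      unfolding IH by (auto simp: lev intro!: arg_cong[of _ _ "h _"] val_map bexI)
    finally show ?case .
  qed
  then have "val (memo (f x) (n x) (n x)) (f x) = tree_rec g args h (n x) (f x)" for x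
    by (simp add: level_def val_def)
  moreover have "prec (\<lambda>x. val (memo (f x) (n x) (n x)) (f x))"
    by (intro val memo assms)
  ultimately show ?thesis by simp
qed

subsection \<open>Functions determined by finite parts of the oracle\<close>

definition seg :: "baire \<Rightarrow> nat \<Rightarrow> nat list" where
  "seg p t = map p [0..<t]"

lemma length_seg [simp]: "length (seg p t) = t"
  by (simp add: seg_def)

lemma seg_Suc: "seg p (Suc t) = seg p t @ [p t]"
  by (simp add: seg_def)

text \<open>The bridge to computability on Baire space. \<open>f\<close> may change from answer to
  silence on longer segments; correct answers and at least one of them suffice, because the machine
  stops at the first.\<close>

lemma prec_machine:
  fixes f :: "nat \<Rightarrow> nat list \<Rightarrow> nat option"
  assumes f: "prec (\<lambda>z. f (fst z) (snd z))"
  shows "\<exists>n. \<forall>p r. (\<forall>k. (\<forall>t v. f k (seg p t) = Some v \<longrightarrow> v = r k) \<and> (\<exists>t. f k (seg p t) \<noteq> None)) \<longrightarrow>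
    machine_map (machine n) p = Some r"
proof -
  have "prec (\<lambda>k :: nat. (k, [] :: nat list))"
    by (intro prec_intros)
  then obtain init where init: "pr init" "\<And>k :: nat. init (enc k) = enc (k, [] :: nat list)"
    by (rule precE) blast
  have "prec (\<lambda>z :: nat \<times> nat list. length (snd z))"
    by (intro prec_intros)
  then obtain query where
    query: "pr query" "\<And>z :: nat \<times> nat list. query (enc z) = enc (length (snd z))"
    by (rule precE) blast
  \<comment> \<open>The known part of the oracle is kept in reverse, so that a new value is one
    \<open>Cons\<close>; its length is the next query.\<close>
  have "prec (\<lambda>z :: (nat \<times> nat list) \<times> nat. (fst (fst z), snd z # snd (fst z)))"
    by (intro prec_intros)
  then obtain upd where upd: "pr upd"
    "\<And>z :: (nat \<times> nat list) \<times> nat. upd (enc z) = enc (fst (fst z), snd z # snd (fst z))"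
    by (rule precE) blast
  have "prec (\<lambda>z :: nat \<times> nat list. f (fst z) (rev (snd z)))"
    by (intro prec_intros prec_comp[OF f, of "\<lambda>z. (fst z, rev (snd z))", simplified])
  then obtain out where out: "pr out" "\<And>z. out (enc z) = enc (f (fst z) (rev (snd z)))"
    by (rule precE) blast
  define nxt where "nxt = (\<lambda>p x. upd (prod_encode (x, p (query x))))"
  obtain n where n: "\<forall>p k v t. out ((nxt p ^^ t) (init k)) = Suc v \<longrightarrow>
      (\<forall>j<t. out ((nxt p ^^ j) (init k)) = 0) \<longrightarrow> halts_with (machine n) p k v"
    using search_computable[OF init(1) out(1) query(1) upd(1)] unfolding nxt_def by (rule exE)
  have it: "(nxt p ^^ t) (init k) = enc (k, rev (seg p t))" for p t k
  proof (induction t)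
    case 0
    then show ?case using init(2)[of k] by (simp add: seg_def)
  next
    case (Suc t)
    then show ?case
      using query(2)[of "(k, rev (seg p t))"] upd(2)[of "((k, rev (seg p t)), p t)"]
      by (simp add: nxt_def seg_Suc enc_prod_def)
  qed
  have out_it: "out ((nxt p ^^ t) (init k)) = (case f k (seg p t) of None \<Rightarrow> 0 | Some v \<Rightarrow> Suc (enc v))" for p t k
    by (simp add: it out(2) enc_option_def)
  have "machine_map (machine n) p = Some r"
    if r: "\<forall>k. (\<forall>t v. f k (seg p t) = Some v \<longrightarrow> v = r k) \<and> (\<exists>t. f k (seg p t) \<noteq> None)" for p r
    unfolding machine_map_eq_Some
  proof
    fix k
    define t where "t = (LEAST t. f k (seg p t) \<noteq> None)"
    from r have "\<exists>t. f k (seg p t) \<noteq> None" by blast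
    then have "f k (seg p t) \<noteq> None" unfolding t_def by (rule LeastI_ex)
    with r have "f k (seg p t) = Some (r k)" by blast
    moreover have "f k (seg p j) = None" if "j < t" for j
      using that not_less_Least unfolding t_def by blast
    ultimately show "halts_with (machine n) p k (r k)"
      by (intro n[rule_format, where t = t]) (simp_all add: out_it)
  qed
  note * = this
  show ?thesis by (intro exI allI impI) (rule *)
qed


section \<open>Simulation of oracle machines on finite oracles\<close>

fun flat :: "instr \<Rightarrow> bool \<times> nat \<times> nat \<times> nat \<times> nat \<times> nat \<times> nat" where
  "flat (Act s i a b d s') = (False, s, i, a, b, (case d of Left \<Rightarrow> 0 | Right \<Rightarrow> 1), s')"
| "flat (Query s s') = (True, s, 0, 0, 0, 0, s')"

lemma flat_inject: "flat I = flat J \<longleftrightarrow> I = J"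
  by (cases I; cases J) (auto split: dir.splits)

instantiation instr :: enc
begin
definition enc_instr :: "instr \<Rightarrow> nat" where "enc_instr I = enc (flat I)"
instance by standard (simp add: enc_instr_def flat_inject)
end

lemma prec_flat [prec_intros]: "prec f \<Longrightarrow> prec (\<lambda>x. flat (f x))"
  by (rule prec_encI) (simp add: prec_enc_iff flip: enc_instr_def)

lemma prec_machine_decode [prec_intros]: "prec f \<Longrightarrow> prec (\<lambda>x. machine (f x))"
proof -
  assume f: "prec f"
  have "prec (\<lambda>n. let m = n div 2 in
    if even n then
      (let m1 = snd (prod_decode m); m2 = snd (prod_decode m1); m3 = snd (prod_decode m2);
           m4 = snd (prod_decode m3); d = fst (prod_decode m4)
       in (False, fst (prod_decode m), fst (prod_decode m1), fst (prod_decode m2),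
           fst (prod_decode m3), if d = 0 then 0 else 1, snd (prod_decode m4)))
    else (True, fst (prod_decode m), 0, 0, 0, 0, snd (prod_decode m)))"
    unfolding Let_def by (intro prec_intros)
  moreover have "(let m = n div 2 in
    if even n then
      (let m1 = snd (prod_decode m); m2 = snd (prod_decode m1); m3 = snd (prod_decode m2);
           m4 = snd (prod_decode m3); d = fst (prod_decode m4)
       in (False, fst (prod_decode m), fst (prod_decode m1), fst (prod_decode m2),
           fst (prod_decode m3), if d = 0 then 0 else 1, snd (prod_decode m4)))
    else (True, fst (prod_decode m), 0, 0, 0, 0, snd (prod_decode m))) = flat (instr_decode n)" for n
    by (simp add: instr_decode_def sum_decode_def split_def Let_def)
  ultimately have "prec (\<lambda>n. flat (instr_decode n))"
    by (rule back_subst[of prec, OF _ ext])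
  then have "prec (\<lambda>n. enc (flat (instr_decode n)))" by (rule prec_enc)
  then have "prec instr_decode"
    by (rule_tac prec_encI) (simp add: enc_instr_def)
  note decode = this
  have "prec (\<lambda>n. map instr_decode (list_decode n))"
    by (intro prec_intros prec_comp[OF decode])
  from prec_comp[OF this f] show ?thesis by (simp add: machine_def)
qed

lemma prec_first_cell [prec_intros]: "prec f \<Longrightarrow> prec (\<lambda>x. first_cell (f x))"
proof -
  assume f: "prec f"
  have "prec (\<lambda>x. case f x of [] \<Rightarrow> 0 | a # _ \<Rightarrow> a)"
    by (intro prec_intros f)
  moreover have "(case r of [] \<Rightarrow> 0 | a # _ \<Rightarrow> a) = first_cell r" for r
    by (cases r) simp_all
  ultimately show ?thesis by simp
qed

lemma prec_tl [prec_intros]: "prec f \<Longrightarrow> prec (\<lambda>x. tl (f x))"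
  unfolding tl_def by (intro prec_intros)

lemma prec_read_tape [prec_intros]: "prec f \<Longrightarrow> prec (\<lambda>x. read_tape (f x))"
proof -
  assume "prec f"
  then have "prec (\<lambda>x. first_cell (snd (f x)))" by (intro prec_intros)
  moreover have "read_tape t = first_cell (snd t)" for t by (cases t) simp
  ultimately show ?thesis by simp
qed

lemma prec_write_tape [prec_intros]: "prec b \<Longrightarrow> prec f \<Longrightarrow> prec (\<lambda>x. write_tape (b x) (f x))"
proof -
  assume "prec b" "prec f"
  then have "prec (\<lambda>x. (fst (f x), b x # tl (snd (f x))))" by (intro prec_intros)
  moreover have "write_tape b t = (fst t, b # tl (snd t))" for b t by (cases t) simp
  ultimately show ?thesis by simp
qed

lemma prec_move_tape [prec_intros]: "prec f \<Longrightarrow> prec (\<lambda>x. move_tape d (f x))"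
proof -
  assume f: "prec f"
  have "prec (\<lambda>x. (tl (fst (f x)), first_cell (fst (f x)) # snd (f x)))"
    "prec (\<lambda>x. (first_cell (snd (f x)) # fst (f x), tl (snd (f x))))"
    by (intro prec_intros f)+
  moreover have "move_tape Left t = (tl (fst t), first_cell (fst t) # snd t)"
    "move_tape Right t = (first_cell (snd t) # fst t, tl (snd t))" for t by (cases t; simp)+
  ultimately show ?thesis by (cases d) simp_all
qed

lemma prec_count_list [prec_intros]: "prec l \<Longrightarrow> prec a \<Longrightarrow> prec (\<lambda>x. count_list (l x) (a x))"
proof -
  assume l: "prec l" "prec a"
  have "prec (\<lambda>x. foldr (\<lambda>y n. if y = a x then Suc n else n) (l x) 0)"
    by (intro prec_intros l prec_comp[OF l(2)])
  moreover have "foldr (\<lambda>y n. if y = a then Suc n else n) ys 0 = count_list ys a" for ys :: "'b list" and a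
    by (induction ys) simp_all
  ultimately show ?thesis by simp
qed

lemma prec_ones [prec_intros]: "prec f \<Longrightarrow> prec (\<lambda>x. ones (f x))"
proof -
  assume "prec f"
  then have "prec (\<lambda>x. count_list (fst (f x)) 1 + count_list (snd (f x)) 1)" by (intro prec_intros)
  moreover have "ones t = count_list (fst t) 1 + count_list (snd t) 1" for t by (cases t) simp
  ultimately show ?thesis by simp
qed

lemma prec_unary [prec_intros]: "prec n \<Longrightarrow> prec (\<lambda>x. unary (n x))"
proof -
  assume n: "prec n"
  have "prec (\<lambda>x. ([] :: nat list, map (\<lambda>_. 1 :: nat) [0..<n x]))" by (intro prec_intros n)
  moreover have "([], map (\<lambda>_. 1) [0..<n]) = unary n" for n
    by (simp add: unary_def map_replicate_const)
  ultimately show ?thesis by simp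
qed

text \<open>A configuration is a function on all tape numbers and has no code, but only finitely
  many tapes have been touched. The newest entry for a tape shadows the older ones.\<close>

type_synonym sconfig = "nat \<times> (nat \<times> tape) list"

definition tape_at :: "(nat \<times> tape) list \<Rightarrow> nat \<Rightarrow> tape" where
  "tape_at ts i = (case find (\<lambda>z. fst z = i) ts of None \<Rightarrow> ([], []) | Some z \<Rightarrow> snd z)"

definition config_of :: "sconfig \<Rightarrow> config" where
  "config_of c = (fst c, tape_at (snd c))"

definition find_instr :: "instr list \<Rightarrow> sconfig \<Rightarrow> instr option" where
  "find_instr M c = find (applicable (config_of c)) M"

text \<open>A query beyond \<open>\<sigma>\<close> leaves the configuration as it is. An instruction
  is then still applicable, so \<open>sim\<close> never reports a halt that rests on an unknown
  oracle value.\<close>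

definition sexec :: "nat list \<Rightarrow> sconfig \<Rightarrow> instr \<Rightarrow> sconfig" where
  "sexec \<sigma> c I =
     (case flat I of (query, s, i, a, b, d, s') \<Rightarrow>
        if query then
          (case lookup \<sigma> (ones (tape_at (snd c) 1)) of
             None \<Rightarrow> c
           | Some v \<Rightarrow> (s', (1, unary v) # snd c))
        else
          (s', (i, let t = write_tape b (tape_at (snd c) i)
                   in if d = 0 then move_tape Left t else move_tape Right t) # snd c))"

definition sstep :: "instr list \<Rightarrow> nat list \<Rightarrow> sconfig \<Rightarrow> sconfig" where
  "sstep M \<sigma> c = (case find_instr M c of None \<Rightarrow> c | Some I \<Rightarrow> sexec \<sigma> c I)"

definition sim :: "instr list \<Rightarrow> nat list \<Rightarrow> nat \<Rightarrow> nat \<Rightarrow> nat option" where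
  "sim M \<sigma> t k =
     (let c = (sstep M \<sigma> ^^ t) (0, [(0, unary k)])
      in if find_instr M c = None then Some (ones (tape_at (snd c) 0)) else None)"

lemma prec_tape_at [prec_intros]:
  assumes "prec f" "prec i"
  shows "prec (\<lambda>x. tape_at (f x) (i x))"
  unfolding tape_at_def by (intro prec_intros prec_comp[OF assms(2)] assms)

lemma prec_find_instr [prec_intros]: "prec M \<Longrightarrow> prec c \<Longrightarrow> prec (\<lambda>x. find_instr (M x) (c x))"
proof -
  assume Mc: "prec M" "prec c"
  have "prec (\<lambda>x. find (\<lambda>I. fst (c x) = fst (snd (flat I)) \<and> (fst (flat I) \<or>
      read_tape (tape_at (snd (c x)) (fst (snd (snd (flat I))))) = fst (snd (snd (snd (flat I)))))) (M x))"
    by (intro prec_intros prec_comp[OF Mc(2)] Mc)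
  moreover have "fst c = fst (snd (flat I)) \<and> (fst (flat I) \<or>
      read_tape (tape_at (snd c) (fst (snd (snd (flat I))))) = fst (snd (snd (snd (flat I))))) \<longleftrightarrow>
      applicable (config_of c) I" for c I
    by (cases I) (auto simp: config_of_def)
  ultimately show ?thesis by (simp add: find_instr_def)
qed

lemma prec_sexec:
  assumes "prec \<sigma>" "prec c" "prec I"
  shows "prec (\<lambda>x. sexec (\<sigma> x) (c x) (I x))"
  unfolding sexec_def split_def Let_def
  by (intro prec_intros prec_comp[OF assms(2)] prec_comp[OF assms(3)] assms)

lemma prec_sim [prec_intros]:
  assumes "prec M" "prec \<sigma>" "prec t" "prec k"
  shows "prec (\<lambda>x. sim (M x) (\<sigma> x) (t x) (k x))"
  unfolding sim_def sstep_def Let_def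
  by (intro prec_intros prec_sexec prec_comp[OF assms(1)] prec_comp[OF assms(2)] assms)

section \<open>Soundness and completeness of the simulation\<close>

lemma tape_at_Cons: "tape_at ((i, t) # ts) = (tape_at ts)(i := t)"
  by (auto simp: tape_at_def)

lemma lookup_seg: "lookup (seg p t) i = (if i < t then Some (p i) else None)"
  by (simp add: lookup_def seg_def)

lemma config_of_sexec:
  assumes "applicable (config_of c) I" "\<And>s s'. I = Query s s' \<Longrightarrow> ones (tape_at (snd c) 1) < L"
  shows "config_of (sexec (seg p L) c I) = exec p (config_of c) I"
  using assms
  by (cases I) (auto simp: sexec_def config_of_def tape_at_Cons lookup_def seg_def split: dir.split)

lemma sexec_cases:
  assumes "applicable (config_of c) I"
  shows "sexec (seg p L) c I = c \<or> config_of (sexec (seg p L) c I) = exec p (config_of c) I"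
proof (cases "\<exists>s s'. I = Query s s' \<and> ones (tape_at (snd c) 1) \<ge> L")
  case True
  then show ?thesis by (auto simp: sexec_def lookup_def)
next
  case False
  then show ?thesis using config_of_sexec[OF assms, of L p] by force
qed

lemma config_of_init: "config_of (0, [(0, unary k)]) = init_config k"
  by (auto simp: config_of_def init_config_def tape_at_def)

lemma find_instr_eq_None: "find_instr M c = None \<longleftrightarrow> step M p (config_of c) = None"
  by (simp add: find_instr_def step_def)

lemma find_instr_SomeD: "find_instr M c = Some I \<Longrightarrow> applicable (config_of c) I"
  by (auto simp: find_instr_def find_Some_iff)

text \<open>Every simulated step either stands still or is a step of the machine with the full
  oracle, whatever \<open>L\<close> and \<open>t\<close> are.\<close>

lemma sim_sound:
  assumes "sim M (seg p L) t k = Some v"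
  shows "halts_with M p k v"
proof -
  have "steps M p (init_config k) (config_of ((sstep M (seg p L) ^^ t) (0, [(0, unary k)])))"
  proof (induction t)
    case 0
    then show ?case by (simp add: config_of_init)
  next
    case (Suc t)
    let ?c = "(sstep M (seg p L) ^^ t) (0, [(0, unary k)])"
    have "sstep M (seg p L) ?c = ?c \<or>
      step M p (config_of ?c) = Some (config_of (sstep M (seg p L) ?c))"
    proof (cases "find_instr M ?c")
      case None
      then show ?thesis by (simp add: sstep_def)
    next
      case (Some I)
      with sexec_cases[OF find_instr_SomeD[OF Some], of p L] show ?thesis
        by (auto simp: sstep_def step_def find_instr_def)
    qed
    with Suc show ?case by (auto intro: rtranclp.rtrancl_into_rtrancl)
  qed
  with assms show ?thesis unfolding halts_with_def
    by (intro exI conjI) (auto simp: sim_def Let_def config_of_def find_instr_eq_None[where p = p]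
        split: if_splits)
qed

lemma sim_complete:
  assumes "halts_with M p k v"
  shows "\<exists>N. \<forall>L\<ge>N. \<forall>t\<ge>N. sim M (seg p L) t k = Some v"
proof -
  from assms obtain d where d: "steps M p (init_config k) d" "step M p d = None" "ones (snd d 0) = v"
    unfolding halts_with_def by blast
  have "\<exists>N. \<forall>L\<ge>N. \<forall>t\<ge>N. config_of ((sstep M (seg p L) ^^ t) c) = d"
    if "steps M p (config_of c) d" for c
    using that
  proof (induction "config_of c" arbitrary: c rule: converse_rtranclp_induct)
    case base
    have "(sstep M (seg p L) ^^ t) c = c" for L t
      by (induction t) (use base d(2) in \<open>simp_all add: sstep_def find_instr_eq_None[where p = p, THEN iffD2]\<close>)
    then show ?case using base by simp
  next
    case (step c')
    define q where "q = Suc (ones (tape_at (snd c) 1))"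
    obtain I where I: "find_instr M c = Some I" "c' = exec p (config_of c) I"
      using step.hyps(1) by (auto simp: step_def find_instr_def)
    have eq: "config_of (sexec (seg p L) c I) = c'" if "L \<ge> q" for L
      using config_of_sexec[OF find_instr_SomeD[OF I(1)], of L p] that I(2) by (simp add: q_def)
    \<comment> \<open>Once the queried position is known, a longer segment changes nothing in this
      step. The induction hypothesis can thus be used for one successor, the same for all
      \<open>L\<close>.\<close>
    have sexec_eq: "sexec (seg p L) c I = sexec (seg p q) c I" if "L \<ge> q" for L
      using that by (cases I) (auto simp: sexec_def lookup_seg q_def)
    from step.hyps(3)[OF eq[OF order_refl, symmetric]] obtain N where
      N: "\<And>L t. L \<ge> N \<Longrightarrow> t \<ge> N \<Longrightarrow> config_of ((sstep M (seg p L) ^^ t) (sexec (seg p q) c I)) = d"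
      by blast
    have "config_of ((sstep M (seg p L) ^^ t) c) = d" if "L \<ge> max q (Suc N)" "t \<ge> max q (Suc N)" for L t
    proof -
      from that obtain t' where t: "t = Suc t'" "t' \<ge> N" by (cases t) auto
      have "sstep M (seg p L) c = sexec (seg p q) c I"
        using that sexec_eq[of L] by (auto simp: sstep_def I(1))
      then show ?thesis using N[of L t'] that t by (simp add: funpow_swap1)
    qed
    then show ?case by blast
  qed
  from this[of "(0, [(0, unary k)])"] obtain N where
    N: "\<And>L t. L \<ge> N \<Longrightarrow> t \<ge> N \<Longrightarrow> config_of ((sstep M (seg p L) ^^ t) (0, [(0, unary k)])) = d"
    using d(1) by (auto simp: config_of_init)
  have "sim M (seg p L) t k = Some v" if "L \<ge> N" "t \<ge> N" for L t
    using N[OF that] d(2,3) by (auto simp: sim_def Let_def find_instr_eq_None[where p = p] config_of_def)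
  then show ?thesis by blast
qed

subsection \<open>Application of machines to finite sequences\<close>

text \<open>A value is appended only if all earlier ones were found, so the list is a gapless
  initial segment of the output. The length of \<open>\<sigma>\<close> bounds the oracle, the
  running time and the number of values at once.\<close>

definition outputs :: "nat \<Rightarrow> nat list \<Rightarrow> nat list" where
  "outputs n \<sigma> = rec_nat [] (\<lambda>k l. if length l = k then
       (case sim (machine n) \<sigma> (length \<sigma>) k of None \<Rightarrow> l | Some v \<Rightarrow> l @ [v]) else l) (length \<sigma>)"

lemma prec_outputs [prec_intros]:
  assumes "prec n" "prec \<sigma>"
  shows "prec (\<lambda>x. outputs (n x) (\<sigma> x))"
  unfolding outputs_def
  by (intro prec_intros prec_comp[OF assms(1)] prec_comp[OF assms(2)] assms)

lemma outputs_seg: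
  assumes r: "machine_map (machine n) p = Some r"
  shows "outputs n (seg p t) = seg r (length (outputs n (seg p t)))"
    and "\<exists>N. \<forall>t\<ge>N. m \<le> length (outputs n (seg p t))"
proof -
  have halts: "halts_with (machine n) p k (r k)" for k
    using r by (simp add: machine_map_eq_Some)
  have sound: "sim (machine n) (seg p t) t k = Some v \<Longrightarrow> v = r k" for t k v
    using halts_with_unique[OF sim_sound halts] by blast
  define out where "out = (\<lambda>t j. rec_nat [] (\<lambda>k l. if length l = k then
       (case sim (machine n) (seg p t) t k of None \<Rightarrow> l | Some v \<Rightarrow> l @ [v]) else l) j)"
  have outputs: "outputs n (seg p t) = out t t" for t
    unfolding outputs_def out_def length_seg ..
  have out_Suc: "out t (Suc j) = (if length (out t j) = j then
       (case sim (machine n) (seg p t) t j of None \<Rightarrow> out t j | Some v \<Rightarrow> out t j @ [v]) else out t j)" for t j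
    unfolding out_def old.nat.rec ..
  have "out t j = seg r (length (out t j))" for t j
  proof (induction j)
    case 0
    then show ?case by (simp add: out_def seg_def)
  next
    case (Suc j)
    show ?case
    proof (cases "length (out t j) = j \<and> sim (machine n) (seg p t) t j \<noteq> None")
      case True
      then obtain v where v: "sim (machine n) (seg p t) t j = Some v" by blast
      with True have "out t (Suc j) = out t j @ [r j]"
        using sound by (simp add: out_Suc)
      also have "\<dots> = seg r (length (out t j)) @ [r j]"
        using Suc by simp
      also have "\<dots> = seg r (Suc j)"
        using True by (simp add: seg_Suc)
      finally show ?thesis by simp
    next
      case False
      then have "out t (Suc j) = out t j" by (auto simp: out_Suc)
      with Suc show ?thesis by simp
    qed
  qed
  then show "outputs n (seg p t) = seg r (length (outputs n (seg p t)))" by (simp add: outputs)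
  have mono: "length (out t j) \<le> length (out t (j + i))" for t j i
    by (induction i) (auto simp: out_Suc split: option.split)
  from halts sim_complete have "\<forall>k. \<exists>N. \<forall>L\<ge>N. \<forall>t\<ge>N. sim (machine n) (seg p L) t k = Some (r k)" by blast
  then obtain N where N: "\<And>k t. t \<ge> N k \<Longrightarrow> sim (machine n) (seg p t) t k = Some (r k)" by metis
  \<comment> \<open>The sum dominates each \<open>N k\<close> with \<open>k < m\<close>, and
    \<open>m\<close> itself is needed because the number of rounds is also \<open>t\<close>.\<close>
  define K where "K = max m (\<Sum>k<m. N k)"
  have "m \<le> length (outputs n (seg p t))" if "t \<ge> K" for t
  proof -
    have "length (out t j) = j" if "j \<le> m" for j
      using that
    proof (induction j)
      case 0
      then show ?case by (simp add: out_def)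
    next
      case (Suc j)
      have "N j \<le> (\<Sum>k<m. N k)"
        using Suc.prems by (intro member_le_sum) auto
      then have "N j \<le> t" using \<open>t \<ge> K\<close> by (simp add: K_def)
      with Suc N show ?case by (simp add: out_Suc)
    qed
    then have "m = length (out t m)" by simp
    also have "\<dots> \<le> length (out t t)"
      using mono[of t m "t - m"] that by (simp add: K_def)
    finally show ?thesis by (simp add: outputs)
  qed
  then show "\<exists>N. \<forall>t\<ge>N. m \<le> length (outputs n (seg p t))" by blast
qed

definition nth0 :: "nat list \<Rightarrow> nat \<Rightarrow> nat" where
  "nth0 l i = (case lookup l i of None \<Rightarrow> 0 | Some v \<Rightarrow> v)"

lemma prec_nth0 [prec_intros]: "prec l \<Longrightarrow> prec i \<Longrightarrow> prec (\<lambda>x. nth0 (l x) (i x))"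
  unfolding nth0_def by (intro prec_intros)

definition pair_list :: "nat list \<Rightarrow> nat list \<Rightarrow> nat list" where
  "pair_list \<sigma> \<tau> = map (\<lambda>i. if even i then nth0 \<sigma> (i div 2) else nth0 \<tau> (i div 2))
     [0..<2 * (if length \<sigma> \<le> length \<tau> then length \<sigma> else length \<tau>)]"

lemma prec_pair_list [prec_intros]:
  assumes "prec \<sigma>" "prec \<tau>"
  shows "prec (\<lambda>x. pair_list (\<sigma> x) (\<tau> x))"
  unfolding pair_list_def
  by (intro prec_intros prec_comp[OF assms(1)] prec_comp[OF assms(2)] assms)

lemma pair_list_seg: "pair_list (seg p s) (seg q t) = seg (pair_seq p q) (2 * min s t)"
  unfolding seg_def[of "pair_seq p q"]
  by (auto simp: pair_list_def nth0_def lookup_seg pair_seq_def min_def)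

text \<open>\<open>e\<close> is what remains of a name \<open>0\<^sup>n1p\<close> when only a finite
  part of \<open>p\<close> is known.\<close>

definition app :: "nat \<times> nat list \<Rightarrow> nat list \<Rightarrow> nat list" where
  "app e \<sigma> = outputs (fst e) (pair_list (snd e) \<sigma>)"

lemma prec_app [prec_intros]: "prec e \<Longrightarrow> prec \<sigma> \<Longrightarrow> prec (\<lambda>x. app (e x) (\<sigma> x))"
  unfolding app_def by (intro prec_intros)

lemma app_seg:
  assumes "machine_map (machine n) (pair_seq p q) = Some r"
  shows "app (n, seg p s) (seg q t) = seg r (length (app (n, seg p s) (seg q t)))"
    and "\<exists>N. \<forall>s\<ge>N. \<forall>t\<ge>N. m \<le> length (app (n, seg p s) (seg q t))"
proof -
  show "app (n, seg p s) (seg q t) = seg r (length (app (n, seg p s) (seg q t)))"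
    using outputs_seg(1)[OF assms] by (simp add: app_def pair_list_seg)
  from outputs_seg(2)[OF assms] obtain N where
    "\<And>t. t \<ge> N \<Longrightarrow> m \<le> length (outputs n (seg (pair_seq p q) t))" by blast
  then show "\<exists>N. \<forall>s\<ge>N. \<forall>t\<ge>N. m \<le> length (app (n, seg p s) (seg q t))"
    by (intro exI[of _ N]) (auto simp: app_def pair_list_seg)
qed


section \<open>Well-founded labelled trees as Borel codes\<close>

text \<open>The sets of nodes used below are not all closed under prefixes. Eventual membership is
  what a failure of bar induction at an arbitrary node yields, and for genuine trees it amounts to
  ill-foundedness.\<close>

definition branch :: "nat list set \<Rightarrow> bool" where
  "branch S \<longleftrightarrow> (\<exists>f N. \<forall>n\<ge>N. map f [0..<n] \<in> S)"

lemma bar_induct [consumes 1, case_names base step]: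
  assumes "\<not> branch S" "\<And>s. s \<notin> S \<Longrightarrow> P s" "\<And>s. s \<in> S \<Longrightarrow> (\<And>i. P (s @ [i])) \<Longrightarrow> P s"
  shows "P s"
proof (rule ccontr)
  assume nP: "\<not> P s"
  define F where "F = rec_nat s (\<lambda>_ u. u @ [SOME i. \<not> P (u @ [i])])"
  have F: "F 0 = s" "F (Suc n) = F n @ [SOME i. \<not> P (F n @ [i])]" for n
    by (simp_all add: F_def)
  have nPF: "\<not> P (F n)" for n
  proof (induction n)
    case 0
    then show ?case using nP F by simp
  next
    case (Suc n)
    then have "\<exists>i. \<not> P (F n @ [i])" using assms(2,3) by blast
    then show ?case unfolding F by (rule someI_ex)
  qed
  then have FS: "F n \<in> S" for n using assms(2) by blast
  have len: "length (F n) = length s + n" for n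
    by (induction n) (simp_all add: F)
  have ext: "i < length (F n) \<Longrightarrow> F (n + m) ! i = F n ! i" for n m i
    by (induction m) (simp_all add: F nth_append len)
  have nth_eq: "F n ! i = F m ! i" if "i < length (F n)" "i < length (F m)" for n m i
    using ext[OF that(1), of "m - n"] ext[OF that(2), of "n - m"] by (cases "n \<le> m") simp_all
  \<comment> \<open>\<open>F (Suc i)\<close> is longer than \<open>i\<close> even if
    \<open>s\<close> is empty, and later stages keep its entry at \<open>i\<close>.\<close>
  have "map (\<lambda>i. F (Suc i) ! i) [0..<n] = F (n - length s)" if "n \<ge> length s" for n
  proof (rule nth_equalityI)
    fix i assume "i < length (map (\<lambda>i. F (Suc i) ! i) [0..<n])"
    then show "map (\<lambda>i. F (Suc i) ! i) [0..<n] ! i = F (n - length s) ! i"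
      using that by (simp add: nth_eq[of i "Suc i" "n - length s"] len)
  qed (use that in \<open>simp add: len\<close>)
  with FS have "branch S" unfolding branch_def
    by (intro exI[of _ "\<lambda>i. F (Suc i) ! i"] exI[of _ "length s"]) simp
  with assms(1) show False ..
qed

text \<open>Under \<open>list_decode\<close> a Borel code is a labelling of the nodes of \<open>nat list\<close>, with \<open>0\<close> at the
  leaves.\<close>

definition bcode :: "(nat list \<Rightarrow> bool) \<Rightarrow> baire" where
  "bcode leaf = (\<lambda>k. if leaf (list_decode k) then 0 else 1)"

text \<open>\<open>list_decode\<close> splits \<open>Suc n\<close> by \<open>prod_decode\<close>
  into a head and the code of the tail, which is exactly the indexing of
  \<open>tuple_seq\<close>.\<close>

lemma bcode_node:
  assumes "\<not> leaf []"
  shows "bcode leaf = cons_seq 1 (tuple_seq (\<lambda>i. bcode (\<lambda>s. leaf (i # s))))"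
proof
  fix k
  show "bcode leaf k = cons_seq 1 (tuple_seq (\<lambda>i. bcode (\<lambda>s. leaf (i # s)))) k"
    using assms by (cases k) (simp_all add: bcode_def cons_seq_def tuple_seq_def split: prod.split)
qed

lemma borel_value_node:
  assumes "\<not> leaf []" "\<And>i. borel_value (bcode (\<lambda>s. leaf (i # s))) (bs i)"
  shows "borel_value (bcode leaf) (\<exists>i. \<not> bs i)"
  unfolding bcode_node[of leaf, OF assms(1)] using assms(2) by (rule borel_value.one)

text \<open>Nothing is required of labels below a leaf. Since no path avoids leaves from some point
  on, every node, even one below a leaf, is the root of a Borel code.\<close>

locale bar_leaves =
  fixes leaf :: "nat list \<Rightarrow> bool"
  assumes bar: "\<not> branch {s. \<not> leaf s}"
begin

definition value_at :: "nat list \<Rightarrow> bool" where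
  "value_at s \<longleftrightarrow> borel_value (bcode (\<lambda>t. leaf (s @ t))) True"

lemma borel_value_value_at: "borel_value (bcode (\<lambda>t. leaf (s @ t))) (value_at s)"
proof -
  from bar have "\<exists>b. borel_value (bcode (\<lambda>t. leaf (s @ t))) b"
  proof (induction s rule: bar_induct)
    case (base s)
    then show ?case
      by (intro exI[of _ True] borel_value.zero) (simp add: bcode_def)
  next
    case (step s)
    then obtain bs where "borel_value (bcode (\<lambda>t. leaf ((s @ [i]) @ t))) (bs i)" for i by metis
    then have "borel_value (bcode (\<lambda>t. leaf (s @ t))) (\<exists>i. \<not> bs i)"
      using step(1) by (intro borel_value_node) simp_all
    then show ?case ..
  qed
  then show ?thesis unfolding value_at_def by (metis (full_types))
qed

lemma value_at_iff: "value_at s \<longleftrightarrow> leaf s \<or> (\<exists>i. \<not> value_at (s @ [i]))"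
proof (cases "leaf s")
  case True
  then show ?thesis unfolding value_at_def by (auto intro!: borel_value.zero simp: bcode_def)
next
  case False
  have "borel_value (bcode (\<lambda>t. leaf (s @ t))) (\<exists>i. \<not> value_at (s @ [i]))"
    using False borel_value_value_at[of "s @ [_]"]
    by (intro borel_value_node) simp_all
  then show ?thesis using False borel_value_unique borel_value_value_at by blast
qed

end

text \<open>A join in a Borel code negates its members. The dummy index \<open>j\<close> inserts a
  second negation with all children equal, so that the members themselves are joined.\<close>

definition union_leaf :: "(nat \<Rightarrow> nat list \<Rightarrow> bool) \<Rightarrow> nat list \<Rightarrow> bool" where
  "union_leaf leaf w = (case w of n # j # s \<Rightarrow> leaf n s | _ \<Rightarrow> False)"

lemma borel_value_union_leaf:
  assumes "\<And>n. borel_value (bcode (leaf n)) (b n)"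
  shows "borel_value (bcode (union_leaf leaf)) (\<exists>n. b n)"
proof -
  have "borel_value (bcode (\<lambda>w. union_leaf leaf (n # w))) (\<exists>j :: nat. \<not> b n)" for n
    using borel_value_node[of "\<lambda>w. union_leaf leaf (n # w)" "\<lambda>_. b n"] assms
    by (simp add: union_leaf_def)
  then have "borel_value (bcode (union_leaf leaf)) (\<exists>n. \<not> (\<exists>j :: nat. \<not> b n))"
    by (rule borel_value_node[rotated]) (simp add: union_leaf_def)
  then show ?thesis by simp
qed

section \<open>Separation of two trees\<close>

definition evens :: "nat list \<Rightarrow> nat list" where
  "evens s = map (\<lambda>i. nth0 s (2 * i)) [0..<length s div 2]"

definition odds :: "nat list \<Rightarrow> nat list" where
  "odds s = map (\<lambda>i. nth0 s (Suc (2 * i))) [0..<length s div 2]"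

lemma prec_evens [prec_intros]: "prec s \<Longrightarrow> prec (\<lambda>x. evens (s x))"
proof -
  assume s: "prec s"
  show ?thesis unfolding evens_def by (intro prec_intros prec_comp[OF s] s)
qed

lemma prec_odds [prec_intros]: "prec s \<Longrightarrow> prec (\<lambda>x. odds (s x))"
proof -
  assume s: "prec s"
  show ?thesis unfolding odds_def by (intro prec_intros prec_comp[OF s] s)
qed

lemma nth0_nth: "i < length s \<Longrightarrow> nth0 s i = s ! i"
  by (simp add: nth0_def lookup_def)

lemma nth0_append: "i < length s \<Longrightarrow> nth0 (s @ t) i = nth0 s i"
  by (simp add: nth0_nth nth_append)

lemma evens_snoc: "even (length s) \<Longrightarrow> evens (s @ [x]) = evens s"
  and odds_snoc: "even (length s) \<Longrightarrow> odds (s @ [x]) = odds s"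
  by (auto simp: evens_def odds_def intro!: nth0_append)

text \<open>The code of the set \<open>C\<close> of all positions \<open>(u, v)\<close> with \<open>C (u, v) \<longleftrightarrow> (\<exists>i. \<forall>j. C (u i, v j))\<close> for
  \<open>u \<in> A\<close> and \<open>v \<in> B\<close>; outside, \<open>C (u, v)\<close> is false if \<open>u \<notin> A\<close> and true if \<open>u \<in> A\<close>, \<open>v \<notin> B\<close>. The
  entries of \<open>u\<close> and \<open>v\<close> alternate in \<open>s\<close>.\<close>

definition sep :: "nat list set \<Rightarrow> nat list set \<Rightarrow> nat list \<Rightarrow> bool" where
  "sep A B s \<longleftrightarrow> (if even (length s) then evens s \<in> A \<and> odds s \<notin> B
     else \<not> (evens s \<in> A \<and> odds s \<in> B))"

text \<open>At nodes of odd length, not being a leaf means that both coordinates are still in their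
  sets, so a path without late leaves gives branches of \<open>A\<close> and of
  \<open>B\<close>.\<close>

lemma bar_leaves_sep:
  assumes "\<not> (branch A \<and> branch B)"
  shows "bar_leaves (sep A B)"
proof
  show "\<not> branch {s. \<not> sep A B s}"
  proof
    assume "branch {s. \<not> sep A B s}"
    then obtain f N where f: "\<And>n. n \<ge> N \<Longrightarrow> \<not> sep A B (map f [0..<n])"
      unfolding branch_def by blast
    have "map (\<lambda>i. f (2 * i)) [0..<n] \<in> A \<and> map (\<lambda>i. f (Suc (2 * i))) [0..<n] \<in> B" if "n \<ge> N" for n
    proof -
      have "evens (map f [0..<Suc (2 * n)]) = map (\<lambda>i. f (2 * i)) [0..<n]"
        "odds (map f [0..<Suc (2 * n)]) = map (\<lambda>i. f (Suc (2 * i))) [0..<n]"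
        by (auto simp: evens_def odds_def nth0_nth nth_append simp del: upt_Suc)
      then show ?thesis
        using f[of "Suc (2 * n)"] that by (auto simp: sep_def simp del: upt_Suc)
    qed
    then have "branch A" "branch B" unfolding branch_def by blast+
    with assms show False by blast
  qed
qed

text \<open>The branch \<open>f\<close> of \<open>A\<close> supplies the witness \<open>i\<close> at
  each even node, against every choice of \<open>j\<close>. Odd leaves have value true, so the claim
  for odd nodes must exclude them; the chosen child is no leaf, as otherwise its parent would be
  one.\<close>

lemma ill_founded_left_value_at:
  assumes "bar_leaves (sep A B)" "ill_founded A"
  shows "bar_leaves.value_at (sep A B) []"
proof -
  interpret bar_leaves "sep A B" by fact
  from assms(2) obtain f where f: "\<And>n. map f [0..<n] \<in> A" unfolding ill_founded_def by blast
  let ?path = "\<lambda>s. \<forall>i. 2 * i < length s \<longrightarrow> s ! (2 * i) = f i"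
  have evens: "evens s \<in> A" if "?path s" for s
  proof -
    have "evens s = map f [0..<length s div 2]"
      using that by (auto simp: evens_def nth0_nth)
    then show ?thesis using f by simp
  qed
  from bar have "?path s \<longrightarrow> (even (length s) \<longrightarrow> value_at s) \<and> (odd (length s) \<and> \<not> sep A B s \<longrightarrow> \<not> value_at s)" for s
  proof (induction s rule: bar_induct)
    case (base s)
    then show ?case using value_at_iff[of s] by auto
  next
    case (step s)
    show ?case
    proof (intro impI conjI)
      assume path: "?path s" and ev: "even (length s)"
      let ?s = "s @ [f (length s div 2)]"
      have "?path ?s" using path ev by (auto simp: nth_append less_Suc_eq)
      moreover have "\<not> sep A B ?s"
        using step(1) evens[OF path] ev by (simp add: sep_def evens_snoc odds_snoc)
      ultimately have "\<not> value_at ?s" using step(2)[of "f (length s div 2)"] ev by simp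
      then show "value_at s" using value_at_iff[of s] by blast
    next
      assume path: "?path s" and odd: "odd (length s) \<and> \<not> sep A B s"
      have "value_at (s @ [j])" for j
      proof -
        have "2 * i \<noteq> length s" for i using odd[THEN conjunct1] by presburger
        then have "?path (s @ [j])"
          using path by (simp add: nth_append less_Suc_eq)
        then show ?thesis using step(2)[of j] odd by simp
      qed
      then show "\<not> value_at s" using value_at_iff[of s] odd by blast
    qed
  qed
  from this[of "[]"] show ?thesis by simp
qed

text \<open>Dually, the branch of \<open>B\<close> refutes every \<open>i\<close> at an even node.
  No exception is made for odd leaves here, since their value true is the claimed one; an even node
  on this path cannot be a leaf because its odd entries lie in \<open>B\<close>.\<close>

lemma ill_founded_right_value_at:
  assumes "bar_leaves (sep A B)" "ill_founded B"
  shows "\<not> bar_leaves.value_at (sep A B) []"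
proof -
  interpret bar_leaves "sep A B" by fact
  from assms(2) obtain f where f: "\<And>n. map f [0..<n] \<in> B" unfolding ill_founded_def by blast
  let ?path = "\<lambda>s. \<forall>i. Suc (2 * i) < length s \<longrightarrow> s ! Suc (2 * i) = f i"
  have odds: "odds s \<in> B" if "?path s" for s
  proof -
    have "odds s = map f [0..<length s div 2]"
      using that by (auto simp: odds_def nth0_nth)
    then show ?thesis using f by simp
  qed
  from bar have "?path s \<longrightarrow> (even (length s) \<longrightarrow> \<not> value_at s) \<and> (odd (length s) \<longrightarrow> value_at s)" for s
  proof (induction s rule: bar_induct)
    case (base s)
    then show ?case using value_at_iff[of s] odds[of s] sep_def[of A B s] by auto
  next
    case (step s)
    show ?case
    proof (intro impI conjI)
      assume path: "?path s" and ev: "even (length s)"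
      have "value_at (s @ [j])" for j
      proof -
        have "Suc (2 * i) \<noteq> length s" for i using ev by presburger
        then have "?path (s @ [j])"
          using path by (simp add: nth_append less_Suc_eq)
        then show ?thesis using step(2)[of j] ev by simp
      qed
      then show "\<not> value_at s" using value_at_iff[of s] step(1) by blast
    next
      assume path: "?path s" and odd: "odd (length s)"
      let ?s = "s @ [f (length s div 2)]"
      have "i = length s div 2" if "Suc (2 * i) = length s" for i using that by presburger
      then have "?path ?s" using path by (auto simp: nth_append less_Suc_eq)
      then have "\<not> value_at ?s" using step(2)[of "f (length s div 2)"] odd by simp
      then show "value_at s" using value_at_iff[of s] by blast
    qed
  qed
  from this[of "[]"] show ?thesis by simp
qed

section \<open>Certificates for the value of a Borel code\<close>

definition snoc_code :: "nat \<Rightarrow> nat \<Rightarrow> nat" where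
  "snoc_code c i = list_encode (list_decode c @ [i])"

lemma prec_snoc_code [prec_intros]: "prec c \<Longrightarrow> prec i \<Longrightarrow> prec (\<lambda>x. snoc_code (c x) (i x))"
  unfolding snoc_code_def by (intro prec_intros)

text \<open>The value \<open>0\<close> of a certificate at a node claims that the node is false, \<open>Suc i\<close> claims that it is
  true because its \<open>i\<close>-th child is false.\<close>

definition cert :: "(nat list \<Rightarrow> bool) \<Rightarrow> baire \<Rightarrow> bool" where
  "cert leaf g \<longleftrightarrow> g 0 \<noteq> 0 \<and> (\<forall>c. if leaf (list_decode c) then g c \<noteq> 0 else
     (case g c of 0 \<Rightarrow> \<forall>i. g (snoc_code c i) \<noteq> 0 | Suc i \<Rightarrow> g (snoc_code c i) = 0))"

text \<open>By bar induction a certificate is nonzero exactly at the true nodes, so it cannot lie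
  anywhere. Conversely the truth values, with chosen false children as witnesses, form a
  certificate.\<close>

lemma (in bar_leaves) ex_cert_iff: "(\<exists>g. cert leaf g) \<longleftrightarrow> value_at []"
proof
  assume "\<exists>g. cert leaf g"
  then obtain g where g: "g 0 \<noteq> 0" and
    gc: "\<And>c. if leaf (list_decode c) then g c \<noteq> 0 else
     (case g c of 0 \<Rightarrow> \<forall>i. g (snoc_code c i) \<noteq> 0 | Suc i \<Rightarrow> g (snoc_code c i) = 0)"
    unfolding cert_def by blast
  from bar have "g (list_encode s) \<noteq> 0 \<longleftrightarrow> value_at s" for s
  proof (induction s rule: bar_induct)
    case (base s)
    then show ?case using gc[of "list_encode s"] value_at_iff[of s] by auto
  next
    case (step s)
    show ?case
    proof (cases "g (list_encode s)")
      case 0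
      then show ?thesis using gc[of "list_encode s"] value_at_iff[of s] step
        by (simp add: snoc_code_def)
    next
      case (Suc i)
      then show ?thesis using gc[of "list_encode s"] value_at_iff[of s] step(1) step(2)[of i]
        by (auto simp: snoc_code_def)
    qed
  qed
  from this[of "[]"] g show "value_at []" by simp
next
  assume v: "value_at []"
  \<comment> \<open>A true node without a false child is a leaf, where any nonzero entry will
    do.\<close>
  define g where "g = (\<lambda>c. let s = list_decode c in if value_at s then
    (if \<exists>i. \<not> value_at (s @ [i]) then Suc (SOME i. \<not> value_at (s @ [i])) else 1) else 0)"
  have g0: "g c \<noteq> 0 \<longleftrightarrow> value_at (list_decode c)" for c
    by (simp add: g_def Let_def)
  have gS: "\<not> value_at (list_decode c @ [i])" if "g c = Suc i" "\<not> leaf (list_decode c)" for c i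
  proof -
    have "value_at (list_decode c)" using that(1) g0[of c] by simp
    then have ex: "\<exists>i. \<not> value_at (list_decode c @ [i])"
      using that(2) value_at_iff by blast
    then have "i = (SOME i. \<not> value_at (list_decode c @ [i]))"
      using that(1) \<open>value_at (list_decode c)\<close> by (simp add: g_def Let_def)
    then show ?thesis using someI_ex[OF ex] by simp
  qed
  have "if leaf (list_decode c) then g c \<noteq> 0 else
     (case g c of 0 \<Rightarrow> \<forall>i. g (snoc_code c i) \<noteq> 0 | Suc i \<Rightarrow> g (snoc_code c i) = 0)" for c
  proof (cases "leaf (list_decode c)")
    case True
    then show ?thesis using g0[of c] value_at_iff[of "list_decode c"] by simp
  next
    case False
    have "g (snoc_code c i) \<noteq> 0 \<longleftrightarrow> value_at (list_decode c @ [i])" for i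
      using g0[of "snoc_code c i"] by (simp add: snoc_code_def)
    then show ?thesis using False gS[of c] g0[of c] value_at_iff[of "list_decode c"]
      by (auto split: nat.split)
  qed
  then have "cert leaf g" using g0[of 0] v by (simp add: cert_def)
  then show "\<exists>g. cert leaf g" by blast
qed

text \<open>The finite shadow of \<open>cert\<close>: only violations visible in \<open>G\<close>
  count. Unknown labels and unknown entries pass, so the segments of a certificate are never
  rejected.\<close>

definition okay :: "nat list \<Rightarrow> (nat \<Rightarrow> bool option) \<Rightarrow> bool" where
  "okay G leaf \<longleftrightarrow> lookup G 0 \<noteq> Some 0 \<and> (\<forall>c<length G. case leaf c of None \<Rightarrow> True
     | Some b \<Rightarrow> if b then nth0 G c \<noteq> 0 else
       (case nth0 G c of 0 \<Rightarrow> \<forall>i<length G. lookup G (snoc_code c i) \<noteq> Some 0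
        | Suc i \<Rightarrow> (case lookup G (snoc_code c i) of None \<Rightarrow> True | Some y \<Rightarrow> y = 0)))"

lemma prec_okay [prec_intros]:
  assumes "prec G" "prec (\<lambda>z. leaf (fst z) (snd z))"
  shows "prec (\<lambda>x. okay (G x) (leaf x))"
  unfolding okay_def by (intro prec_intros prec_comp[OF assms(1)] assms)

lemma okay_cong:
  assumes "\<And>c. c < length G \<Longrightarrow> leaf c = leaf' c"
  shows "okay G leaf = okay G leaf'"
  using assms by (simp add: okay_def)

lemma nth0_seg: "i < t \<Longrightarrow> nth0 (seg p t) i = p i"
  by (simp add: nth0_def lookup_seg)

lemma cert_okay:
  assumes "cert leaf g" "\<And>c b. lf c = Some b \<Longrightarrow> b = leaf (list_decode c)"
  shows "okay (seg g n) lf"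
  unfolding okay_def
proof (intro conjI allI impI)
  show "lookup (seg g n) 0 \<noteq> Some 0" using assms(1) by (simp add: lookup_seg cert_def)
  fix c assume "c < length (seg g n)"
  then show "case lf c of None \<Rightarrow> True
     | Some b \<Rightarrow> if b then nth0 (seg g n) c \<noteq> 0 else
       (case nth0 (seg g n) c of 0 \<Rightarrow> \<forall>i<length (seg g n). lookup (seg g n) (snoc_code c i) \<noteq> Some 0
        | Suc i \<Rightarrow> (case lookup (seg g n) (snoc_code c i) of None \<Rightarrow> True | Some y \<Rightarrow> y = 0))"
    using assms(1)[unfolded cert_def, THEN conjunct2, rule_format, of c] assms(2)[of c]
    by (auto simp: nth0_seg lookup_seg split: option.split nat.split)
qed

text \<open>Each instance of a clause of \<open>cert\<close> concerns one label and at most two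
  entries, so it is tested by some finite segment. The labels may vary with \<open>n\<close> as long
  as each of them settles.\<close>

lemma okay_cert:
  assumes "\<And>n. n \<ge> N \<Longrightarrow> okay (seg g n) (lf n)"
    and "\<And>c. \<exists>M. \<forall>n\<ge>M. lf n c = Some (leaf (list_decode c))"
  shows "cert leaf g"
  unfolding cert_def
proof (intro conjI allI)
  show "g 0 \<noteq> 0"
    using assms(1)[of "Suc N"] by (auto simp: okay_def lookup_seg)
  fix c
  from assms(2) obtain M where M: "\<And>n. n \<ge> M \<Longrightarrow> lf n c = Some (leaf (list_decode c))" by blast
  have ok: "if leaf (list_decode c) then g c \<noteq> 0 else
       (case g c of 0 \<Rightarrow> \<forall>i<n. lookup (seg g n) (snoc_code c i) \<noteq> Some 0
        | Suc i \<Rightarrow> (case lookup (seg g n) (snoc_code c i) of None \<Rightarrow> True | Some y \<Rightarrow> y = 0))"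
    if "n > N + M + c" for n
  proof -
    have "nth0 (seg g n) c = g c" using that by (intro nth0_seg) simp
    then show ?thesis
      using assms(1)[of n, unfolded okay_def length_seg, THEN conjunct2, rule_format, of c] M[of n] that
      by (auto split: if_splits)
  qed
  show "if leaf (list_decode c) then g c \<noteq> 0 else
     (case g c of 0 \<Rightarrow> \<forall>i. g (snoc_code c i) \<noteq> 0 | Suc i \<Rightarrow> g (snoc_code c i) = 0)"
  proof (cases "leaf (list_decode c)")
    case True
    then show ?thesis using ok[of "Suc (N + M + c)"] by simp
  next
    case False
    show ?thesis
    proof (cases "g c")
      case 0
      have "g (snoc_code c i) \<noteq> 0" for i
      proof -
        let ?n = "Suc (N + M + c + i + snoc_code c i)"
        have "lookup (seg g ?n) (snoc_code c i) \<noteq> Some 0"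
          using ok[of ?n] False 0 by simp
        then show ?thesis by (simp add: lookup_seg)
      qed
      then show ?thesis using False 0 by simp
    next
      case (Suc i)
      then show ?thesis using ok[of "Suc (N + M + c + snoc_code c i)"] False
        by (simp add: lookup_seg)
    qed
  qed
qed

section \<open>The invariant separation\<close>

definition member :: "nat list \<Rightarrow> nat list \<Rightarrow> bool option" where
  "member l u = (case lookup l (list_encode u) of None \<Rightarrow> None | Some x \<Rightarrow> Some (x = 1))"

lemma prec_member [prec_intros]: "prec l \<Longrightarrow> prec u \<Longrightarrow> prec (\<lambda>x. member (l x) (u x))"
  unfolding member_def by (intro prec_intros)

lemma member_app:
  assumes "machine_map (machine n) (pair_seq p q) = Some w"
  shows "member (app (n, seg p s) (seg q t)) u = Some b \<Longrightarrow> b \<longleftrightarrow> w (list_encode u) = 1"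
    and "\<exists>N. \<forall>s\<ge>N. \<forall>t\<ge>N. member (app (n, seg p s) (seg q t)) u = Some (w (list_encode u) = 1)"
proof -
  have *: "member (seg w m) u = (if list_encode u < m then Some (w (list_encode u) = 1) else None)" for m
    by (simp add: member_def lookup_seg)
  show "member (app (n, seg p s) (seg q t)) u = Some b \<Longrightarrow> b \<longleftrightarrow> w (list_encode u) = 1"
    by (subst (asm) app_seg(1)[OF assms]) (auto simp: * split: if_splits)
  from app_seg(2)[OF assms] obtain N where
    N: "\<And>s t. s \<ge> N \<Longrightarrow> t \<ge> N \<Longrightarrow> Suc (list_encode u) \<le> length (app (n, seg p s) (seg q t))" by blast
  have "member (app (n, seg p s) (seg q t)) u = Some (w (list_encode u) = 1)" if "s \<ge> N" "t \<ge> N" for s t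
    by (subst app_seg(1)[OF assms]) (use N[OF that] in \<open>simp add: *\<close>)
  then show "\<exists>N. \<forall>s\<ge>N. \<forall>t\<ge>N. member (app (n, seg p s) (seg q t)) u = Some (w (list_encode u) = 1)"
    by blast
qed

definition sep_opt :: "nat list \<Rightarrow> bool option \<Rightarrow> bool option \<Rightarrow> bool option" where
  "sep_opt s a b = (case a of None \<Rightarrow> None | Some x \<Rightarrow> (case b of None \<Rightarrow> None | Some y \<Rightarrow>
     Some (if even (length s) then x \<and> \<not> y else \<not> (x \<and> y))))"

lemma prec_sep_opt [prec_intros]:
  assumes "prec s" "prec a" "prec b"
  shows "prec (\<lambda>x. sep_opt (s x) (a x) (b x))"
  unfolding sep_opt_def by (intro prec_intros prec_comp[OF assms(1)] prec_comp[OF assms(3)] assms)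

type_synonym env = "(nat \<times> nat list) \<times> (nat \<times> nat list)"

text \<open>Truncating all data to the length of the node makes membership in the trees of positive
  level independent of how much more of the oracles is known, so that these trees are well-defined
  sets.\<close>

definition cut :: "nat \<Rightarrow> env \<Rightarrow> env" where
  "cut n e = ((fst (fst e), take n (snd (fst e))), (fst (snd e), take n (snd (snd e))))"

lemma prec_cut [prec_intros]: "prec n \<Longrightarrow> prec e \<Longrightarrow> prec (\<lambda>x. cut (n x) (e x))"
  unfolding cut_def by (intro prec_intros)

text \<open>The nodes of the trees of level \<open>k + 1\<close> consist of pairs \<open>\<langle>q i, g i\<rangle>\<close>, where \<open>g\<close> is meant to be a
  certificate for the Borel code of level \<open>k\<close> at the name which the trace \<open>n\<close> assigns to \<open>q\<close>. A node
  \<open>u\<close> belongs to the tree unless a violation can be seen from the first \<open>length u\<close> entries of all data.\<close>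

definition traced :: "nat \<Rightarrow> env \<times> nat list \<times> nat list \<Rightarrow> nat list" where
  "traced n x = app (n, take (length (snd (snd x))) (fst (snd x)))
     (map (\<lambda>z. fst (prod_decode z)) (snd (snd x)))"

definition level_base :: "env \<times> nat list \<times> nat list \<Rightarrow> bool option" where
  "level_base x = member (app (fst (fst x)) (fst (snd x))) (snd (snd x))"

text \<open>One call for each position \<open>c\<close> of the certificate that \<open>okay\<close>
  inspects; the previous level is asked at the traced name about the left coordinate of the node
  \<open>c\<close>.\<close>

definition level_args :: "nat \<Rightarrow> env \<times> nat list \<times> nat list \<Rightarrow> (env \<times> nat list \<times> nat list) list" where
  "level_args n x = map (\<lambda>c. (cut (length (snd (snd x))) (fst x), traced n x, evens (list_decode c)))
     [0..<length (snd (snd x))]"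

text \<open>The answer is withheld until every segment reaches the length of the node. From then on
  it is final, even if \<open>okay\<close> was lenient because labels were unknown.\<close>

definition level_step :: "nat \<Rightarrow> env \<times> nat list \<times> nat list \<Rightarrow> bool option list \<Rightarrow> bool option" where
  "level_step n x rs =
     (let l = length (snd (snd x)); e = fst x
      in if l \<le> length (snd (fst e)) \<and> l \<le> length (snd (snd e)) \<and> l \<le> length (fst (snd x)) then
        Some (okay (map (\<lambda>z. snd (prod_decode z)) (snd (snd x)))
          (\<lambda>c. case lookup rs c of None \<Rightarrow> None | Some a \<Rightarrow> sep_opt (list_decode c) a
             (member (app (snd (cut l e)) (traced n x)) (odds (list_decode c)))))
      else None)"

definition level :: "nat \<Rightarrow> nat \<Rightarrow> env \<times> nat list \<times> nat list \<Rightarrow> bool option" where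
  "level n = tree_rec level_base (level_args n) (level_step n)"

definition label :: "nat \<Rightarrow> nat \<Rightarrow> env \<Rightarrow> nat list \<Rightarrow> nat list \<Rightarrow> bool option" where
  "label n k e \<sigma> s = sep_opt s (level n k (e, \<sigma>, evens s)) (member (app (snd e) \<sigma>) (odds s))"

lemma prec_traced: "prec x \<Longrightarrow> prec (\<lambda>z. traced n (x z))"
  unfolding traced_def by (intro prec_intros)

lemma prec_level_args: "prec (level_args n)"
  unfolding level_args_def by (intro prec_intros prec_traced)

lemma prec_level_step: "prec (\<lambda>z. level_step n (fst z) (snd z))"
  unfolding level_step_def Let_def by (intro prec_intros prec_traced)

lemma prec_level_base: "prec level_base"
  unfolding level_base_def by (intro prec_intros)

lemma prec_level [prec_intros]: "prec k \<Longrightarrow> prec x \<Longrightarrow> prec (\<lambda>z. level n (k z) (x z))"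
  unfolding level_def by (intro prec_tree_rec prec_level_base prec_level_args prec_level_step)

lemma prec_label [prec_intros]:
  "prec k \<Longrightarrow> prec e \<Longrightarrow> prec \<sigma> \<Longrightarrow> prec s \<Longrightarrow> prec (\<lambda>x. label n (k x) (e x) (\<sigma> x) (s x))"
  unfolding label_def by (intro prec_intros)

lemma level_Suc:
  "level n (Suc k) (e, \<sigma>, u) =
     (if length u \<le> length (snd (fst e)) \<and> length u \<le> length (snd (snd e)) \<and> length u \<le> length \<sigma> then
        Some (okay (map (\<lambda>z. snd (prod_decode z)) u)
          (\<lambda>c. label n k (cut (length u) e) (traced n (e, \<sigma>, u)) (list_decode c)))
      else None)"
proof -
  have "okay (map (\<lambda>z. snd (prod_decode z)) u)
      (\<lambda>c. case lookup (map (level n k) (level_args n (e, \<sigma>, u))) c of None \<Rightarrow> None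
         | Some a \<Rightarrow> sep_opt (list_decode c) a
             (member (app (snd (cut (length u) e)) (traced n (e, \<sigma>, u))) (odds (list_decode c)))) =
    okay (map (\<lambda>z. snd (prod_decode z)) u)
      (\<lambda>c. label n k (cut (length u) e) (traced n (e, \<sigma>, u)) (list_decode c))"
    by (rule okay_cong) (simp add: lookup_def level_args_def label_def)
  then show ?thesis by (simp add: level_def level_step_def Let_def)
qed

lemma map_seg: "map h (seg p t) = seg (\<lambda>i. h (p i)) t"
  by (simp add: seg_def)

lemma take_seg: "n \<le> t \<Longrightarrow> take n (seg p t) = seg p n"
  by (simp add: seg_def take_map)

text \<open>The construction lives on names: \<open>D\<close> is the set of names, and points occur
  only through the assumption that ill-foundedness on the side of \<open>B\<close> passes from a
  name to every name traced from it.\<close>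

locale lusin =
  fixes nA nB nT :: nat and pA pB :: baire and D :: "baire set"
    and T :: "baire \<Rightarrow> baire \<Rightarrow> baire" and wA wB :: "baire \<Rightarrow> baire"
  assumes wA: "r \<in> D \<Longrightarrow> machine_map (machine nA) (pair_seq pA r) = Some (wA r)"
    and wB: "r \<in> D \<Longrightarrow> machine_map (machine nB) (pair_seq pB r) = Some (wB r)"
    and T: "r \<in> D \<Longrightarrow> machine_map (machine nT) (pair_seq r q) = Some (T r q)"
    and T_D: "r \<in> D \<Longrightarrow> T r q \<in> D"
    and branch_A: "r \<in> D \<Longrightarrow> branch {u. wA r (list_encode u) = 1} \<Longrightarrow> ill_founded {u. wA r (list_encode u) = 1}"
    and branch_B: "r \<in> D \<Longrightarrow> branch {u. wB r (list_encode u) = 1} \<Longrightarrow> ill_founded {u. wB r (list_encode u) = 1}"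
    and invariant_B: "r \<in> D \<Longrightarrow> ill_founded {u. wB r (list_encode u) = 1} \<Longrightarrow>
      ill_founded {u. wB (T r q) (list_encode u) = 1}"
    and disjoint: "r \<in> D \<Longrightarrow> ill_founded {u. wA r (list_encode u) = 1} \<Longrightarrow>
      \<not> ill_founded {u. wB r (list_encode u) = 1}"
begin

definition env_at :: "nat \<Rightarrow> nat \<Rightarrow> env" where
  "env_at s t = ((nA, seg pA s), (nB, seg pB t))"

definition tree_B :: "baire \<Rightarrow> nat list set" where
  "tree_B r = {u. wB r (list_encode u) = 1}"

fun tree :: "nat \<Rightarrow> baire \<Rightarrow> nat list set" where
  "tree 0 r = {u. wA r (list_encode u) = 1}"
| "tree (Suc k) r =
     {u. level nT (Suc k) (env_at (length u) (length u), seg r (length u), u) = Some True}"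

section \<open>Correctness and eventual definedness of the finite approximations\<close>

lemma level_cut:
  assumes "length u \<le> t1" "length u \<le> t2" "length u \<le> t3"
  shows "level nT (Suc k) (env_at t1 t2, seg r t3, u) =
    level nT (Suc k) (env_at (length u) (length u), seg r (length u), u)"
  using assms by (simp add: level_Suc env_at_def cut_def traced_def take_seg)

lemma level_sound:
  assumes "r \<in> D" "level nT k (env_at t1 t2, seg r t3, u) = Some b"
  shows "b \<longleftrightarrow> u \<in> tree k r"
proof (cases k)
  case 0
  then show ?thesis
    using assms(2) member_app(1)[OF wA[OF assms(1)]] by (simp add: level_def level_base_def env_at_def)
next
  case (Suc j)
  then have "length u \<le> t1" "length u \<le> t2" "length u \<le> t3"
    using assms(2) by (auto simp: level_Suc env_at_def split: if_splits)
  from level_cut[OF this, of j r] show ?thesis using assms(2) Suc by auto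
qed

lemma level_complete:
  assumes "r \<in> D"
  shows "\<exists>N. \<forall>t1\<ge>N. \<forall>t2\<ge>N. \<forall>t3\<ge>N. level nT k (env_at t1 t2, seg r t3, u) = Some (u \<in> tree k r)"
proof (cases k)
  case 0
  then show ?thesis
    using member_app(2)[OF wA[OF assms], of u] by (simp add: level_def level_base_def env_at_def) blast
next
  case (Suc j)
  have "level nT k (env_at t1 t2, seg r t3, u) = Some (u \<in> tree k r)"
    if "t1 \<ge> length u" "t2 \<ge> length u" "t3 \<ge> length u" for t1 t2 t3
  proof -
    have "\<exists>b. level nT k (env_at t1 t2, seg r t3, u) = Some b"
      using that by (simp add: Suc level_Suc env_at_def)
    then obtain b where b: "level nT k (env_at t1 t2, seg r t3, u) = Some b" ..
    with level_sound[OF assms b] show ?thesis by simp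
  qed
  then show ?thesis by blast
qed

lemma label_sound:
  assumes "r \<in> D" "label nT k (env_at t1 t2) (seg r t3) s = Some b"
  shows "b \<longleftrightarrow> sep (tree k r) (tree_B r) s"
proof -
  from assms(2) obtain x y where
    x: "level nT k (env_at t1 t2, seg r t3, evens s) = Some x" and
    y: "member (app (nB, seg pB t2) (seg r t3)) (odds s) = Some y" and
    b: "b = (if even (length s) then x \<and> \<not> y else \<not> (x \<and> y))"
    by (auto simp: label_def sep_opt_def env_at_def split: option.splits)
  show ?thesis
    using level_sound[OF assms(1) x] member_app(1)[OF wB[OF assms(1)] y] b
    by (simp add: sep_def tree_B_def)
qed

lemma label_complete:
  assumes "r \<in> D"
  shows "\<exists>N. \<forall>t1\<ge>N. \<forall>t2\<ge>N. \<forall>t3\<ge>N.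
    label nT k (env_at t1 t2) (seg r t3) s = Some (sep (tree k r) (tree_B r) s)"
proof -
  from level_complete[OF assms] obtain N where N: "\<And>t1 t2 t3. t1 \<ge> N \<Longrightarrow> t2 \<ge> N \<Longrightarrow> t3 \<ge> N \<Longrightarrow>
    level nT k (env_at t1 t2, seg r t3, evens s) = Some (evens s \<in> tree k r)" by blast
  from member_app(2)[OF wB[OF assms]] obtain M where M: "\<And>t2 t3. t2 \<ge> M \<Longrightarrow> t3 \<ge> M \<Longrightarrow>
    member (app (nB, seg pB t2) (seg r t3)) (odds s) = Some (wB r (list_encode (odds s)) = 1)" by blast
  have snd_env: "snd (env_at t1 t2) = (nB, seg pB t2)" for t1 t2
    by (simp add: env_at_def)
  show ?thesis
    by (intro exI[of _ "max N M"])
      (simp add: label_def snd_env N M sep_opt_def sep_def tree_B_def)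
qed

text \<open>The lists \<open>\<tau> n\<close> are segments of the single name \<open>T r q\<close>
  with lengths tending to infinity. Hence the labels tested along the branch settle to those of
  \<open>T r q\<close>, and \<open>okay_cert\<close> applies.\<close>

lemma cert_of_branch:
  assumes r: "r \<in> D" and f: "\<And>n. n \<ge> N \<Longrightarrow> map f [0..<n] \<in> tree (Suc k) r"
  defines "q \<equiv> \<lambda>i. fst (prod_decode (f i))"
  shows "cert (sep (tree k (T r q)) (tree_B (T r q))) (\<lambda>i. snd (prod_decode (f i)))"
proof -
  define \<tau> where "\<tau> = (\<lambda>n. app (nT, seg r n) (seg q n))"
  note \<tau> = app_seg[OF T[OF r, of q]]
  show ?thesis
  proof (rule okay_cert)
    fix n assume "n \<ge> N"
    from f[OF this] have "seg f n \<in> tree (Suc k) r" by (simp add: seg_def)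
    then show "okay (seg (\<lambda>i. snd (prod_decode (f i))) n)
        (\<lambda>c. label nT k (env_at n n) (\<tau> n) (list_decode c))"
      by (simp add: level_Suc env_at_def cut_def take_seg traced_def \<tau>_def map_seg q_def)
  next
    fix c
    from label_complete[OF T_D[OF r, of q]] obtain M where M: "\<And>t1 t2 t3. t1 \<ge> M \<Longrightarrow> t2 \<ge> M \<Longrightarrow> t3 \<ge> M \<Longrightarrow>
      label nT k (env_at t1 t2) (seg (T r q) t3) (list_decode c) =
        Some (sep (tree k (T r q)) (tree_B (T r q)) (list_decode c))" by blast
    from \<tau>(2)[of M] obtain K where K: "\<And>n. n \<ge> K \<Longrightarrow> M \<le> length (\<tau> n)" unfolding \<tau>_def by blast
    have "label nT k (env_at n n) (\<tau> n) (list_decode c) =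
        Some (sep (tree k (T r q)) (tree_B (T r q)) (list_decode c))" if "n \<ge> max M K" for n
    proof -
      have "\<tau> n = seg (T r q) (length (\<tau> n))" unfolding \<tau>_def by (rule \<tau>(1))
      then show ?thesis using M[of n n "length (\<tau> n)"] K[of n] that by simp
    qed
    then show "\<exists>M. \<forall>n\<ge>M. label nT k (env_at n n) (\<tau> n) (list_decode c) =
        Some (sep (tree k (T r q)) (tree_B (T r q)) (list_decode c))" by blast
  qed
qed

text \<open>Every label that is already known is correct, so no finite part of the certificate shows
  a violation; convergence plays no part in this direction.\<close>

lemma ill_founded_of_cert:
  assumes r: "r \<in> D" and g: "cert (sep (tree k (T r q)) (tree_B (T r q))) g"
  shows "ill_founded (tree (Suc k) r)"
  unfolding ill_founded_def
proof (intro exI[of _ "\<lambda>i. prod_encode (q i, g i)"] allI)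
  fix n
  define \<tau> where "\<tau> = app (nT, seg r n) (seg q n)"
  have \<tau>: "\<tau> = seg (T r q) (length \<tau>)"
    unfolding \<tau>_def by (rule app_seg(1)[OF T[OF r]])
  have "okay (seg g n) (\<lambda>c. label nT k (env_at n n) \<tau> (list_decode c))"
    using label_sound[OF T_D[OF r]] \<tau> by (intro cert_okay[OF g]) metis
  then show "map (\<lambda>i. prod_encode (q i, g i)) [0..<n] \<in> tree (Suc k) r"
    by (simp add: level_Suc env_at_def cut_def take_seg traced_def \<tau>_def map_seg flip: seg_def)
qed

text \<open>Both claims go through one induction: disjointness of level \<open>k\<close> at the
  traced name is what makes its code well-founded, and only then does a certificate prove the code
  true.\<close>

lemma tree_invariants:
  assumes "r \<in> D"
  shows "branch (tree k r) \<Longrightarrow> ill_founded (tree k r)"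
    and "\<not> (branch (tree k r) \<and> branch (tree_B r))"
proof -
  have "(branch (tree k r) \<longrightarrow> ill_founded (tree k r)) \<and> \<not> (branch (tree k r) \<and> branch (tree_B r))"
    using assms
  proof (induction k arbitrary: r)
    case 0
    then show ?case using branch_A branch_B disjoint by (auto simp: tree_B_def)
  next
    case (Suc k)
    have "ill_founded (tree (Suc k) r) \<and> \<not> branch (tree_B r)" if br: "branch (tree (Suc k) r)"
    proof -
      from br obtain f N where f: "\<And>n. n \<ge> N \<Longrightarrow> map f [0..<n] \<in> tree (Suc k) r"
        unfolding branch_def by blast
      define q where "q = (\<lambda>i. fst (prod_decode (f i)))"
      have cert: "cert (sep (tree k (T r q)) (tree_B (T r q))) (\<lambda>i. snd (prod_decode (f i)))"
        unfolding q_def by (rule cert_of_branch[OF Suc.prems f])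
      interpret bar_leaves "sep (tree k (T r q)) (tree_B (T r q))"
        using Suc.IH[OF T_D[OF Suc.prems]] by (intro bar_leaves_sep) blast
      from cert have "value_at []" using ex_cert_iff by blast
      \<comment> \<open>An ill-founded tree on the side of \<open>B\<close> would make the code
        false. This is transported back to \<open>r\<close> by \<open>invariant_B\<close>.\<close>
      then have "\<not> ill_founded (tree_B (T r q))"
        using ill_founded_right_value_at bar_leaves_axioms by blast
      moreover have "ill_founded (tree_B r) \<Longrightarrow> ill_founded (tree_B (T r q))"
        using invariant_B[OF Suc.prems] by (simp add: tree_B_def)
      ultimately have "\<not> branch (tree_B r)"
        using branch_B[OF Suc.prems] by (auto simp: tree_B_def)
      with ill_founded_of_cert[OF Suc.prems cert] show ?thesis by blast
    qed
    then show ?case by blast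
  qed
  then show "branch (tree k r) \<Longrightarrow> ill_founded (tree k r)"
    and "\<not> (branch (tree k r) \<and> branch (tree_B r))" by blast+
qed

end


context lusin
begin

section \<open>The increasing sequence of separating sets of names\<close>

definition separated :: "nat \<Rightarrow> baire \<Rightarrow> bool" where
  "separated k r \<longleftrightarrow> bar_leaves.value_at (sep (tree k r) (tree_B r)) []"

lemma bar_leaves_tree: "r \<in> D \<Longrightarrow> bar_leaves (sep (tree k r) (tree_B r))"
  by (intro bar_leaves_sep tree_invariants(2))

lemma borel_value_separated:
  "r \<in> D \<Longrightarrow> borel_value (bcode (sep (tree k r) (tree_B r))) (separated k r)"
  using bar_leaves.borel_value_value_at[OF bar_leaves_tree, of r k "[]"] by (simp add: separated_def)

lemma separated_left: "r \<in> D \<Longrightarrow> ill_founded (tree k r) \<Longrightarrow> separated k r"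
  unfolding separated_def by (intro ill_founded_left_value_at bar_leaves_tree)

lemma separated_right: "r \<in> D \<Longrightarrow> ill_founded (tree_B r) \<Longrightarrow> \<not> separated k r"
  unfolding separated_def by (intro ill_founded_right_value_at bar_leaves_tree)

text \<open>A true code has a certificate, which together with \<open>q\<close> is an infinite path
  in the next tree at \<open>r\<close>; the next code must be true there.\<close>

lemma separated_Suc:
  assumes "r \<in> D" "separated k (T r q)"
  shows "separated (Suc k) r"
proof -
  have "\<exists>g. cert (sep (tree k (T r q)) (tree_B (T r q))) g"
    using bar_leaves.ex_cert_iff[OF bar_leaves_tree[OF T_D[OF assms(1)]]] assms(2)
    by (simp add: separated_def)
  then show ?thesis
    using ill_founded_of_cert separated_left assms(1) by blast
qed

end

subsection \<open>The separating machine\<close>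

definition zeros :: "nat list \<Rightarrow> nat" where
  "zeros \<sigma> = foldr (\<lambda>y n. if y = 0 then Suc n else 0) \<sigma> 0"

lemma prec_zeros [prec_intros]: "prec \<sigma> \<Longrightarrow> prec (\<lambda>x. zeros (\<sigma> x))"
  unfolding zeros_def by (intro prec_intros)

definition parse :: "nat list \<Rightarrow> nat \<times> nat list" where
  "parse \<sigma> = (zeros \<sigma>, drop (Suc (zeros \<sigma>)) \<sigma>)"

lemma prec_parse [prec_intros]: "prec \<sigma> \<Longrightarrow> prec (\<lambda>x. parse (\<sigma> x))"
  unfolding parse_def by (intro prec_intros)

lemma zeros_seg:
  assumes "a = (cons_seq 0 ^^ n) (cons_seq 1 p)"
  shows "zeros (seg a t) = min n t"
  using assms
proof (induction n arbitrary: a t)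
  case 0
  then show ?case
    by (cases t) (simp_all add: seg_def zeros_def upt_conv_Cons cons_seq_def del: upt_Suc)
next
  case (Suc n)
  define a' where "a' = (cons_seq 0 ^^ n) (cons_seq 1 p)"
  have a: "a = cons_seq 0 a'" using Suc.prems by (simp add: a'_def)
  show ?case
  proof (cases t)
    case 0
    then show ?thesis by (simp add: seg_def zeros_def)
  next
    case (Suc t')
    have "seg a (Suc t') = 0 # seg a' t'"
      by (rule nth_equalityI) (auto simp: seg_def a cons_seq_def nth_Cons' simp del: upt_Suc split: nat.split)
    then show ?thesis using Suc.IH[OF a'_def, of t'] Suc by (simp add: zeros_def)
  qed
qed

lemma zeros_one_add: "(cons_seq 0 ^^ n) (cons_seq 1 p) (Suc n + i) = p i"
  by (induction n) (simp_all add: cons_seq_def)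

lemma parse_seg:
  assumes "a = (cons_seq 0 ^^ n) (cons_seq 1 p)" "n < t"
  shows "parse (seg a t) = (n, seg p (t - Suc n))"
proof -
  have z: "zeros (seg a t) = n" using zeros_seg[OF assms(1)] assms(2) by simp
  have "drop (Suc n) (seg a t) = seg p (t - Suc n)"
    by (rule nth_equalityI)
      (use zeros_one_add[of n p] assms(1) in \<open>simp_all add: seg_def\<close>)
  with z show ?thesis by (simp add: parse_def)
qed

lemma evens_seg: "evens (seg (pair_seq p q) t) = seg p (t div 2)"
  and odds_seg: "odds (seg (pair_seq p q) t) = seg q (t div 2)"
  by (auto simp: evens_def odds_def seg_def[of p] seg_def[of q] nth0_seg pair_seq_def)

text \<open>\<open>\<rho>\<close> is a segment of
  \<open>\<langle>\<langle>a, b\<rangle>, r\<rangle>\<close>. It must show the 1 that ends the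
  leading zeros of \<open>a\<close> and of \<open>b\<close>. The two outer layers of the code are
  nodes of the union; its first index selects the level.\<close>

definition separator :: "nat \<Rightarrow> nat \<Rightarrow> nat list \<Rightarrow> nat option" where
  "separator n k \<rho> =
     (let a = evens (evens \<rho>); b = odds (evens \<rho>)
      in if zeros a < length a \<and> zeros b < length b then
        (case list_decode k of
           [] \<Rightarrow> Some 1
         | i # w \<Rightarrow>
           (case w of
              [] \<Rightarrow> Some 1
            | j # s \<Rightarrow>
              (case label n i (parse a, parse b) (odds \<rho>) s of
                 None \<Rightarrow> None
               | Some leaf \<Rightarrow> Some (if leaf then 0 else 1))))
      else None)"

lemma prec_separator: "prec (\<lambda>z. separator n (fst z) (snd z))"
  unfolding separator_def Let_def by (intro prec_intros)

lemma (in lusin) separator_computes: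
  assumes r: "r \<in> D" and a: "a = (cons_seq 0 ^^ nA) (cons_seq 1 pA)"
    and b: "b = (cons_seq 0 ^^ nB) (cons_seq 1 pB)"
  defines "R \<equiv> pair_seq (pair_seq a b) r"
    and "c \<equiv> bcode (union_leaf (\<lambda>n. sep (tree n r) (tree_B r)))"
  shows "separator nT k (seg R t) = Some v \<Longrightarrow> v = c k"
    and "\<exists>t. separator nT k (seg R t) \<noteq> None"
proof -
  have eq: "separator nT k (seg R t) = (if nA < t div 2 div 2 \<and> nB < t div 2 div 2 then
      (case list_decode k of [] \<Rightarrow> Some 1 | i # w \<Rightarrow> (case w of [] \<Rightarrow> Some 1 | j # s \<Rightarrow>
        (case label nT i (env_at (t div 2 div 2 - Suc nA) (t div 2 div 2 - Suc nB)) (seg r (t div 2)) s of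
           None \<Rightarrow> None | Some leaf \<Rightarrow> Some (if leaf then 0 else 1)))) else None)" for t
  proof -
    have "min n l < l \<longleftrightarrow> n < l" for n l :: nat by auto
    then show ?thesis
      by (simp add: separator_def R_def evens_seg odds_seg zeros_seg[OF a] zeros_seg[OF b]
          parse_seg[OF a] parse_seg[OF b] env_at_def cong: if_cong list.case_cong)
  qed
  show "separator nT k (seg R t) = Some v \<Longrightarrow> v = c k"
    using label_sound[OF r]
    by (auto simp: eq c_def bcode_def union_leaf_def split: if_splits list.splits option.splits)
  show "\<exists>t. separator nT k (seg R t) \<noteq> None"
  proof (cases "\<exists>i j s. list_decode k = i # j # s")
    case True
    then obtain i j s where k: "list_decode k = i # j # s" by blast
    from label_complete[OF r] obtain N where N: "\<And>t1 t2 t3. t1 \<ge> N \<Longrightarrow> t2 \<ge> N \<Longrightarrow> t3 \<ge> N \<Longrightarrow>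
      label nT i (env_at t1 t2) (seg r t3) s = Some (sep (tree i r) (tree_B r) s)" by blast
    \<comment> \<open>Unpairing halves the length twice; the \<open>N\<close> spare entries survive
      the removal of either prefix, of length \<open>Suc nA\<close> or
      \<open>Suc nB\<close>.\<close>
    define t where "t = 4 * (N + nA + nB + 1)"
    have "t div 2 div 2 = N + nA + nB + 1" "t div 2 \<ge> N" by (simp_all add: t_def)
    then have "separator nT k (seg R t) \<noteq> None"
      by (simp add: eq k N)
    then show ?thesis ..
  next
    case False
    define t where "t = 4 * (nA + nB + 1)"
    have "t div 2 div 2 = nA + nB + 1" by (simp add: t_def)
    then have "separator nT k (seg R t) \<noteq> None"
      using False by (auto simp: eq split: list.split)
    then show ?thesis ..
  qed
qed

text \<open>A name of the separating function is the fixed machine together with the name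
  \<open>p\<close> of the given pair as its parameter. The Lusin map itself thus only prefixes its
  input; all work is deferred to the machine \<open>m\<close>.\<close>

lemma computable_prefix: "\<exists>n. \<forall>p. machine_map (machine n) p = Some ((cons_seq 0 ^^ m) (cons_seq 1 p))"
proof -
  define f where "f = (\<lambda>k (\<sigma> :: nat list). if k < m then Some 0 else if k = m then Some 1 else lookup \<sigma> (k - Suc m))"
  have "prec (\<lambda>z. f (fst z) (snd z))"
    unfolding f_def by (intro prec_intros)
  from prec_machine[OF this] obtain n where n: "\<And>p r. (\<forall>k. (\<forall>t v. f k (seg p t) = Some v \<longrightarrow> v = r k) \<and>
      (\<exists>t. f k (seg p t) \<noteq> None)) \<Longrightarrow> machine_map (machine n) p = Some r" by blast
  have less: "k < m \<Longrightarrow> (cons_seq 0 ^^ m) (cons_seq 1 p) k = 0" for k p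
  proof (induction m arbitrary: k)
    case (Suc m)
    then show ?case by (cases k) (simp_all add: cons_seq_def)
  qed simp
  have eq: "(cons_seq 0 ^^ m) (cons_seq 1 p) m = 1" for p
    by (induction m) (simp_all add: cons_seq_def)
  have greater: "k > m \<Longrightarrow> (cons_seq 0 ^^ m) (cons_seq 1 p) k = p (k - Suc m)" for k p
    using zeros_one_add[of m p "k - Suc m"] by simp
  have "machine_map (machine n) p = Some ((cons_seq 0 ^^ m) (cons_seq 1 p))" for p
  proof (intro n allI conjI)
    show "f k (seg p t) = Some v \<longrightarrow> v = (cons_seq 0 ^^ m) (cons_seq 1 p) k" for k t v
      using less[of k p] eq[of p] greater[of k p]
      by (cases k m rule: linorder_cases) (auto simp: f_def lookup_seg split: if_splits)
    show "\<exists>t. f k (seg p t) \<noteq> None" for k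
      by (intro exI[of _ "Suc k"]) (auto simp: f_def lookup_seg)
  qed
  then show ?thesis by blast
qed

text \<open>A coded tree is closed under prefixes, so eventual membership along a path gives
  membership of all its initial segments.\<close>

lemma codes_tree_branch:
  assumes "codes_tree w S"
  shows "{u. w (list_encode u) = 1} = S" and "branch S \<Longrightarrow> ill_founded S"
proof -
  show "{u. w (list_encode u) = 1} = S"
    using assms by (auto simp: codes_tree_def split: if_splits)
  assume "branch S"
  then obtain f N where f: "\<And>n. n \<ge> N \<Longrightarrow> map f [0..<n] \<in> S" unfolding branch_def by blast
  have "map f [0..<n] \<in> S" for n
  proof -
    have "prefix (map f [0..<n]) (map f [0..<n + N])"
      by (simp add: upt_add_eq_append[of 0 n N])
    then show ?thesis
      using f[of "n + N"] assms unfolding codes_tree_def is_tree_def by (metis le_add2)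
  qed
  then show "ill_founded S" unfolding ill_founded_def by blast
qed

lemma sigma11_realizer:
  assumes "fun_name X sigma11_space a f"
  obtains n p w where "a = (cons_seq 0 ^^ n) (cons_seq 1 p)"
    "\<And>r. r \<in> dom (rep X) \<Longrightarrow> machine_map (machine n) (pair_seq p r) = Some (w r)"
    "\<And>r. r \<in> dom (rep X) \<Longrightarrow> branch {u. w r (list_encode u) = 1} \<Longrightarrow>
      ill_founded {u. w r (list_encode u) = 1}"
    "\<And>r x. rep X r = Some x \<Longrightarrow> ill_founded {u. w r (list_encode u) = 1} \<longleftrightarrow> f x"
proof -
  from assms obtain n p where a: "a = (cons_seq 0 ^^ n) (cons_seq 1 p)" and
    re: "realizes (\<lambda>q. machine_map (machine n) (pair_seq p q)) X sigma11_space f"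
    unfolding fun_name_def by blast
  define w where "w = (\<lambda>r. the (machine_map (machine n) (pair_seq p r)))"
  have w: "machine_map (machine n) (pair_seq p r) = Some (w r) \<and>
      (\<exists>S. codes_tree (w r) S \<and> f x = ill_founded S)" if "rep X r = Some x" for r x
    using re that unfolding realizes_def rep_sigma11_space_eq_Some by (fastforce simp: w_def)
  show ?thesis
  proof (rule that[OF a])
    show "machine_map (machine n) (pair_seq p r) = Some (w r)" if "r \<in> dom (rep X)" for r
      using w that by blast
    show "ill_founded {u. w r (list_encode u) = 1}"
      if "r \<in> dom (rep X)" "branch {u. w r (list_encode u) = 1}" for r
      using that w codes_tree_branch by (metis domD)
    show "ill_founded {u. w r (list_encode u) = 1} \<longleftrightarrow> f x" if "rep X r = Some x" for r x
      using w[OF that] codes_tree_branch(1) by metis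
  qed
qed

theorem theorem56:
  fixes X :: "'a repspace"
  assumes "represented_space X"
    and "effectively_traceable (rep X)"
  shows "(\<forall>z\<in>Lusin_dom X. Lusin X z \<noteq> {}) \<and>
    mv_computable
      (prod_space (cont_space X sigma11_space) (cont_space X sigma11_space))
      (cont_space X borel_space)
      (Lusin_dom X) (Lusin X)"
proof -
  let ?S = "cont_space X sigma11_space"
  from assms(2) obtain T' where T': "computable2 T'" "dom T' = dom (rep X) \<times> UNIV"
    "\<And>p. p \<in> dom (rep X) \<Longrightarrow> {r. \<exists>q. T' (p, q) = Some r} = {r. rep X r = rep X p}"
    unfolding effectively_traceable_def by blast
  from T'(1) obtain G nT where G: "G \<subseteq>\<^sub>m machine_map (machine nT)"
    "\<And>p q. (p, q) \<in> dom T' \<Longrightarrow> G (pair_seq p q) = T' (p, q)"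
    unfolding computable2_def computable_def by blast
  define T where "T = (\<lambda>p q. the (T' (p, q)))"
  have T'_eq: "T' (p, q) = Some (T p q)" if "p \<in> dom (rep X)" for p q
  proof -
    have "(p, q) \<in> dom T'" using that T'(2) by simp
    then show ?thesis by (auto simp: T_def)
  qed
  have T: "machine_map (machine nT) (pair_seq p q) = Some (T p q)" if "p \<in> dom (rep X)" for p q
  proof -
    have "G (pair_seq p q) = Some (T p q)"
      using G(2)[of p q] T'_eq[OF that] by (auto simp: dom_def)
    then show ?thesis using G(1) unfolding map_le_def by (metis domI)
  qed
  have rep_T: "rep X (T p q) = rep X p" if "p \<in> dom (rep X)" for p q
    using T'(3)[OF that] T'_eq[OF that] by blast
  have ex_T: "\<exists>q. T p q = r" if "p \<in> dom (rep X)" "rep X r = rep X p" for p r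
    using T'(3)[OF that(1)] T'_eq[OF that(1)] that(2) by auto
  from prec_machine[OF prec_separator] obtain m where m:
    "\<And>p r. (\<forall>k. (\<forall>t v. separator nT k (seg p t) = Some v \<longrightarrow> v = r k) \<and>
      (\<exists>t. separator nT k (seg p t) \<noteq> None)) \<Longrightarrow> machine_map (machine m) p = Some r" by blast
  \<comment> \<open>Established for an arbitrary name of the pair, this yields both a value of the
    map and a realizer.\<close>
  have main: "\<exists>y. rep (cont_space X borel_space) ((cons_seq 0 ^^ m) (cons_seq 1 P)) = Some y \<and> y \<in> Lusin X z"
    if z: "z \<in> Lusin_dom X" and P: "rep (prod_space ?S ?S) P = Some z" for P z
  proof -
    from z obtain A B where AB: "z = (chi X A, chi X B)" "A \<subseteq> points X" "B \<subseteq> points X" "A \<inter> B = {}"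
      unfolding Lusin_dom_def by blast
    from P obtain a b where ab: "P = pair_seq a b"
      "fun_name X sigma11_space a (chi X A)" "fun_name X sigma11_space b (chi X B)"
      unfolding AB(1) rep_prod_space_eq_Some rep_cont_space_eq_Some[OF assms(1)] by blast
    from ab(2) obtain nA pA wA where A: "a = (cons_seq 0 ^^ nA) (cons_seq 1 pA)"
      "\<And>r. r \<in> dom (rep X) \<Longrightarrow> machine_map (machine nA) (pair_seq pA r) = Some (wA r)"
      "\<And>r. r \<in> dom (rep X) \<Longrightarrow> branch {u. wA r (list_encode u) = 1} \<Longrightarrow>
        ill_founded {u. wA r (list_encode u) = 1}"
      "\<And>r x. rep X r = Some x \<Longrightarrow> ill_founded {u. wA r (list_encode u) = 1} \<longleftrightarrow> chi X A x"
      by (rule sigma11_realizer) blast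
    from ab(3) obtain nB pB wB where B: "b = (cons_seq 0 ^^ nB) (cons_seq 1 pB)"
      "\<And>r. r \<in> dom (rep X) \<Longrightarrow> machine_map (machine nB) (pair_seq pB r) = Some (wB r)"
      "\<And>r. r \<in> dom (rep X) \<Longrightarrow> branch {u. wB r (list_encode u) = 1} \<Longrightarrow>
        ill_founded {u. wB r (list_encode u) = 1}"
      "\<And>r x. rep X r = Some x \<Longrightarrow> ill_founded {u. wB r (list_encode u) = 1} \<longleftrightarrow> chi X B x"
      by (rule sigma11_realizer) blast
    have pts: "x \<in> points X" if "rep X r = Some x" for r x
      using that assms(1) by (auto simp: represented_space_def ran_def)
    have illA: "ill_founded {u. wA r (list_encode u) = 1} \<longleftrightarrow> x \<in> A" if "rep X r = Some x" for r x
      using A(4)[OF that] pts[OF that] by (simp add: chi_def)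
    have illB: "ill_founded {u. wB r (list_encode u) = 1} \<longleftrightarrow> x \<in> B" if "rep X r = Some x" for r x
      using B(4)[OF that] pts[OF that] by (simp add: chi_def)
    interpret lusin nA nB nT pA pB "dom (rep X)" T wA wB
    proof
      show "T r q \<in> dom (rep X)" if "r \<in> dom (rep X)" for r q
        using rep_T[OF that] that by (simp add: dom_def)
      show "ill_founded {u. wB (T r q) (list_encode u) = 1}"
        if "r \<in> dom (rep X)" "ill_founded {u. wB r (list_encode u) = 1}" for r q
      proof -
        from that(1) obtain x where x: "rep X r = Some x" by blast
        then have "rep X (T r q) = Some x" using rep_T[OF that(1)] by simp
        with x illB that(2) show ?thesis by blast
      qed
      show "\<not> ill_founded {u. wB r (list_encode u) = 1}"
        if "r \<in> dom (rep X)" "ill_founded {u. wA r (list_encode u) = 1}" for r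
        using that illA illB AB(4) by blast
    qed (fact A B T)+
    \<comment> \<open>A point belongs to \<open>C\<close> if some name of it is separated at some
      level; the next fact shows that any other name may be used instead.\<close>
    define C where "C = {x \<in> points X. \<exists>r n. rep X r = Some x \<and> separated n r}"
    have C_iff: "x \<in> C \<longleftrightarrow> (\<exists>n. separated n r)" if r: "rep X r = Some x" for r x
    proof
      assume "x \<in> C"
      then obtain r' n where r': "rep X r' = Some x" "separated n r'" unfolding C_def by blast
      \<comment> \<open>Surjectivity of the trace onto the names of a point: the separated name
        \<open>r'\<close> is reached from \<open>r\<close>, at the cost of one level.\<close>
      with r obtain q where "T r q = r'" using ex_T[of r r'] by auto
      with r r' show "\<exists>n. separated n r" using separated_Suc[of r n q] by blast
    qed (use r pts in \<open>auto simp: C_def\<close>)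
    have "realizes (\<lambda>q. machine_map (machine m) (pair_seq P q)) X borel_space (chi X C)"
      unfolding realizes_def
    proof (intro allI impI)
      fix r x assume r: "rep X r = Some x"
      then have rD: "r \<in> dom (rep X)" by blast
      let ?c = "bcode (union_leaf (\<lambda>n. sep (tree n r) (tree_B r)))"
      have "machine_map (machine m) (pair_seq P r) = Some ?c"
        unfolding ab(1) using separator_computes[OF rD A(1) B(1)] by (intro m) blast
      moreover have "borel_value ?c (\<exists>n. separated n r)"
        using borel_value_separated[OF rD] by (rule borel_value_union_leaf)
      moreover have "chi X C x \<longleftrightarrow> (\<exists>n. separated n r)"
        using C_iff[OF r] pts[OF r] by (simp add: chi_def)
      ultimately show "\<exists>q. machine_map (machine m) (pair_seq P r) = Some q \<and>
          rep borel_space q = Some (chi X C x)"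
        by (simp add: rep_borel_space_eq_Some)
    qed
    moreover have "chi X C \<in> points X \<rightarrow>\<^sub>E points borel_space"
      by (auto simp: chi_def borel_space_def)
    ultimately have name: "fun_name X borel_space ((cons_seq 0 ^^ m) (cons_seq 1 P)) (chi X C)"
      unfolding fun_name_def by blast
    have "A \<subseteq> C"
    proof
      fix x assume "x \<in> A"
      then obtain r where r: "rep X r = Some x"
        using AB(2) assms(1) by (auto simp: represented_space_def ran_def)
      then have "separated 0 r"
        using illA[OF r] \<open>x \<in> A\<close> by (intro separated_left) auto
      with C_iff[OF r] show "x \<in> C" by blast
    qed
    moreover have "C \<inter> B = {}"
    proof -
      have False if "x \<in> C" "x \<in> B" for x
      proof -
        from that(1) obtain r n where r: "rep X r = Some x" "separated n r" unfolding C_def by blast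
        then show False
          using separated_right[of r n] illB[OF r(1)] that(2) by (auto simp: tree_B_def)
      qed
      then show ?thesis by blast
    qed
    moreover have "C \<subseteq> points X" unfolding C_def by blast
    moreover have "chi X C \<in> points (cont_space X borel_space)"
      using name by (auto simp: cont_space_def)
    ultimately have "chi X C \<in> Lusin X z"
      unfolding Lusin_def using AB by blast
    with name show ?thesis using rep_cont_space_eq_Some[OF assms(1)] by blast
  qed
  have named: "\<exists>a. rep ?S a = Some f" if "f \<in> points ?S" for f
    using that unfolding rep_cont_space_eq_Some[OF assms(1)] by (simp add: cont_space_def)
  have "Lusin X z \<noteq> {}" if z: "z \<in> Lusin_dom X" for z
  proof -
    from z obtain f g where "z = (f, g)" "f \<in> points ?S" "g \<in> points ?S"
      unfolding Lusin_dom_def by blast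
    then obtain a b where "z = (f, g)" "rep ?S a = Some f" "rep ?S b = Some g"
      using named by blast
    then have "rep (prod_space ?S ?S) (pair_seq a b) = Some z"
      by (simp add: rep_prod_space_eq_Some)
    from main[OF z this] show ?thesis by blast
  qed
  moreover have "mv_computable (prod_space ?S ?S) (cont_space X borel_space) (Lusin_dom X) (Lusin X)"
  proof -
    from computable_prefix obtain n where
      n: "\<And>p. machine_map (machine n) p = Some ((cons_seq 0 ^^ m) (cons_seq 1 p))" by blast
    show ?thesis
      unfolding mv_computable_def
    proof (intro exI[of _ "machine_map (machine n)"] conjI ballI allI impI)
      show "computable (machine_map (machine n))"
        unfolding computable_def by (intro exI[of _ n]) simp
      fix z P assume "z \<in> Lusin_dom X" "rep (prod_space ?S ?S) P = Some z"
      from main[OF this] show "\<exists>q y. machine_map (machine n) P = Some q \<and>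
          rep (cont_space X borel_space) q = Some y \<and> y \<in> Lusin X z"
        by (simp add: n)
    qed
  qed
  ultimately show ?thesis by blast
qed

end
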